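(* Let $K$ be an arbitrary field, $S=K[x_1,\dots,x_n]$ with the standard grading, $d\ge 2$ and $\mathbf t=(t_1,\dots,t_{d-1})\in\mathbb Z_{\ge 0}^{d-1}$. Let $I\subset S$ be a $\mathbf t$-spread strongly stable ideal, and let $I^{\mathbf t,\mathrm{lex}}\subset S$ be the unique $\mathbf t$-spread lex ideal with $f_{\mathbf t}(I^{\mathbf t,\mathrm{lex}})=f_{\mathbf t}(I)$. Then $$\beta_{i,j}(I)\le\beta_{i,j}(I^{\mathbf t,\mathrm{lex}})\qquad\text{for all } i \text{ and } j.$$
   Context: A monomial $u=x_{j_1}\cdots x_{j_\ell}$ of $S$ with $1\le j_1\le\cdots\le j_\ell\le n$ and degree $\ell\le d$ is $\mathbf t$-spread if $j_{i+1}-j_i\ge t_i$ for $i=1,\dots,\ell-1$ (so all $\mathbf t$-spread monomials have degree at most $d$). $M_{n,\ell,\mathbf t}$ is the set of all $\mathbf t$-spread monomials of degree $\ell$ in $S$. A $\mathbf t$-spread ideal is a monomial ideal generated by $\mathbf t$-spread monomials. For a monomial ideal $I$, $[I_\ell]_{\mathbf t}$ is the set of all $\mathbf t$-spread monomials of degree $\ell$ in $I$. The $f_{\mathbf t}$-vector of $I$ is $f_{\mathbf t}(I)=(f_{\mathbf t,-1}(I),f_{\mathbf t,0}(I),\dots,f_{\mathbf t,d-1}(I))$ with $f_{\mathbf t,\ell-1}(I)=|M_{n,\ell,\mathbf t}|-|[I_\ell]_{\mathbf t}|$ for $0\le \ell\le d$. A set $L\subseteq M_{n,\ell,\mathbf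 t}$ is a $\mathbf t$-spread strongly stable set if for all $u\in L$ and all $j<i$ such that $x_i$ divides $u$ and $x_j(u/x_i)$ is $\mathbf t$-spread, one has $x_j(u/x_i)\in L$. It is a $\mathbf t$-spread lex set if for all $u\in L$ and $v\in M_{n,\ell,\mathbf t}$ with $v\ge_{\mathrm{lex}}u$ one has $v\in L$, where $\ge_{\mathrm{lex}}$ is the lexicographic order induced by $x_1>\dots>x_n$. The empty set is both. A $\mathbf t$-spread ideal $I$ is a $\mathbf t$-spread strongly stable (resp. lex) ideal if $[I_\ell]_{\mathbf t}$ is a $\mathbf t$-spread strongly stable (resp. lex) set for all $\ell$. For every $\mathbf t$-spread strongly stable ideal $I$ there is a unique $\mathbf t$-spread lex ideal with the same $f_{\mathbf t}$-vector as $I$; it is denoted $I^{\mathbf t,\mathrm{lex}}$. The graded Betti numbers are $\beta_{i,j}(I)=\dim_K\mathrm{Tor}_i^S(K,I)_j$. *)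

theory Defs
  imports Complex_Main "HOL-Library.Function_Algebras" "HOL-Library.Poly_Mapping" "HOL-Algebra.Ideal"
begin

section \<open>The polynomial ring\<close>

text \<open>A monomial is identified with its exponent vector. The variables of
  \<open>S = K[x\<^sub>1, \<dots>, x\<^sub>n]\<close> are the indices \<open>1, \<dots>, n\<close>, so \<open>S\<close> is the subring of those polynomials in
  countably many variables in which no variable outside \<open>{1..n}\<close> occurs.\<close>

type_synonym monomial = "nat \<Rightarrow>\<^sub>0 nat"
type_synonym 'k mpoly = "monomial \<Rightarrow>\<^sub>0 'k"

definition poly_ring :: "nat \<Rightarrow> 'k::field mpoly ring" where
  "poly_ring n = \<lparr> carrier = {p. \<forall>m\<in>Poly_Mapping.keys p. Poly_Mapping.keys m \<subseteq> {1..n}},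
     monoid.mult = (*), one = 1, zero = 0, add = (+) \<rparr>"

abbreviation mono_poly :: "monomial \<Rightarrow> 'k::field mpoly" where
  "mono_poly u \<equiv> Poly_Mapping.single u 1"

definition mdeg :: "monomial \<Rightarrow> nat" where
  "mdeg u = (\<Sum>i\<in>Poly_Mapping.keys u. Poly_Mapping.lookup u i)"

definition homogeneous :: "int \<Rightarrow> 'k::field mpoly \<Rightarrow> bool" where
  "homogeneous e p \<longleftrightarrow> (\<forall>m\<in>Poly_Mapping.keys p. int (mdeg m) = e)"


section \<open>Vector-spread monomials and ideals\<close>

text \<open>Lists are indexed from 0: \<open>js ! i\<close> is \<open>j\<^sub>i\<^sub>+\<^sub>1\<close> and \<open>t ! i\<close> is \<open>t\<^sub>i\<^sub>+\<^sub>1\<close>. The list \<open>t\<close> is meant to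
  have length \<open>d - 1\<close>; since \<open>length js \<le> d\<close> only indices below \<open>d - 1\<close> are used.\<close>

definition tspread :: "nat \<Rightarrow> nat \<Rightarrow> nat list \<Rightarrow> monomial \<Rightarrow> bool" where
  "tspread n d t u \<longleftrightarrow>
     (\<exists>js. sorted js \<and> set js \<subseteq> {1..n} \<and> length js \<le> d \<and>
        u = (\<Sum>j\<leftarrow>js. Poly_Mapping.single j 1) \<and>
        (\<forall>i. Suc i < length js \<longrightarrow> js ! i + t ! i \<le> js ! Suc i))"

definition tspread_monos :: "nat \<Rightarrow> nat \<Rightarrow> nat list \<Rightarrow> nat \<Rightarrow> monomial set" where
  "tspread_monos n d t l = {u. tspread n d t u \<and> mdeg u = l}"

definition tspread_ideal :: "nat \<Rightarrow> nat \<Rightarrow> nat list \<Rightarrow> 'k::field mpoly set \<Rightarrow> bool" where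
  "tspread_ideal n d t I \<longleftrightarrow>
     (\<exists>G. (\<forall>u\<in>G. tspread n d t u) \<and> I = Idl\<^bsub>poly_ring n\<^esub> (mono_poly ` G))"

definition tspread_part ::
    "nat \<Rightarrow> nat \<Rightarrow> nat list \<Rightarrow> 'k::field mpoly set \<Rightarrow> nat \<Rightarrow> monomial set" where
  "tspread_part n d t I l = {u \<in> tspread_monos n d t l. mono_poly u \<in> I}"

text \<open>The entry at position \<open>l\<close> is the component with index \<open>l - 1\<close> of the \<open>f\<close>-vector. The subtraction
  does not truncate: the second set is contained in the first, which is finite.\<close>

definition f_vector :: "nat \<Rightarrow> nat \<Rightarrow> nat list \<Rightarrow> 'k::field mpoly set \<Rightarrow> nat list" where
  "f_vector n d t I =
     map (\<lambda>l. card (tspread_monos n d t l) - card (tspread_part n d t I l)) [0..<Suc d]"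

definition tspread_strongly_stable_set ::
    "nat \<Rightarrow> nat \<Rightarrow> nat list \<Rightarrow> nat \<Rightarrow> monomial set \<Rightarrow> bool" where
  "tspread_strongly_stable_set n d t l L \<longleftrightarrow>
     L \<subseteq> tspread_monos n d t l \<and>
     (\<forall>u\<in>L. \<forall>i\<in>Poly_Mapping.keys u. \<forall>j. 1 \<le> j \<and> j < i \<longrightarrow>
        (let v = (u - Poly_Mapping.single i 1) + Poly_Mapping.single j 1
         in tspread n d t v \<longrightarrow> v \<in> L))"

text \<open>The library order on \<open>nat \<Rightarrow>\<^sub>0 nat\<close> compares two exponent vectors at the smallest index where they
  differ (see \<open>less_fun_def\<close>); on monomials this is the lexicographic order with
  \<open>x\<^sub>1 > x\<^sub>2 > \<dots>\<close>.\<close>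

definition tspread_lex_set ::
    "nat \<Rightarrow> nat \<Rightarrow> nat list \<Rightarrow> nat \<Rightarrow> monomial set \<Rightarrow> bool" where
  "tspread_lex_set n d t l L \<longleftrightarrow>
     L \<subseteq> tspread_monos n d t l \<and>
     (\<forall>u\<in>L. \<forall>v\<in>tspread_monos n d t l. v \<ge> u \<longrightarrow> v \<in> L)"

definition tspread_strongly_stable_ideal ::
    "nat \<Rightarrow> nat \<Rightarrow> nat list \<Rightarrow> 'k::field mpoly set \<Rightarrow> bool" where
  "tspread_strongly_stable_ideal n d t I \<longleftrightarrow>
     tspread_ideal n d t I \<and>
     (\<forall>l. tspread_strongly_stable_set n d t l (tspread_part n d t I l))"

definition tspread_lex_ideal ::
    "nat \<Rightarrow> nat \<Rightarrow> nat list \<Rightarrow> 'k::field mpoly set \<Rightarrow> bool" where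
  "tspread_lex_ideal n d t I \<longleftrightarrow>
     tspread_ideal n d t I \<and> (\<forall>l. tspread_lex_set n d t l (tspread_part n d t I l))"

definition lex_ideal_of ::
    "nat \<Rightarrow> nat \<Rightarrow> nat list \<Rightarrow> 'k::field mpoly set \<Rightarrow> 'k mpoly set" where
  "lex_ideal_of n d t I =
     (THE J. tspread_lex_ideal n d t J \<and> f_vector n d t J = f_vector n d t I)"


section \<open>Graded free resolutions and graded Betti numbers\<close>

text \<open>Data of an augmented complex \<open>\<dots> \<rightarrow> F\<^sub>1 \<rightarrow> F\<^sub>0 \<rightarrow> S\<close> of graded free modules
  of finite rank: \<open>F\<^sub>i\<close> is the direct sum of the \<open>S(-a\<^sub>k)\<close> for \<open>k < frank i\<close>, where
  \<open>a\<^sub>k = shift i k\<close> is the degree of the \<open>k\<close>-th basis element. The map from \<open>F\<^sub>i\<^sub>+\<^sub>1\<close> to \<open>F\<^sub>i\<close> sends the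
  \<open>k\<close>-th basis element to the vector \<open>bdry i k\<close>, and the augmentation sends the \<open>k\<close>-th basis
  element of \<open>F\<^sub>0\<close> to \<open>aug k\<close>.\<close>

record (overloaded) 'k::zero free_complex =
  frank :: "nat \<Rightarrow> nat"
  shift :: "nat \<Rightarrow> nat \<Rightarrow> int"
  bdry  :: "nat \<Rightarrow> nat \<Rightarrow> nat \<Rightarrow> 'k mpoly"
  aug   :: "nat \<Rightarrow> 'k mpoly"

definition free_module :: "nat \<Rightarrow> nat \<Rightarrow> (nat \<Rightarrow> 'k::field mpoly) set" where
  "free_module n r = {v. (\<forall>k<r. v k \<in> carrier (poly_ring n)) \<and> (\<forall>k\<ge>r. v k = 0)}"

definition bdry_map ::
    "'k::field free_complex \<Rightarrow> nat \<Rightarrow> (nat \<Rightarrow> 'k mpoly) \<Rightarrow> nat \<Rightarrow> 'k mpoly" where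
  "bdry_map F i v =
     (\<lambda>l. if l < frank F i then \<Sum>k<frank F (Suc i). v k * bdry F i k l else 0)"

definition aug_map :: "'k::field free_complex \<Rightarrow> (nat \<Rightarrow> 'k mpoly) \<Rightarrow> 'k mpoly" where
  "aug_map F v = (\<Sum>k<frank F 0. v k * aug F k)"

definition graded_free_resolution ::
    "nat \<Rightarrow> 'k::field mpoly set \<Rightarrow> 'k free_complex \<Rightarrow> bool" where
  "graded_free_resolution n I F \<longleftrightarrow>
     (\<forall>i. \<forall>k<frank F (Suc i). \<forall>l<frank F i.
        bdry F i k l \<in> carrier (poly_ring n) \<and>
        homogeneous (shift F (Suc i) k - shift F i l) (bdry F i k l)) \<and>
     (\<forall>k<frank F 0. aug F k \<in> carrier (poly_ring n) \<and> homogeneous (shift F 0 k) (aug F k)) \<and>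
     aug_map F ` free_module n (frank F 0) = I \<and>
     {v \<in> free_module n (frank F 0). aug_map F v = 0}
       = bdry_map F 0 ` free_module n (frank F 1) \<and>
     (\<forall>i. {v \<in> free_module n (frank F (Suc i)). bdry_map F i v = (\<lambda>_. 0)}
       = bdry_map F (Suc i) ` free_module n (frank F (Suc (Suc i))))"

text \<open>With \<open>K = S/(x\<^sub>1, \<dots>, x\<^sub>n)\<close> one has \<open>K \<otimes> S(-a) = K(-a)\<close>. Hence the degree \<open>j\<close> part of
  \<open>K \<otimes> F\<^sub>i\<close> has as basis the basis elements of \<open>F\<^sub>i\<close> of degree \<open>j\<close>, and the matrix of a
  differential of \<open>K \<otimes> F\<close> consists of the constant terms of the entries of the matrix over \<open>S\<close>.\<close>

definition tensor_part :: "'k::field free_complex \<Rightarrow> nat \<Rightarrow> int \<Rightarrow> (nat \<Rightarrow> 'k) set" where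
  "tensor_part F i j = {v. \<forall>k. v k \<noteq> 0 \<longrightarrow> k < frank F i \<and> shift F i k = j}"

definition tensor_bdry ::
    "'k::field free_complex \<Rightarrow> nat \<Rightarrow> (nat \<Rightarrow> 'k) \<Rightarrow> nat \<Rightarrow> 'k" where
  "tensor_bdry F i v =
     (\<lambda>l. if l < frank F i then \<Sum>k<frank F (Suc i). v k * Poly_Mapping.lookup (bdry F i k l) 0
          else 0)"

definition tensor_cycles :: "'k::field free_complex \<Rightarrow> nat \<Rightarrow> int \<Rightarrow> (nat \<Rightarrow> 'k) set" where
  "tensor_cycles F i j =
     (case i of 0 \<Rightarrow> tensor_part F 0 j
      | Suc i' \<Rightarrow> {v \<in> tensor_part F (Suc i') j. tensor_bdry F i' v = (\<lambda>_. 0)})"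

definition tensor_boundaries :: "'k::field free_complex \<Rightarrow> nat \<Rightarrow> int \<Rightarrow> (nat \<Rightarrow> 'k) set" where
  "tensor_boundaries F i j = tensor_bdry F i ` tensor_part F (Suc i) j"

abbreviation kdim :: "(nat \<Rightarrow> 'k::field) set \<Rightarrow> nat" where
  "kdim \<equiv> vector_space.dim (\<lambda>c v k. c * v k)"

text \<open>The dimension of the homology \<open>Z/B\<close> is \<open>dim Z - dim B\<close>; for a resolution \<open>F\<close> of \<open>I\<close> the
  boundaries \<open>B\<close> lie in the finite-dimensional space \<open>Z\<close> of cycles.\<close>

definition tensor_homology_dim :: "'k::field free_complex \<Rightarrow> nat \<Rightarrow> int \<Rightarrow> nat" where
  "tensor_homology_dim F i j = kdim (tensor_cycles F i j) - kdim (tensor_boundaries F i j)"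

text \<open>\<open>\<beta>\<^sub>i\<^sub>,\<^sub>j(I) = dim\<^sub>K Tor\<^sub>i(K, I)\<^sub>j\<close>, where \<open>Tor\<close> is computed from an arbitrarily chosen graded free
  resolution of \<open>I\<close>. As for any derived functor, the dimension does not depend on the choice, and
  every homogeneous ideal of \<open>S\<close> has such a resolution because \<open>S\<close> is Noetherian.\<close>

definition betti :: "nat \<Rightarrow> 'k::field mpoly set \<Rightarrow> nat \<Rightarrow> int \<Rightarrow> nat" where
  "betti n I i j = tensor_homology_dim (SOME F. graded_free_resolution n I F) i j"

end

theory Submission
  imports Defs "HOL-Library.List_Lenlexorder"
begin

text \<open>In shifted coordinates \<open>a\<^sub>r = j\<^sub>r - (t\<^sub>1 + \<dots> + t\<^sub>r\<^sub>-\<^sub>1)\<close> the spread monomials of degree \<open>l\<close> become sorted words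
  of length \<open>l\<close> over an alphabet whose size decreases with \<open>l\<close>, and the spread multiples of degree \<open>l + 1\<close>
  of a stable set are obtained by appending a letter. Ordered by degree and then lexicographically,
  the minimal generators of a strongly stable ideal have linear quotients: \<open>u\<close> with shifted word
  ending in \<open>m\<close> contributes the Koszul complex on \<open>m - 1\<close> variables. Hence iterated mapping cones form a
  minimal resolution, since all degrees in the old part are too small for a unit to appear, and
  \<open>\<beta>\<^sub>i\<^sub>,\<^sub>i\<^sub>+\<^sub>l\<close> is the sum of \<open>(m - 1) choose i\<close> over the generators of degree \<open>l\<close>.

  It remains to compare such sums for a stable and a lex family of equal cardinalities. By a theorem
  of Bayer and Bigatti, a lex set has at most as many words over each smaller alphabet as a stable
  set of the same size. Thus it has the larger sum over all words of degree \<open>l\<close> and the smaller sum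
  over the multiples of words of degree \<open>l - 1\<close>; the same bound on the number of multiples shows that
  the lex family generates an ideal with the prescribed \<open>f\<close>-vector.\<close>

section \<open>Lexicographic and stable sets of sorted words\<close>

text \<open>The shift turns an exchange \<open>x\<^sub>j(u/x\<^sub>i)\<close> into lowering a
  letter, so strong stability becomes closure downwards in the componentwise order. For the
  counting, the vector \<open>t\<close> survives only in the sizes of the alphabets, which shrink
  with the degree because the entries of \<open>t\<close> are nonnegative.

  The comparison of lex and stable sets cannot be proved by induction on the alphabet alone. Passing
  from \<open>N + 1\<close> letters to \<open>N\<close> requires knowing how much a set over
  \<open>N\<close> letters can grow when some of its top letters are raised to \<open>N + 1\<close>,
  and that growth over \<open>N + 1\<close> letters is in turn bounded by the comparison just
  obtained. The operator \<open>up\<close> measures this growth.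

  On the algebraic side \<open>betti\<close> refers to an unspecified resolution, so lifts and
  homotopies have to be constructed in coordinates. The same lifting theorem, applied to
  multiplication by a monomial, supplies the chain maps for the mapping cones. No explicit
  differentials or Koszul signs are written down, and the argument is uniform in the characteristic
  of the field.\<close>

definition words :: "nat \<Rightarrow> nat \<Rightarrow> nat list set" where
  "words N l = {a. sorted a \<and> length a = l \<and> set a \<subseteq> {1..N}}"

text \<open>Down-sets for the componentwise order. Closure under single exchanges yields such a
  down-set by \<open>strongly_stable_imp_stab\<close>.\<close>

definition stab :: "nat \<Rightarrow> nat \<Rightarrow> nat list set \<Rightarrow> bool" where
  "stab N l L \<longleftrightarrow> L \<subseteq> words N l \<and> (\<forall>a\<in>L. \<forall>b\<in>words N l. list_all2 (\<le>) b a \<longrightarrow> b \<in> L)"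

text \<open>An initial segment rather than a final one: smaller words are lexicographically larger
  monomials (\<open>spread_le_iff\<close>).\<close>

definition lexs :: "nat \<Rightarrow> nat \<Rightarrow> nat list set \<Rightarrow> bool" where
  "lexs N l L \<longleftrightarrow> L \<subseteq> words N l \<and> (\<forall>a\<in>L. \<forall>b\<in>words N l. b \<le> a \<longrightarrow> b \<in> L)"

lemma finite_words [simp]: "finite (words N l)"
proof -
  have "words N l \<subseteq> {a. set a \<subseteq> {1..N} \<and> length a = l}"
    by (auto simp: words_def)
  then show ?thesis
    by (rule finite_subset) (rule finite_lists_length_eq, simp)
qed

lemma words_subset_finite: "L \<subseteq> words N l \<Longrightarrow> finite L"
  by (erule finite_subset) simp

lemma words_mono: "M \<le> N \<Longrightarrow> words M l \<subseteq> words N l"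
  by (fastforce simp: words_def)

lemma words_0 [simp]: "words N 0 = {[]}"
  by (auto simp: words_def)

lemma words_0_Suc [simp]: "words 0 (Suc l) = {}"
  by (auto simp: words_def)

lemma snoc_in_words:
  "a @ [b] \<in> words N (Suc l) \<longleftrightarrow> a \<in> words b l \<and> 1 \<le> b \<and> b \<le> N"
  by (fastforce simp: words_def sorted_append)

lemma words_Suc_cases:
  assumes "w \<in> words N (Suc l)"
  obtains a b where "w = a @ [b]" "a \<in> words b l" "1 \<le> b" "b \<le> N"
proof -
  have "w \<noteq> []" using assms by (auto simp: words_def)
  then obtain a b where "w = a @ [b]" by (metis append_butlast_last_id)
  then show ?thesis using assms that snoc_in_words by blast
qed

lemma snoc_le_snoc:
  fixes a b :: "nat list"
  shows "length a = length b \<Longrightarrow> a @ [x] \<le> b @ [y] \<longleftrightarrow> a < b \<or> (a = b \<and> x \<le> y)"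
  by (induction a b rule: list_induct2) (auto simp: Cons_le_Cons Cons_less_Cons)

lemma list_all2_imp_le:
  fixes a b :: "nat list"
  shows "list_all2 (\<le>) a b \<Longrightarrow> a \<le> b"
  by (induction rule: list_all2_induct) (auto simp: Cons_le_Cons dest: list_all2_lengthD)

lemma lexs_imp_stab: "lexs N l L \<Longrightarrow> stab N l L"
  unfolding lexs_def stab_def using list_all2_imp_le by blast

lemma lexs_finite: "lexs N l L \<Longrightarrow> finite L"
  using words_subset_finite by (auto simp: lexs_def)

text \<open>Initial segments of a linear order form a chain, so cardinalities decide
  inclusion.\<close>

lemma lexs_card_le_imp_subset:
  assumes "lexs N l X" "lexs N l Y" "card X \<le> card Y"
  shows "X \<subseteq> Y"
proof (rule ccontr)
  assume "\<not> X \<subseteq> Y"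
  then obtain x where x: "x \<in> X" "x \<notin> Y" by blast
  have "Y \<subset> X"
  proof -
    have "y \<in> X" if "y \<in> Y" for y
    proof -
      have "\<not> x \<le> y" using assms(1,2) x that unfolding lexs_def by blast
      then have "y \<le> x" by simp
      then show ?thesis using assms(1,2) x that unfolding lexs_def by blast
    qed
    then show ?thesis using x by blast
  qed
  then have "card Y < card X" using assms(1) lexs_finite psubset_card_mono by blast
  then show False using assms(3) by simp
qed

lemma finite_down_closed_subset_exists:
  fixes X :: "'a::linorder set"
  assumes "finite X" "s \<le> card X"
  shows "\<exists>Y\<subseteq>X. card Y = s \<and> (\<forall>a\<in>Y. \<forall>b\<in>X. b \<le> a \<longrightarrow> b \<in> Y)"
  using assms
proof (induction X rule: finite_linorder_max_induct)
  case empty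
  then show ?case by simp
next
  case (insert m X)
  have m: "m \<notin> X" using insert.hyps by blast
  show ?case
  proof (cases "s = card (insert m X)")
    case True
    then show ?thesis by blast
  next
    case False
    then have "s \<le> card X" using insert m by simp
    then obtain Y where Y: "Y \<subseteq> X" "card Y = s" "\<forall>a\<in>Y. \<forall>b\<in>X. b \<le> a \<longrightarrow> b \<in> Y"
      using insert.IH by blast
    have "b \<in> Y" if "a \<in> Y" "b \<in> insert m X" "b \<le> a" for a b
    proof (cases "b = m")
      case True
      then have "a < b" using that(1) Y(1) insert.hyps(2) by blast
      then show ?thesis using that(3) by simp
    next
      case False
      then show ?thesis using that Y by blast
    qed
    then show ?thesis using Y by blast
  qed
qed

lemma lexs_exists:
  assumes "s \<le> card (words N l)"
  shows "\<exists>L. lexs N l L \<and> card L = s"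
  using finite_down_closed_subset_exists[OF finite_words assms] unfolding lexs_def by blast

lemma lexs_subset_card:
  assumes "lexs N l X" "s \<le> card X"
  shows "\<exists>Y\<subseteq>X. lexs N l Y \<and> card Y = s"
proof -
  obtain Y where Y: "Y \<subseteq> X" "card Y = s" "\<forall>a\<in>Y. \<forall>b\<in>X. b \<le> a \<longrightarrow> b \<in> Y"
    using finite_down_closed_subset_exists[OF lexs_finite[OF assms(1)] assms(2)] by blast
  have "lexs N l Y"
    using Y(1,3) assms(1) unfolding lexs_def by (meson subset_trans subsetD)
  then show ?thesis using Y by blast
qed

lemma lexs_restrict: "lexs N l L \<Longrightarrow> M \<le> N \<Longrightarrow> lexs M l (L \<inter> words M l)"
  unfolding lexs_def using words_mono by blast

lemma stab_restrict: "stab N l L \<Longrightarrow> M \<le> N \<Longrightarrow> stab M l (L \<inter> words M l)"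
  unfolding stab_def using words_mono by blast

section \<open>Raising the top letter, and the comparison on smaller alphabets\<close>

text \<open>These words arise from \<open>X\<close> by raising some letters \<open>N\<close> to
  \<open>N + 1\<close>. A stable set over \<open>N + 1\<close> letters is contained in
  \<open>up\<close> of its restriction to \<open>N\<close> letters, because truncation only lowers
  letters.\<close>

definition up :: "nat \<Rightarrow> nat \<Rightarrow> nat list set \<Rightarrow> nat list set" where
  "up N l X = {w \<in> words (Suc N) l. map (min N) w \<in> X}"

lemma finite_up [simp]: "finite (up N l X)"
  by (simp add: up_def)

lemma map_min_id: "a \<in> words N l \<Longrightarrow> map (min N) a = a"
  by (intro map_idI) (auto simp: words_def min_def)

lemma map_min_in_words: "w \<in> words (Suc N) l \<Longrightarrow> 1 \<le> N \<or> l = 0 \<Longrightarrow> map (min N) w \<in> words N l"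
proof -
  assume w: "w \<in> words (Suc N) l" and N: "1 \<le> N \<or> l = 0"
  then have "sorted (map (min N) w)"
    by (auto simp: words_def sorted_iff_nth_mono simp flip: min_le_iff_disj intro: min.coboundedI2)
  moreover have "min N x \<in> {1..N}" if "x \<in> set w" for x
    using w N that by (auto simp: words_def)
  ultimately show ?thesis using w by (auto simp: words_def)
qed

text \<open>A word of \<open>up N (Suc l) X\<close> without the letter \<open>N + 1\<close> is its
  own truncation. Any other ends in \<open>N + 1\<close>, its truncation ends in \<open>N\<close>,
  and deleting that last letter gives the second summand. This recursion drives the induction on the
  length.\<close>

lemma card_up_Suc:
  assumes "X \<subseteq> words N (Suc l)" "1 \<le> N"
  shows "card (up N (Suc l) X) = card X + card (up N l {y. y @ [N] \<in> X})"
proof -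
  let ?Y = "(\<lambda>y. y @ [Suc N]) ` up N l {y. y @ [N] \<in> X}"
  have "up N (Suc l) X = X \<union> ?Y"
  proof (intro subset_antisym subsetI)
    fix w assume w: "w \<in> up N (Suc l) X"
    then have "w \<in> words (Suc N) (Suc l)" by (simp add: up_def)
    then obtain a b where ab: "w = a @ [b]" "a \<in> words b l" "1 \<le> b" "b \<le> Suc N"
      by (rule words_Suc_cases)
    show "w \<in> X \<union> ?Y"
    proof (cases "b = Suc N")
      case True
      then have "a \<in> up N l {y. y @ [N] \<in> X}" using w ab by (simp add: up_def)
      then show ?thesis using ab True by blast
    next
      case False
      then have "w \<in> words N (Suc l)" using ab by (simp add: snoc_in_words)
      then show ?thesis using w map_min_id by (simp add: up_def)
    qed
  next
    fix w assume "w \<in> X \<union> ?Y"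
    then show "w \<in> up N (Suc l) X"
      using assms words_mono[of N "Suc N"]
      by (auto simp: up_def map_min_id subset_iff snoc_in_words)
  qed
  moreover have "X \<inter> ?Y = {}" using assms by (auto simp: words_def)
  moreover have "card ?Y = card (up N l {y. y @ [N] \<in> X})"
    by (intro card_image inj_onI) simp
  moreover have "finite X" using assms words_subset_finite by auto
  ultimately show ?thesis by (simp add: card_Un_disjoint)
qed

lemma up_0: "X \<subseteq> words N 0 \<Longrightarrow> up N 0 X = X"
  by (auto simp: up_def)

lemma card_words_Suc_split:
  assumes "X \<subseteq> words (Suc N) (Suc l)"
  shows "card X = card (X \<inter> words N (Suc l)) + card {y. y @ [Suc N] \<in> X}"
proof -
  let ?Y = "(\<lambda>y. y @ [Suc N]) ` {y. y @ [Suc N] \<in> X}"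
  have "X = (X \<inter> words N (Suc l)) \<union> ?Y"
  proof (intro subset_antisym subsetI)
    fix w assume w: "w \<in> X"
    then have "w \<in> words (Suc N) (Suc l)" using assms by blast
    then obtain a b where "w = a @ [b]" "a \<in> words b l" "1 \<le> b" "b \<le> Suc N"
      by (rule words_Suc_cases)
    then show "w \<in> (X \<inter> words N (Suc l)) \<union> ?Y"
      using w by (cases "b = Suc N") (auto simp: snoc_in_words)
  qed auto
  moreover have "(X \<inter> words N (Suc l)) \<inter> ?Y = {}" by (auto simp: words_def)
  moreover have "card ?Y = card {y. y @ [Suc N] \<in> X}"
    by (intro card_image inj_onI) simp
  moreover have fin: "finite X" using assms words_subset_finite by auto
  moreover have "finite ?Y" using fin by (rule rev_finite_subset) auto
  ultimately show ?thesis by (metis card_Un_disjoint finite_Int)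
qed

lemma list_less_nth:
  fixes a b :: "nat list"
  assumes "length a = length b"
  shows "a < b \<longleftrightarrow> (\<exists>p<length a. (\<forall>q<p. a ! q = b ! q) \<and> a ! p < b ! p)"
  using assms
proof (induction a b rule: list_induct2)
  case Nil
  then show ?case by simp
next
  case (Cons x xs y ys)
  have "(\<exists>p<length (x # xs). (\<forall>q<p. (x # xs) ! q = (y # ys) ! q) \<and> (x # xs) ! p < (y # ys) ! p)
    \<longleftrightarrow> x < y \<or> (x = y \<and> (\<exists>p<length xs. (\<forall>q<p. xs ! q = ys ! q) \<and> xs ! p < ys ! p))"
    (is "?L \<longleftrightarrow> ?R")
  proof
    assume ?L
    then obtain p where p: "p < length (x # xs)" "\<forall>q<p. (x # xs) ! q = (y # ys) ! q"
      "(x # xs) ! p < (y # ys) ! p" by blast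
    show ?R
    proof (cases p)
      case 0
      then show ?thesis using p by simp
    next
      case (Suc p')
      then show ?thesis using p by fastforce
    qed
  next
    assume ?R
    then show ?L
    proof
      assume "x < y"
      then show ?thesis by (intro exI[of _ 0]) simp
    next
      assume "x = y \<and> (\<exists>p<length xs. (\<forall>q<p. xs ! q = ys ! q) \<and> xs ! p < ys ! p)"
      then obtain p where "x = y" "p < length xs" "\<forall>q<p. xs ! q = ys ! q" "xs ! p < ys ! p" by blast
      then show ?thesis by (intro exI[of _ "Suc p"]) (auto simp: nth_Cons split: nat.split)
    qed
  qed
  then show ?case using Cons by (simp add: Cons_less_Cons)
qed

text \<open>At the first difference the truncated letter is smaller than a letter of
  \<open>z\<close>, hence below \<open>N\<close>, so truncation did not change it. By sortedness it
  changed no earlier letter either.\<close>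

lemma map_min_less_imp_less:
  assumes w: "w \<in> words (Suc N) l" and z: "z \<in> words N l" and less: "map (min N) w < z"
  shows "w < z"
proof -
  have len: "length w = l" "length z = l" "sorted w" using w z by (auto simp: words_def)
  obtain p where p: "p < l" "\<forall>q<p. map (min N) w ! q = z ! q" "map (min N) w ! p < z ! p"
    using less len by (auto simp: list_less_nth)
  have "z ! p \<le> N" using z p(1) len by (force simp: words_def)
  then have wp: "w ! p < N" "w ! p < z ! p" using p len by auto
  have "w ! q = z ! q" if "q < p" for q
  proof -
    have "w ! q \<le> w ! p" using that p(1) len sorted_nth_mono by fastforce
    then show ?thesis using p that wp len by force
  qed
  then show ?thesis using len p(1) wp by (auto simp: list_less_nth)
qed

text \<open>One half of a simultaneous induction on the alphabet; \<open>card_up_le\<close> is the other. Every word truncated to something below the largest word \<open>z\<close> of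
  the restricted lex set is itself below \<open>z\<close>.\<close>

lemma card_restrict_le_step:
  assumes upN: "\<And>X Y. stab N l X \<Longrightarrow> lexs N l Y \<Longrightarrow> card X \<le> card Y \<Longrightarrow> card (up N l X) \<le> card (up N l Y)"
    and L: "stab (Suc N) l L" and M: "lexs (Suc N) l M" and card: "card M \<le> card L"
  shows "card (M \<inter> words N l) \<le> card (L \<inter> words N l)"
proof (rule ccontr)
  let ?L0 = "L \<inter> words N l" and ?M0 = "M \<inter> words N l"
  assume neg: "\<not> card ?M0 \<le> card ?L0"
  have "?M0 \<noteq> {}" using neg by auto
  define z where "z = Max ?M0"
  have z: "z \<in> ?M0" using \<open>?M0 \<noteq> {}\<close> Max_in[of ?M0] by (auto simp: z_def)
  have lex0: "lexs N l ?M0" using M by (rule lexs_restrict) simp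
  have lex1: "lexs N l (?M0 - {z})"
    unfolding lexs_def
  proof (intro conjI ballI impI)
    fix a b assume a: "a \<in> ?M0 - {z}" and b: "b \<in> words N l" "b \<le> a"
    have "a \<le> z" using a unfolding z_def by (intro Max_ge) auto
    then have "b \<noteq> z" using a b by auto
    then show "b \<in> ?M0 - {z}" using a b lex0 unfolding lexs_def by blast
  qed auto
  have "card ?L0 \<le> card (?M0 - {z})" using neg z by simp
  then have c1: "card (up N l ?L0) \<le> card (up N l (?M0 - {z}))"
    using L by (intro upN lex1 stab_restrict[of "Suc N"]) auto
  \<comment> \<open>Truncation at 0 would leave the alphabet; the existence of \<open>z\<close>
    excludes \<open>N = 0\<close> for nonempty words.\<close>
  have nz: "1 \<le> N \<or> l = 0" using z by (cases N; cases l) auto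
  have "L \<subseteq> up N l ?L0"
  proof
    fix w assume w: "w \<in> L"
    then have ww: "w \<in> words (Suc N) l" using L by (auto simp: stab_def)
    then have mw: "map (min N) w \<in> words N l" using nz by (rule map_min_in_words)
    moreover have "list_all2 (\<le>) (map (min N) w) w" by (simp add: list_all2_conv_all_nth)
    moreover have "map (min N) w \<in> words (Suc N) l" using mw words_mono[of N "Suc N" l] by auto
    ultimately have "map (min N) w \<in> L" using L w unfolding stab_def by blast
    then show "w \<in> up N l ?L0" using ww mw by (simp add: up_def)
  qed
  then have c2: "card L \<le> card (up N l ?L0)" by (simp add: card_mono)
  \<comment> \<open>The word \<open>z\<close> is the strict gain behind the contradiction:
    \<open>card L \<le> card (up N l ?L0) \<le> card (up N l (?M0 - {z})) < card M\<close>.\<close>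
  have "insert z (up N l (?M0 - {z})) \<subseteq> M"
  proof
    fix w assume "w \<in> insert z (up N l (?M0 - {z}))"
    then consider "w = z" | "w \<in> up N l (?M0 - {z})" by blast
    then show "w \<in> M"
    proof cases
      case 2
      then have w: "w \<in> words (Suc N) l" "map (min N) w \<in> ?M0" "map (min N) w \<noteq> z" by (auto simp: up_def)
      then have "map (min N) w \<le> z" unfolding z_def by (intro Max_ge) auto
      then have "w < z" using w z by (intro map_min_less_imp_less[of w N l z]) auto
      then show ?thesis using M z w unfolding lexs_def by (meson IntD1 less_imp_le)
    qed (use z in auto)
  qed
  moreover have "z \<notin> up N l (?M0 - {z})" using z map_min_id[of z N l] by (auto simp: up_def)
  ultimately have "Suc (card (up N l (?M0 - {z}))) \<le> card M"
    using card_mono[OF lexs_finite[OF M]] by (metis card_insert_disjoint finite_up)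
  then show False using c1 c2 card by simp
qed

text \<open>Outer induction on the alphabet, inner induction on the length. The sets of words that
  can be followed by the top letter are again stable and lex, and \<open>card_up_Suc\<close>
  expresses the count through them. Comparing these derived sets is where the outer hypothesis
  enters, by way of \<open>card_restrict_le_step\<close>.\<close>

lemma card_up_le:
  "stab N l X \<Longrightarrow> lexs N l Y \<Longrightarrow> card X \<le> card Y \<Longrightarrow> card (up N l X) \<le> card (up N l Y)"
proof (induction N arbitrary: l X Y)
  case 0
  show ?case
  proof (cases l)
    case 0
    have "X \<subseteq> words 0 0" "Y \<subseteq> words 0 0"
      using "0.prems"(1,2) 0 by (auto simp only: stab_def lexs_def)
    then show ?thesis using "0.prems"(3) 0 by (simp only: up_0)
  next
    case (Suc l')
    have "X \<subseteq> words 0 l" using "0.prems"(1) by (simp only: stab_def)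
    then have "up 0 l X = {}" unfolding Suc words_0_Suc up_def by blast
    then show ?thesis by simp
  qed
next
  case (Suc N)
  note IHN = Suc.IH
  show ?case using Suc.prems
  proof (induction l arbitrary: X Y)
    case 0
    have "X \<subseteq> words (Suc N) 0" "Y \<subseteq> words (Suc N) 0"
      using 0 by (auto simp only: stab_def lexs_def)
    then show ?case using 0 by (simp only: up_0)
  next
    case (Suc l)
    have XW: "X \<subseteq> words (Suc N) (Suc l)" using Suc.prems by (simp add: stab_def)
    \<comment> \<open>Equal cardinality is what turns "at most as many words avoiding the top
      letter" into "at least as many words ending in it".\<close>
    obtain Y' where Y': "Y' \<subseteq> Y" "lexs (Suc N) (Suc l) Y'" "card Y' = card X"
      using lexs_subset_card[OF Suc.prems(2,3)] by blast
    have Y'W: "Y' \<subseteq> words (Suc N) (Suc l)" using Y' by (simp add: lexs_def)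
    let ?d = "\<lambda>X. {y. y @ [Suc N] \<in> X}"
    have "card (Y' \<inter> words N (Suc l)) \<le> card (X \<inter> words N (Suc l))"
      by (rule card_restrict_le_step[OF IHN Suc.prems(1) Y'(2)]) (use Y' in auto)
    then have "card (?d X) \<le> card (?d Y')"
      using card_words_Suc_split[OF XW] card_words_Suc_split[OF Y'W] Y'(3) by linarith
    moreover have "stab (Suc N) l (?d X)"
      unfolding stab_def
    proof (intro conjI ballI impI subsetI)
      fix a assume "a \<in> ?d X"
      then show "a \<in> words (Suc N) l" using XW by (auto simp: snoc_in_words)
    next
      fix a b assume "a \<in> ?d X" "b \<in> words (Suc N) l" "list_all2 (\<le>) b a"
      then show "b \<in> ?d X"
        using Suc.prems(1) unfolding stab_def
        by (auto simp: snoc_in_words list_all2_appendI)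
    qed
    moreover have "lexs (Suc N) l (?d Y')"
      unfolding lexs_def
    proof (intro conjI ballI impI subsetI)
      fix a assume "a \<in> ?d Y'"
      then show "a \<in> words (Suc N) l" using Y'W by (auto simp: snoc_in_words)
    next
      fix a b assume a: "a \<in> ?d Y'" and b: "b \<in> words (Suc N) l" "b \<le> a"
      have "a \<in> words (Suc N) l" using a Y'W by (auto simp: snoc_in_words)
      then have "length b = length a" using b by (simp add: words_def)
      then have "b @ [Suc N] \<le> a @ [Suc N]" using b by (auto simp: snoc_le_snoc)
      then show "b \<in> ?d Y'"
        using a b Y'(2) unfolding lexs_def by (auto simp: snoc_in_words)
    qed
    ultimately have "card (up (Suc N) l (?d X)) \<le> card (up (Suc N) l (?d Y'))"
      using Suc.IH by blast
    then have "card (up (Suc N) (Suc l) X) \<le> card (up (Suc N) (Suc l) Y')"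
      using card_up_Suc[OF XW] card_up_Suc[OF Y'W] Y'(3) by simp
    also have "\<dots> \<le> card (up (Suc N) (Suc l) Y)"
      using Y'(1) by (intro card_mono) (auto simp: up_def)
    finally show ?case .
  qed
qed

text \<open>The Bayer-Bigatti comparison, by removing one letter at a time. The assumption is an
  inequality of cardinalities because equality would be lost after the first restriction.\<close>

theorem card_lexs_restrict_le:
  assumes "stab N l L" "lexs N l M" "card M \<le> card L" "b \<le> N"
  shows "card (M \<inter> words b l) \<le> card (L \<inter> words b l)"
  using assms
proof (induction N arbitrary: L M)
  case 0
  then have "b = 0" by simp
  then show ?case using "0.prems" unfolding stab_def lexs_def by (simp only: Int_absorb2)
next
  case (Suc N)
  show ?case
  proof (cases "b = Suc N")
    case True
    then show ?thesis using Suc.prems unfolding stab_def lexs_def by (simp only: Int_absorb2)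
  next
    case False
    then have b: "b \<le> N" using Suc.prems by simp
    have "card (M \<inter> words N l) \<le> card (L \<inter> words N l)"
      by (rule card_restrict_le_step[OF card_up_le Suc.prems(1-3)])
    then have "card (M \<inter> words N l \<inter> words b l) \<le> card (L \<inter> words N l \<inter> words b l)"
      using Suc.prems b by (intro Suc.IH lexs_restrict[of "Suc N"] stab_restrict[of "Suc N"]) auto
    moreover have "words N l \<inter> words b l = words b l" using words_mono[OF b] by blast
    ultimately show ?thesis by (simp add: Int_assoc)
  qed
qed

section \<open>Weighted sums over the last letter\<close>

text \<open>The value 1 for the empty word makes \<open>mx a - 1\<close> vanish, so that the
  generator 1 has no linear quotient variables, and it keeps \<open>words_mx_iff\<close> valid for
  length 0.\<close>

definition mx :: "nat list \<Rightarrow> nat" where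
  "mx a = (if a = [] then 1 else last a)"

lemma mx_snoc [simp]: "mx (a @ [b]) = b"
  by (simp add: mx_def)

lemma mx_le: "a \<in> words N l \<Longrightarrow> 1 \<le> N \<Longrightarrow> mx a \<le> N"
  by (auto simp: mx_def words_def dest: last_in_set)

lemma mx_ge: "a \<in> words N l \<Longrightarrow> 1 \<le> mx a"
  by (auto simp: mx_def words_def dest: last_in_set)

lemma words_mx_iff:
  assumes "a \<in> words N l" "1 \<le> b"
  shows "a \<in> words b l \<longleftrightarrow> mx a \<le> b"
proof (cases l)
  case 0
  then show ?thesis using assms by (auto simp: mx_def)
next
  case (Suc k)
  then obtain c x where "a = c @ [x]" "c \<in> words x k" "1 \<le> x" "x \<le> N"
    using assms words_Suc_cases by blast
  then show ?thesis using Suc by (simp add: snoc_in_words)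
qed

text \<open>Here \<open>N\<close> is the alphabet for length \<open>l + 1\<close>, possibly smaller
  than the one of \<open>A\<close>. Extensions that do not fit into it are dropped; they would
  violate the bound on the variables.\<close>

definition shad :: "nat \<Rightarrow> nat \<Rightarrow> nat list set \<Rightarrow> nat list set" where
  "shad N l A = {c \<in> words N (Suc l). butlast c \<in> A}"

lemma finite_shad [simp]: "finite (shad N l A)"
  by (simp add: shad_def)

lemma shad_eq: "shad N l A = (\<Union>b\<in>{1..N}. (\<lambda>a. a @ [b]) ` (A \<inter> words b l))"
proof (intro subset_antisym subsetI)
  fix c assume c: "c \<in> shad N l A"
  then have "c \<in> words N (Suc l)" by (simp add: shad_def)
  then obtain a b where "c = a @ [b]" "a \<in> words b l" "1 \<le> b" "b \<le> N" by (rule words_Suc_cases)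
  then show "c \<in> (\<Union>b\<in>{1..N}. (\<lambda>a. a @ [b]) ` (A \<inter> words b l))" using c by (auto simp: shad_def)
qed (auto simp: shad_def snoc_in_words)

text \<open>The letter \<open>b\<close> can follow exactly the words over \<open>{1..b}\<close>. So
  the sum is a nonnegative combination of the counts that \<open>card_lexs_restrict_le\<close>
  bounds.\<close>

lemma sum_shad:
  fixes \<phi> :: "nat \<Rightarrow> nat"
  shows "(\<Sum>c\<in>shad N l A. \<phi> (mx c)) = (\<Sum>b=1..N. \<phi> b * card (A \<inter> words b l))"
proof -
  have "(\<Sum>c\<in>shad N l A. \<phi> (mx c))
      = (\<Sum>b=1..N. \<Sum>c\<in>(\<lambda>a. a @ [b]) ` (A \<inter> words b l). \<phi> (mx c))"
    unfolding shad_eq by (rule sum.UNION_disjoint) auto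
  also have "\<dots> = (\<Sum>b=1..N. \<Sum>a\<in>A \<inter> words b l. \<phi> b)"
    by (rule sum.cong[OF refl], subst sum.reindex) (auto simp: inj_on_def)
  finally show ?thesis by (simp add: mult.commute)
qed

lemma sum_mono_nat_telescope:
  fixes \<phi> :: "nat \<Rightarrow> nat"
  assumes "\<And>b. 1 \<le> b \<Longrightarrow> \<phi> b \<le> \<phi> (Suc b)" "1 \<le> m" "m \<le> N"
  shows "\<phi> m + (\<Sum>b=m..<N. \<phi> (Suc b) - \<phi> b) = \<phi> N"
  using assms(3)
proof (induction N rule: dec_induct)
  case (step k)
  then show ?case using assms(1)[of k] assms(2) by simp
qed simp

text \<open>Abel summation: \<open>\<phi> (mx a)\<close> is \<open>\<phi> N\<close> minus the
  increments from \<open>mx a\<close> to \<open>N\<close>, and \<open>mx a \<le> b\<close> means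
  that \<open>a\<close> is a word over \<open>{1..b}\<close>. The counts on small alphabets thus
  enter with a negative sign, which is why lex sets maximise the sum. The additive form avoids
  truncated subtraction.\<close>

lemma sum_mx_by_parts:
  fixes \<phi> :: "nat \<Rightarrow> nat"
  assumes L: "L \<subseteq> words N l" and N: "1 \<le> N" and mono: "\<And>b. 1 \<le> b \<Longrightarrow> \<phi> b \<le> \<phi> (Suc b)"
  shows "(\<Sum>a\<in>L. \<phi> (mx a)) + (\<Sum>b=1..<N. (\<phi> (Suc b) - \<phi> b) * card (L \<inter> words b l)) = card L * \<phi> N"
proof -
  have fin: "finite L" using L words_subset_finite by blast
  have "(\<Sum>b=1..<N. (\<phi> (Suc b) - \<phi> b) * card (L \<inter> words b l))
      = (\<Sum>b=1..<N. \<Sum>a\<in>L. if mx a \<le> b then \<phi> (Suc b) - \<phi> b else 0)"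
  proof (rule sum.cong[OF refl])
    fix b assume b: "b \<in> {1..<N}"
    have "L \<inter> words b l = {a \<in> L. mx a \<le> b}"
      using L b words_mx_iff by fastforce
    then show "(\<phi> (Suc b) - \<phi> b) * card (L \<inter> words b l)
        = (\<Sum>a\<in>L. if mx a \<le> b then \<phi> (Suc b) - \<phi> b else 0)"
      using fin by (simp add: sum.If_cases Int_def mult.commute)
  qed
  also have "\<dots> = (\<Sum>a\<in>L. \<Sum>b=1..<N. if mx a \<le> b then \<phi> (Suc b) - \<phi> b else 0)"
    by (rule sum.swap)
  also have "\<dots> = (\<Sum>a\<in>L. \<Sum>b=mx a..<N. \<phi> (Suc b) - \<phi> b)"
  proof (rule sum.cong[OF refl])
    fix a assume "a \<in> L"
    then have "1 \<le> mx a" using L mx_ge by blast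
    then have "{1..<N} \<inter> {b. mx a \<le> b} = {mx a..<N}" by auto
    then show "(\<Sum>b=1..<N. if mx a \<le> b then \<phi> (Suc b) - \<phi> b else 0) = (\<Sum>b=mx a..<N. \<phi> (Suc b) - \<phi> b)"
      by (simp add: sum.If_cases)
  qed
  finally have "(\<Sum>a\<in>L. \<phi> (mx a)) + (\<Sum>b=1..<N. (\<phi> (Suc b) - \<phi> b) * card (L \<inter> words b l))
      = (\<Sum>a\<in>L. \<phi> (mx a) + (\<Sum>b=mx a..<N. \<phi> (Suc b) - \<phi> b))"
    by (simp add: sum.distrib)
  also have "\<dots> = (\<Sum>a\<in>L. \<phi> N)"
  proof (rule sum.cong[OF refl])
    fix a assume "a \<in> L"
    then have "1 \<le> mx a" "mx a \<le> N" using L N mx_ge mx_le by blast+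
    then show "\<phi> (mx a) + (\<Sum>b=mx a..<N. \<phi> (Suc b) - \<phi> b) = \<phi> N"
      using mono by (intro sum_mono_nat_telescope)
  qed
  finally show ?thesis by simp
qed

lemma sum_mx_le:
  fixes \<phi> :: "nat \<Rightarrow> nat"
  assumes L: "stab N l L" and M: "lexs N l M" and card: "card M = card L"
    and mono: "\<And>b. 1 \<le> b \<Longrightarrow> \<phi> b \<le> \<phi> (Suc b)"
  shows "(\<Sum>a\<in>L. \<phi> (mx a)) \<le> (\<Sum>a\<in>M. \<phi> (mx a))"
proof (cases "l = 0 \<or> N = 0")
  case True
  have LW: "L \<subseteq> words N l" and MW: "M \<subseteq> words N l" using L M by (auto simp: stab_def lexs_def)
  have "words N l \<subseteq> {[]}" using True by (cases l) auto
  then have "M = L" using LW MW card by (metis card.empty card_0_eq finite.simps subset_singletonD subset_trans)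
  then show ?thesis by simp
next
  case False
  then have N: "1 \<le> N" by simp
  have LW: "L \<subseteq> words N l" and MW: "M \<subseteq> words N l" using L M by (auto simp: stab_def lexs_def)
  have "(\<Sum>b=1..<N. (\<phi> (Suc b) - \<phi> b) * card (M \<inter> words b l))
      \<le> (\<Sum>b=1..<N. (\<phi> (Suc b) - \<phi> b) * card (L \<inter> words b l))"
    using card_lexs_restrict_le[OF L M] card by (intro sum_mono mult_left_mono) auto
  then show ?thesis
    using sum_mx_by_parts[of L N l \<phi>, OF LW N mono] sum_mx_by_parts[of M N l \<phi>, OF MW N mono] card by simp
qed

lemma sum_shad_le:
  fixes \<phi> :: "nat \<Rightarrow> nat"
  assumes L: "stab N l L" and M: "lexs N l M" and card: "card M \<le> card L" and N: "N' \<le> N"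
  shows "(\<Sum>c\<in>shad N' l M. \<phi> (mx c)) \<le> (\<Sum>c\<in>shad N' l L. \<phi> (mx c))"
  unfolding sum_shad using card_lexs_restrict_le[OF L M card] N
  by (intro sum_mono mult_left_mono) auto

lemma card_shad_le:
  assumes "stab N l L" "lexs N l M" "card M \<le> card L" "N' \<le> N"
  shows "card (shad N' l M) \<le> card (shad N' l L)"
  using sum_shad_le[OF assms, of "\<lambda>_. 1"] by simp

lemma butlast_in_words: "c \<in> words N (Suc l) \<Longrightarrow> butlast c \<in> words N l"
  by (elim words_Suc_cases) (auto dest: words_mono[THEN subsetD])

text \<open>For words of equal length, \<open>b \<le> a\<close> passes to the words without their
  last letters.\<close>

lemma lexs_shad:
  assumes M: "lexs N l M" and N: "N' \<le> N"
  shows "lexs N' (Suc l) (shad N' l M)"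
  unfolding lexs_def
proof (intro conjI ballI impI)
  fix a b assume a: "a \<in> shad N' l M" and b: "b \<in> words N' (Suc l)" "b \<le> a"
  have aw: "a \<in> words N' (Suc l)" using a by (simp add: shad_def)
  obtain a' x where a': "a = a' @ [x]" "a' \<in> words x l" using words_Suc_cases[OF aw] by metis
  obtain b' y where b': "b = b' @ [y]" "b' \<in> words y l" using words_Suc_cases[OF b(1)] by metis
  have "length b' = length a'" using a' b' by (simp add: words_def)
  then have "b' \<le> a'" using b(2) a' b' by (auto simp: snoc_le_snoc)
  moreover have "b' \<in> words N l"
    using butlast_in_words[OF b(1)] b' words_mono[OF N, of l] by auto
  moreover have "a' \<in> M" using a a' by (simp add: shad_def)
  ultimately have "b' \<in> M" using M unfolding lexs_def by blast
  then show "b \<in> shad N' l M" using b b' by (simp add: shad_def)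
qed (auto simp: shad_def)

section \<open>Families of stable sets closed under shadows\<close>

text \<open>The combinatorial shadow of a strongly stable ideal: \<open>L l\<close> collects its
  spread monomials of degree \<open>l\<close>, and \<open>N l\<close> is the alphabet for that
  degree. Conversely such a family generates an ideal with exactly these levels
  (\<open>spread_words_mideal\<close>).\<close>

definition stable_family :: "(nat \<Rightarrow> nat) \<Rightarrow> nat \<Rightarrow> (nat \<Rightarrow> nat list set) \<Rightarrow> bool" where
  "stable_family N d L \<longleftrightarrow>
     (\<forall>l\<le>d. stab (N l) l (L l)) \<and> (\<forall>l<d. shad (N (Suc l)) l (L l) \<subseteq> L (Suc l))"

text \<open>In a stable family only the longest proper prefix has to be tested: a shorter prefix in
  the family would bring in the longest one through shadows. At level 0 only the empty word occurs,
  so the truncated \<open>l - 1\<close> does no harm.\<close>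

definition level_gens :: "(nat \<Rightarrow> nat list set) \<Rightarrow> nat \<Rightarrow> nat list set" where
  "level_gens L l = {a \<in> L l. a = [] \<or> butlast a \<notin> L (l - 1)}"

definition family_gens :: "nat \<Rightarrow> (nat \<Rightarrow> nat list set) \<Rightarrow> nat list set" where
  "family_gens d L = (\<Union>l\<le>d. level_gens L l)"

lemma stable_family_words: "stable_family N d L \<Longrightarrow> l \<le> d \<Longrightarrow> L l \<subseteq> words (N l) l"
  by (simp add: stable_family_def stab_def)

lemma stable_family_finite: "stable_family N d L \<Longrightarrow> l \<le> d \<Longrightarrow> finite (L l)"
  using stable_family_words words_subset_finite by metis

lemma finite_family_gens: "stable_family N d L \<Longrightarrow> finite (family_gens d L)"
  unfolding family_gens_def level_gens_def by (auto dest: stable_family_finite)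

text \<open>Lex sets of the prescribed sizes are chosen independently in each degree. Their closure
  under shadows is a matter of counting: the shadow of \<open>M l\<close> and the set
  \<open>M (Suc l)\<close> are lex sets over the same alphabet, so the inequality of their
  cardinalities already gives inclusion.\<close>

lemma lex_family_exists:
  assumes fam: "stable_family N d L" and N: "\<And>l. N (Suc l) \<le> N l"
  shows "\<exists>M. stable_family N d M \<and> (\<forall>l\<le>d. lexs (N l) l (M l) \<and> card (M l) = card (L l))"
proof -
  have "\<exists>X. l \<le> d \<longrightarrow> lexs (N l) l X \<and> card X = card (L l)" for l
  proof (cases "l \<le> d")
    case True
    then have "card (L l) \<le> card (words (N l) l)"
      using fam by (intro card_mono stable_family_words) auto
    then show ?thesis using lexs_exists by blast
  qed simp
  then obtain M where M: "\<And>l. l \<le> d \<Longrightarrow> lexs (N l) l (M l)" "\<And>l. l \<le> d \<Longrightarrow> card (M l) = card (L l)"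
    by metis
  have "shad (N (Suc l)) l (M l) \<subseteq> M (Suc l)" if "l < d" for l
  proof (rule lexs_card_le_imp_subset)
    show "lexs (N (Suc l)) (Suc l) (shad (N (Suc l)) l (M l))"
      using that M N by (intro lexs_shad[of "N l"]) auto
    show "lexs (N (Suc l)) (Suc l) (M (Suc l))" using that M by simp
    have "card (shad (N (Suc l)) l (M l)) \<le> card (shad (N (Suc l)) l (L l))"
      using that M N fam by (intro card_shad_le[of "N l"]) (auto simp: stable_family_def)
    also have "\<dots> \<le> card (L (Suc l))"
      using that fam by (intro card_mono stable_family_finite) (auto simp: stable_family_def)
    finally show "card (shad (N (Suc l)) l (M l)) \<le> card (M (Suc l))" using that M by simp
  qed
  then have "stable_family N d M"
    using M by (auto simp: stable_family_def intro: lexs_imp_stab)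
  then show ?thesis using M by blast
qed

lemma level_gens_0 [simp]: "stable_family N d L \<Longrightarrow> level_gens L 0 = L 0"
  using stable_family_words[of N d L 0] by (auto simp: level_gens_def)

lemma level_gens_Suc:
  assumes "stable_family N d L" "Suc l \<le> d"
  shows "level_gens L (Suc l) = L (Suc l) - shad (N (Suc l)) l (L l)"
  using stable_family_words[OF assms] by (auto simp: level_gens_def shad_def words_def)

lemma sum_level_gens_Suc:
  fixes \<phi> :: "nat list \<Rightarrow> nat"
  assumes "stable_family N d L" "Suc l \<le> d"
  shows "sum \<phi> (level_gens L (Suc l)) + sum \<phi> (shad (N (Suc l)) l (L l)) = sum \<phi> (L (Suc l))"
proof -
  have "shad (N (Suc l)) l (L l) \<subseteq> L (Suc l)" using assms by (simp add: stable_family_def)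
  from sum.subset_diff[OF this, of \<phi>] show ?thesis
    using assms by (simp add: level_gens_Suc stable_family_finite)
qed

lemma sum_level_gens_le:
  fixes \<phi> :: "nat \<Rightarrow> nat"
  assumes L: "stable_family N d L" and M: "stable_family N d M" and N: "\<And>l. N (Suc l) \<le> N l"
    and lex: "\<And>l. l \<le> d \<Longrightarrow> lexs (N l) l (M l)"
    and card: "\<And>l. l \<le> d \<Longrightarrow> card (M l) = card (L l)"
    and mono: "\<And>b. 1 \<le> b \<Longrightarrow> \<phi> b \<le> \<phi> (Suc b)" and l: "l \<le> d"
  shows "(\<Sum>a\<in>level_gens L l. \<phi> (mx a)) \<le> (\<Sum>a\<in>level_gens M l. \<phi> (mx a))"
proof -
  have stab: "stab (N l) l (L l)" if "l \<le> d" for l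
    using L that by (simp add: stable_family_def)
  have le: "(\<Sum>a\<in>L l. \<phi> (mx a)) \<le> (\<Sum>a\<in>M l. \<phi> (mx a))"
    using stab[OF l] lex[OF l] card[OF l] mono by (rule sum_mx_le)
  show ?thesis
  proof (cases l)
    case 0
    then show ?thesis using le L M by simp
  next
    case (Suc k)
    have "(\<Sum>a\<in>shad (N (Suc k)) k (M k). \<phi> (mx a)) \<le> (\<Sum>a\<in>shad (N (Suc k)) k (L k). \<phi> (mx a))"
      using Suc l stab lex card N by (intro sum_shad_le[of "N k"]) auto
    then show ?thesis
      using sum_level_gens_Suc[OF L, of k "\<lambda>a. \<phi> (mx a)"] sum_level_gens_Suc[OF M, of k "\<lambda>a. \<phi> (mx a)"]
        le Suc l by simp
  qed
qed

text \<open>The Eliahou-Kervaire formula, in shifted coordinates.\<close>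

definition gens_betti :: "nat list set \<Rightarrow> nat \<Rightarrow> int \<Rightarrow> nat" where
  "gens_betti G i j = (\<Sum>a\<in>G. if int (length a + i) = j then (mx a - 1) choose i else 0)"

theorem gens_betti_le:
  assumes L: "stable_family N d L" and M: "stable_family N d M" and N: "\<And>l. N (Suc l) \<le> N l"
    and lex: "\<And>l. l \<le> d \<Longrightarrow> lexs (N l) l (M l)"
    and card: "\<And>l. l \<le> d \<Longrightarrow> card (M l) = card (L l)"
  shows "gens_betti (family_gens d L) i j \<le> gens_betti (family_gens d M) i j"
proof -
  have split: "gens_betti (family_gens d L) i j =
      (\<Sum>l\<le>d. if int (l + i) = j then \<Sum>a\<in>level_gens L l. (mx a - 1) choose i else 0)"
    if L: "stable_family N d L" for L
  proof -
    have len: "length a = l" if "l \<le> d" "a \<in> level_gens L l" for a l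
      using that stable_family_words[OF L] by (auto simp: level_gens_def words_def)
    have "gens_betti (family_gens d L) i j =
        (\<Sum>l\<le>d. \<Sum>a\<in>level_gens L l. if int (length a + i) = j then (mx a - 1) choose i else 0)"
      unfolding gens_betti_def family_gens_def
    proof (rule sum.UNION_disjoint)
      show "\<forall>l\<in>{..d}. finite (level_gens L l)"
        using stable_family_finite[OF L] by (auto simp: level_gens_def)
      show "\<forall>l\<in>{..d}. \<forall>k\<in>{..d}. l \<noteq> k \<longrightarrow> level_gens L l \<inter> level_gens L k = {}"
        using len by (metis atMost_iff disjoint_iff)
    qed simp
    also have "\<dots> = (\<Sum>l\<le>d. if int (l + i) = j then \<Sum>a\<in>level_gens L l. (mx a - 1) choose i else 0)"
      by (intro sum.cong refl) (auto simp: len)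
    finally show ?thesis .
  qed
  have le: "(\<Sum>a\<in>level_gens L l. (mx a - 1) choose i) \<le> (\<Sum>a\<in>level_gens M l. (mx a - 1) choose i)"
    if "l \<le> d" for l
    using sum_level_gens_le[OF L M N lex card, where \<phi> = "\<lambda>b. (b - 1) choose i"] that
    by (simp add: binomial_right_mono)
  show ?thesis unfolding split[OF L] split[OF M]
    using le by (intro sum_mono) auto
qed

section \<open>Polynomials and homogeneous components\<close>

abbreviation lookup :: "('a \<Rightarrow>\<^sub>0 'b::zero) \<Rightarrow> 'a \<Rightarrow> 'b" where
  "lookup \<equiv> Poly_Mapping.lookup"

abbreviation keys :: "('a \<Rightarrow>\<^sub>0 'b::zero) \<Rightarrow> 'a set" where
  "keys \<equiv> Poly_Mapping.keys"

abbreviation single :: "'a \<Rightarrow> 'b \<Rightarrow> 'a \<Rightarrow>\<^sub>0 'b::zero" where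
  "single \<equiv> Poly_Mapping.single"

abbreviation S :: "nat \<Rightarrow> 'k::field mpoly set" where
  "S n \<equiv> carrier (poly_ring n)"

lemma in_S_iff: "p \<in> S n \<longleftrightarrow> (\<forall>m\<in>keys p. keys m \<subseteq> {1..n})"
  by (simp add: poly_ring_def)

lemma keys_add_monomial: "keys (u + v :: monomial) = keys u \<union> keys v"
  by (auto simp: in_keys_iff lookup_add)

lemma S_zero [simp]: "0 \<in> S n"
  by (simp add: in_S_iff)

lemma S_one [simp]: "1 \<in> S n"
  by (simp add: in_S_iff)

lemma S_add [intro]: "p \<in> S n \<Longrightarrow> q \<in> S n \<Longrightarrow> p + q \<in> S n"
  using Poly_Mapping.keys_add[of p q] by (auto simp: in_S_iff)

lemma S_uminus [intro]: "p \<in> S n \<Longrightarrow> - p \<in> S n"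
  by (simp add: in_S_iff in_keys_iff)

lemma S_diff [intro]: "p \<in> S n \<Longrightarrow> q \<in> S n \<Longrightarrow> p - q \<in> S n"
  using S_add[of p n "- q"] S_uminus[of q n] by simp

lemma S_mult [intro]: "p \<in> S n \<Longrightarrow> q \<in> S n \<Longrightarrow> p * q \<in> S n"
  unfolding in_S_iff
proof
  fix m assume p: "\<forall>m\<in>keys p. keys m \<subseteq> {1..n}"
    and q: "\<forall>m\<in>keys q. keys m \<subseteq> {1..n}"
    and "m \<in> keys (p * q)"
  then obtain a b where "m = a + b" "a \<in> keys p" "b \<in> keys q"
    using keys_mult[of p q] by blast
  then show "keys m \<subseteq> {1..n}" using p q by (simp add: keys_add_monomial)
qed

lemma S_sum [intro]: "(\<And>x. x \<in> A \<Longrightarrow> f x \<in> S n) \<Longrightarrow> sum f A \<in> S n"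
  by (induction A rule: infinite_finite_induct) auto

lemma mdeg_superset: "finite A \<Longrightarrow> keys u \<subseteq> A \<Longrightarrow> mdeg u = (\<Sum>i\<in>A. lookup u i)"
  unfolding mdeg_def by (intro sum.mono_neutral_left) (auto simp: in_keys_iff)

lemma mdeg_add: "mdeg (u + v) = mdeg u + mdeg v"
  using mdeg_superset[of "keys u \<union> keys v" u]
    mdeg_superset[of "keys u \<union> keys v" v]
    mdeg_superset[of "keys u \<union> keys v" "u + v"]
  by (simp add: keys_add_monomial lookup_add sum.distrib)

lemma mdeg_zero [simp]: "mdeg 0 = 0"
  by (simp add: mdeg_def)

lemma mdeg_single [simp]: "mdeg (single i c) = c"
  by (simp add: mdeg_def)

lemma homogeneous_zero [simp]: "homogeneous e 0"
  by (simp add: homogeneous_def)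

lemma homogeneous_one [simp]: "homogeneous 0 1"
  by (simp add: homogeneous_def)

lemma homogeneous_add [intro]: "homogeneous e p \<Longrightarrow> homogeneous e q \<Longrightarrow> homogeneous e (p + q)"
  using Poly_Mapping.keys_add[of p q] by (auto simp: homogeneous_def)

lemma homogeneous_uminus [intro]: "homogeneous e p \<Longrightarrow> homogeneous e (- p)"
  by (simp add: homogeneous_def in_keys_iff)

lemma homogeneous_diff [intro]: "homogeneous e p \<Longrightarrow> homogeneous e q \<Longrightarrow> homogeneous e (p - q)"
  using homogeneous_add[of e p "- q"] homogeneous_uminus[of e q] by simp

lemma homogeneous_mult:
  assumes "homogeneous e p" "homogeneous f q" "g = e + f"
  shows "homogeneous g (p * q)"
  unfolding homogeneous_def
proof
  fix m assume "m \<in> keys (p * q)"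
  then obtain a b where "m = a + b" "a \<in> keys p" "b \<in> keys q"
    using keys_mult[of p q] by blast
  then show "int (mdeg m) = g" using assms by (simp add: homogeneous_def mdeg_add)
qed

lemma homogeneous_sum [intro]: "(\<And>x. x \<in> A \<Longrightarrow> homogeneous e (f x)) \<Longrightarrow> homogeneous e (sum f A)"
  by (induction A rule: infinite_finite_induct) auto

lemma homogeneous_single: "homogeneous (int (mdeg m)) (single m c)"
  by (simp add: homogeneous_def)

lemma homogeneous_const_term: "homogeneous e p \<Longrightarrow> lookup p 0 \<noteq> 0 \<Longrightarrow> e = 0"
  by (metis homogeneous_def in_keys_iff mdeg_zero of_nat_0)

text \<open>Degrees are integers because a matrix entry has a difference of shifts as its degree;
  components of negative degree are zero.\<close>

definition hcomp :: "int \<Rightarrow> 'k::field mpoly \<Rightarrow> 'k mpoly" where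
  "hcomp e p = Poly_Mapping.mapp (\<lambda>m c. if int (mdeg m) = e then c else 0) p"

lemma lookup_hcomp: "lookup (hcomp e p) m = (if int (mdeg m) = e then lookup p m else 0)"
  by (auto simp: hcomp_def lookup_mapp in_keys_iff when_def)

lemma hcomp_zero [simp]: "hcomp e 0 = 0"
  by (rule poly_mapping_eqI) (simp add: lookup_hcomp)

lemma hcomp_add: "hcomp e (p + q) = hcomp e p + hcomp e q"
  by (rule poly_mapping_eqI) (simp add: lookup_hcomp lookup_add)

lemma hcomp_sum: "hcomp e (sum f A) = (\<Sum>x\<in>A. hcomp e (f x))"
  by (induction A rule: infinite_finite_induct) (auto simp: hcomp_add)

lemma hcomp_S: "p \<in> S n \<Longrightarrow> hcomp e p \<in> S n"
  by (auto simp: in_S_iff in_keys_iff lookup_hcomp split: if_splits)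

lemma homogeneous_hcomp: "homogeneous e (hcomp e p)"
  by (auto simp: homogeneous_def in_keys_iff lookup_hcomp split: if_splits)

lemma hcomp_homogeneous: "homogeneous a p \<Longrightarrow> hcomp e p = (if a = e then p else 0)"
  by (rule poly_mapping_eqI) (auto simp: lookup_hcomp homogeneous_def in_keys_iff)

lemma sum_monomials: "p = (\<Sum>m\<in>keys p. single m (lookup p m))"
  by (rule poly_mapping_eqI) (auto simp: lookup_sum lookup_single when_def in_keys_iff)

lemma hcomp_mult_homogeneous:
  assumes q: "homogeneous a q"
  shows "hcomp e (p * q) = hcomp (e - a) p * q"
proof -
  have "hcomp e (single m c * q) = hcomp (e - a) (single m c) * q" for m c
  proof -
    have "homogeneous (int (mdeg m) + a) (single m c * q)"
      using homogeneous_single q by (rule homogeneous_mult) simp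
    then show ?thesis
      using homogeneous_single[of m c] by (auto simp: hcomp_homogeneous)
  qed
  then have "hcomp e ((\<Sum>m\<in>keys p. single m (lookup p m)) * q)
      = hcomp (e - a) (\<Sum>m\<in>keys p. single m (lookup p m)) * q"
    by (simp add: sum_distrib_right hcomp_sum)
  then show ?thesis using sum_monomials[of p] by simp
qed

text \<open>A sum of exponent vectors vanishes only if both do. Hence taking constant terms is
  multiplicative, and tensoring with \<open>K\<close> may be done entry by entry.\<close>

lemma lookup_mult_0: "lookup (p * q) 0 = lookup p 0 * lookup q (0 :: monomial)"
  for p q :: "'k::field mpoly"
proof -
  have plus0: "u + v = 0 \<longleftrightarrow> u = 0 \<and> v = 0" for u v :: monomial
    by (auto simp: poly_mapping_eq_iff fun_eq_iff lookup_add)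
  have single: "lookup (single m c * q) 0 = lookup (single m c) 0 * lookup q 0"
    for m c
  proof -
    have "lookup (single m c * (\<Sum>l\<in>keys q. single l (lookup q l))) 0
        = (\<Sum>l\<in>keys q. lookup (single m c) 0 * lookup (single l (lookup q l)) 0)"
      unfolding sum_distrib_left lookup_sum
      by (rule sum.cong[OF refl]) (simp add: mult_single lookup_single when_def plus0)
    also have "\<dots> = lookup (single m c) 0 * lookup (\<Sum>l\<in>keys q. single l (lookup q l)) 0"
      by (simp add: sum_distrib_left lookup_sum)
    finally show ?thesis using sum_monomials[of q] by simp
  qed
  have "lookup ((\<Sum>l\<in>keys p. single l (lookup p l)) * q) 0
     = lookup (\<Sum>l\<in>keys p. single l (lookup p l)) 0 * lookup q 0"
    by (simp add: sum_distrib_right lookup_sum single)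
  then show ?thesis using sum_monomials[of p] by simp
qed

section \<open>Row vectors times matrices\<close>

text \<open>As in \<open>bdry\<close>, row \<open>p\<close> of a matrix is the image of the
  \<open>p\<close>-th basis element, so maps act on row vectors from the right and composition reads
  from left to right.\<close>

definition vm :: "nat \<Rightarrow> (nat \<Rightarrow> 'r::comm_ring_1) \<Rightarrow> (nat \<Rightarrow> nat \<Rightarrow> 'r) \<Rightarrow> nat \<Rightarrow> 'r" where
  "vm r v A l = (\<Sum>p<r. v p * A p l)"

lemma vm_assoc: "vm s (vm r v A) B l = vm r v (\<lambda>p. vm s (A p) B) l"
proof -
  have "vm s (vm r v A) B l = (\<Sum>q<s. \<Sum>p<r. v p * A p q * B q l)"
    by (simp add: vm_def sum_distrib_right)
  also have "\<dots> = (\<Sum>p<r. \<Sum>q<s. v p * A p q * B q l)" by (rule sum.swap)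
  finally show ?thesis by (simp add: vm_def sum_distrib_left mult.assoc)
qed

lemma vm_cong: "(\<And>p. p < r \<Longrightarrow> v p = w p) \<Longrightarrow> (\<And>p. p < r \<Longrightarrow> A p l = B p l) \<Longrightarrow> vm r v A l = vm r w B l"
  unfolding vm_def by (rule sum.cong) auto

lemma vm_add_left: "vm r (\<lambda>p. v p + w p) A l = vm r v A l + vm r w A l"
  by (simp add: vm_def distrib_right sum.distrib)

lemma vm_diff_left: "vm r (\<lambda>p. v p - w p) A l = vm r v A l - vm r w A l"
  by (simp add: vm_def left_diff_distrib sum_subtractf)

lemma vm_uminus_left: "vm r (\<lambda>p. - v p) A l = - vm r v A l"
  by (simp add: vm_def sum_negf)

lemma vm_diff_right: "vm r v (\<lambda>p q. A p q - B p q) l = vm r v A l - vm r v B l"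
  by (simp add: vm_def right_diff_distrib sum_subtractf)

lemma vm_zero_left: "(\<And>p. p < r \<Longrightarrow> v p = 0) \<Longrightarrow> vm r v A l = 0"
  by (simp add: vm_def)

lemma vm_zero_right: "(\<And>p. p < r \<Longrightarrow> A p l = 0) \<Longrightarrow> vm r v A l = 0"
  by (simp add: vm_def)

lemma vm_Suc_0: "vm (Suc 0) v A l = v 0 * A 0 l"
  by (simp add: vm_def)

lemma vm_id: "l < r \<Longrightarrow> vm r v (\<lambda>p q. if p = q then 1 else 0) l = v l"
  by (simp add: vm_def if_distrib[of "\<lambda>x. _ * x"] cong: if_cong)

lemma vm_unit: "k < r \<Longrightarrow> vm r (\<lambda>p. if k = p then 1 else 0) A l = A k l"
  by (simp add: vm_def if_distrib[of "\<lambda>x. x * _"] cong: if_cong)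

lemma sum_lessThan_add: "(\<Sum>k<a + b. f k) = (\<Sum>k<a. f k) + (\<Sum>k<b. f (a + k :: nat))"
  for f :: "nat \<Rightarrow> 'a::comm_monoid_add"
  by (induction b) (auto simp: add.assoc)

lemma vm_append: "vm (a + b) v A l = vm a v A l + vm b (\<lambda>k. v (a + k)) (\<lambda>k. A (a + k)) l"
  by (simp add: vm_def sum_lessThan_add)

lemma vm_S: "(\<And>p. p < r \<Longrightarrow> v p \<in> S n) \<Longrightarrow> (\<And>p. p < r \<Longrightarrow> A p l \<in> S n) \<Longrightarrow> vm r v A l \<in> S n"
  unfolding vm_def by blast

lemma vm_homogeneous:
  assumes "\<And>p. p < r \<Longrightarrow> homogeneous (e - s p) (v p)" "\<And>p. p < r \<Longrightarrow> homogeneous (s p - f) (A p l)"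
  shows "homogeneous (e - f) (vm r v A l)"
  unfolding vm_def
proof (rule homogeneous_sum)
  fix p assume "p \<in> {..<r}"
  then show "homogeneous (e - f) (v p * A p l)"
    using assms by (intro homogeneous_mult[of "e - s p" _ "s p - f"]) auto
qed

lemma lookup_0_vm:
  fixes v :: "nat \<Rightarrow> 'k::field mpoly"
  shows "lookup (vm r v A l) 0 = vm r (\<lambda>p. lookup (v p) 0) (\<lambda>p q. lookup (A p q) 0) l"
  unfolding vm_def lookup_sum by (simp add: lookup_mult_0)

section \<open>Augmented complexes\<close>

text \<open>The augmented complex \<open>\<dots> \<rightarrow> F\<^sub>1 \<rightarrow> F\<^sub>0 \<rightarrow> S\<close> is indexed so that \<open>S\<close> sits in position 0 and
  \<open>F\<^sub>i\<close> in position \<open>Suc i\<close>.\<close>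

definition arank :: "'k::field free_complex \<Rightarrow> nat \<Rightarrow> nat" where
  "arank F i = (case i of 0 \<Rightarrow> 1 | Suc i' \<Rightarrow> frank F i')"

definition ashift :: "'k::field free_complex \<Rightarrow> nat \<Rightarrow> nat \<Rightarrow> int" where
  "ashift F i k = (case i of 0 \<Rightarrow> 0 | Suc i' \<Rightarrow> shift F i' k)"

definition abdry :: "'k::field free_complex \<Rightarrow> nat \<Rightarrow> nat \<Rightarrow> nat \<Rightarrow> 'k mpoly" where
  "abdry F i k l = (case i of 0 \<Rightarrow> aug F k | Suc i' \<Rightarrow> bdry F i' k l)"

lemma aug_0 [simp]: "arank F 0 = Suc 0" "ashift F 0 k = 0"
  by (simp_all add: arank_def ashift_def)

lemma aug_Suc: "arank F (Suc i) = frank F i" "ashift F (Suc i) k = shift F i k"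
    "abdry F 0 k l = aug F k" "abdry F (Suc i) = bdry F i"
  by (simp_all add: arank_def ashift_def abdry_def fun_eq_iff)

text \<open>A resolution in uniform indexing: the augmentation is the boundary with index 0, so
  lifting and cone constructions need not treat it separately. Vectors are constrained only below
  the rank; their values beyond it are irrelevant.\<close>

definition exact_aug :: "nat \<Rightarrow> 'k::field mpoly set \<Rightarrow> 'k free_complex \<Rightarrow> bool" where
  "exact_aug n I F \<longleftrightarrow>
     (\<forall>i. \<forall>k<arank F (Suc i). \<forall>l<arank F i.
        abdry F i k l \<in> S n \<and> homogeneous (ashift F (Suc i) k - ashift F i l) (abdry F i k l)) \<and>
     (\<forall>p. p \<in> I \<longleftrightarrow> (\<exists>w. (\<forall>k<arank F 1. w k \<in> S n) \<and> p = vm (arank F 1) w (abdry F 0) 0)) \<and>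
     (\<forall>i v. (\<forall>k<arank F (Suc i). v k \<in> S n) \<longrightarrow>
        ((\<forall>l<arank F i. vm (arank F (Suc i)) v (abdry F i) l = 0) \<longleftrightarrow>
         (\<exists>w. (\<forall>k<arank F (Suc (Suc i)). w k \<in> S n) \<and>
            (\<forall>l<arank F (Suc i). v l = vm (arank F (Suc (Suc i))) w (abdry F (Suc i)) l))))"

text \<open>Translates equality of kernel and image, as sets of vectors that vanish beyond the rank,
  into a statement about entries below the rank. The truncation \<open>tr\<close> passes between the
  two views.\<close>

lemma exact_free_module_iff:
  fixes B :: "nat \<Rightarrow> nat \<Rightarrow> 'k::field mpoly"
  assumes B: "\<And>k l. k < q \<Longrightarrow> l < r \<Longrightarrow> B k l \<in> S n"
  shows "{v \<in> free_module n r. \<forall>l<s. vm r v A l = 0}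
       = (\<lambda>w l. if l < r then vm q w B l else 0) ` free_module n q
     \<longleftrightarrow> (\<forall>v. (\<forall>k<r. v k \<in> S n) \<longrightarrow> ((\<forall>l<s. vm r v A l = 0) \<longleftrightarrow>
         (\<exists>w. (\<forall>k<q. w k \<in> S n) \<and> (\<forall>l<r. v l = vm q w B l))))"
    (is "?K = ?M \<longleftrightarrow> ?R")
proof -
  define tr :: "nat \<Rightarrow> (nat \<Rightarrow> 'k mpoly) \<Rightarrow> nat \<Rightarrow> 'k mpoly" where "tr r v k = (if k < r then v k else 0)" for r v k
  have tr_fm: "tr r v \<in> free_module n r" if "\<forall>k<r. v k \<in> S n" for r v
    using that by (simp add: tr_def free_module_def)
  have tr_vm: "vm r (tr r v) A l = vm r v A l" for r v A l
    by (rule vm_cong) (auto simp: tr_def)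
  have M: "tr r v \<in> ?M \<longleftrightarrow> (\<exists>w. (\<forall>k<q. w k \<in> S n) \<and> (\<forall>l<r. v l = vm q w B l))" for v
  proof
    assume "tr r v \<in> ?M"
    then obtain w where w: "w \<in> free_module n q" "tr r v = (\<lambda>l. if l < r then vm q w B l else 0)" by blast
    have "v l = vm q w B l" if "l < r" for l
      using fun_cong[OF w(2), of l] that by (simp add: tr_def)
    then show "\<exists>w. (\<forall>k<q. w k \<in> S n) \<and> (\<forall>l<r. v l = vm q w B l)"
      using w(1) by (auto simp: free_module_def)
  next
    assume "\<exists>w. (\<forall>k<q. w k \<in> S n) \<and> (\<forall>l<r. v l = vm q w B l)"
    then obtain w where w: "\<forall>k<q. w k \<in> S n" "\<forall>l<r. v l = vm q w B l" by blast
    have "tr r v = (\<lambda>l. if l < r then vm q (tr q w) B l else 0)"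
      using w(2) by (auto simp: tr_def[of r] tr_vm)
    then show "tr r v \<in> ?M" using tr_fm[OF w(1)] by blast
  qed
  have K: "tr r v \<in> ?K \<longleftrightarrow> (\<forall>l<s. vm r v A l = 0)" if "\<forall>k<r. v k \<in> S n" for v
    using tr_fm[OF that] by (simp add: tr_vm)
  have tr_id: "tr r v = v" if "v \<in> free_module n r" for v
    using that by (auto simp: tr_def free_module_def)
  have M_fm: "?M \<subseteq> free_module n r"
  proof
    fix v assume "v \<in> ?M"
    then obtain w where w: "w \<in> free_module n q" "v = (\<lambda>l. if l < r then vm q w B l else 0)" by blast
    have "vm q w B l \<in> S n" if "l < r" for l
      using w(1) B that by (intro vm_S) (auto simp: free_module_def)
    then show "v \<in> free_module n r" using w(2) by (simp add: free_module_def)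
  qed
  show ?thesis
  proof
    assume "?K = ?M"
    show ?R
    proof (intro allI impI)
      fix v :: "nat \<Rightarrow> 'k mpoly" assume v: "\<forall>k<r. v k \<in> S n"
      have "tr r v \<in> ?K \<longleftrightarrow> tr r v \<in> ?M" by (simp only: \<open>?K = ?M\<close>)
      then show "(\<forall>l<s. vm r v A l = 0) \<longleftrightarrow> (\<exists>w. (\<forall>k<q. w k \<in> S n) \<and> (\<forall>l<r. v l = vm q w B l))"
        by (simp only: K[OF v] M)
    qed
  next
    assume R: ?R
    show "?K = ?M"
    proof (rule Set.set_eqI)
      fix v
      show "v \<in> ?K \<longleftrightarrow> v \<in> ?M"
      proof (cases "v \<in> free_module n r")
        case True
        then have v: "\<forall>k<r. v k \<in> S n" by (simp add: free_module_def)
        have "tr r v \<in> ?K \<longleftrightarrow> tr r v \<in> ?M" unfolding K[OF v] M using R v by blast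
        then show ?thesis using tr_id[OF True] by simp
      next
        case False
        then show ?thesis using M_fm by blast
      qed
    qed
  qed
qed

lemma graded_free_resolution_iff: "graded_free_resolution n I F \<longleftrightarrow> exact_aug n I F"
proof -
  note [simp] = aug_Suc
  define hom where "hom \<longleftrightarrow> (\<forall>i. \<forall>k<frank F (Suc i). \<forall>l<frank F i.
        bdry F i k l \<in> S n \<and> homogeneous (shift F (Suc i) k - shift F i l) (bdry F i k l))"
  define hom0 where "hom0 \<longleftrightarrow> (\<forall>k<frank F 0. aug F k \<in> S n \<and> homogeneous (shift F 0 k) (aug F k))"
  have H: "(\<forall>i. \<forall>k<arank F (Suc i). \<forall>l<arank F i.
        abdry F i k l \<in> S n \<and> homogeneous (ashift F (Suc i) k - ashift F i l) (abdry F i k l)) \<longleftrightarrow> hom0 \<and> hom"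
    (is "?L \<longleftrightarrow> _")
  proof
    assume L: ?L
    have "hom0" using L[rule_format, of _ 0] by (simp add: hom0_def)
    moreover have "hom" using L[rule_format, of _ "Suc _"] by (simp add: hom_def)
    ultimately show "hom0 \<and> hom" ..
  next
    assume "hom0 \<and> hom"
    then show ?L unfolding hom0_def hom_def
      by (intro allI, case_tac i) auto
  qed
  have aug_vm: "aug_map F v = vm (frank F 0) v (abdry F 0) l" for v l
    by (simp add: aug_map_def vm_def)
  have bd_vm: "bdry_map F i v = (\<lambda>l. if l < frank F i then vm (frank F (Suc i)) v (bdry F i) l else 0)" for i v
    unfolding bdry_map_def vm_def ..
  have aug: "aug_map F ` free_module n (frank F 0) = I \<longleftrightarrow>
      (\<forall>p. p \<in> I \<longleftrightarrow> (\<exists>w. (\<forall>k<arank F 1. w k \<in> S n) \<and> p = vm (arank F 1) w (abdry F 0) 0))"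
  proof -
    have "p \<in> aug_map F ` free_module n (frank F 0) \<longleftrightarrow>
        (\<exists>w. (\<forall>k<frank F 0. w k \<in> S n) \<and> p = vm (frank F 0) w (abdry F 0) 0)" (is "_ \<longleftrightarrow> ?R") for p
    proof
      assume "p \<in> aug_map F ` free_module n (frank F 0)"
      then show ?R by (auto simp: aug_vm[of _ 0] free_module_def)
    next
      assume ?R
      then obtain w where w: "\<forall>k<frank F 0. w k \<in> S n" "p = vm (frank F 0) w (abdry F 0) 0" by blast
      let ?w = "\<lambda>k. if k < frank F 0 then w k else 0"
      have "?w \<in> free_module n (frank F 0)" using w by (simp add: free_module_def)
      moreover have "p = aug_map F ?w" unfolding aug_vm[of _ 0] w(2) by (rule vm_cong) auto
      ultimately show "p \<in> aug_map F ` free_module n (frank F 0)" by blast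
    qed
    then show ?thesis by (auto simp: set_eq_iff)
  qed
  define ex where "ex i \<longleftrightarrow> (\<forall>v. (\<forall>k<arank F (Suc i). v k \<in> S n) \<longrightarrow>
        ((\<forall>l<arank F i. vm (arank F (Suc i)) v (abdry F i) l = 0) \<longleftrightarrow>
         (\<exists>w. (\<forall>k<arank F (Suc (Suc i)). w k \<in> S n) \<and>
            (\<forall>l<arank F (Suc i). v l = vm (arank F (Suc (Suc i))) w (abdry F (Suc i)) l))))" for i
  \<comment> \<open>The image lies in the free module only if the boundary entries lie in the ring;
    that is part of \<open>hom\<close>, hence the final case distinction.\<close>
  have ex0: "{v \<in> free_module n (frank F 0). aug_map F v = 0} = bdry_map F 0 ` free_module n (frank F 1) \<longleftrightarrow> ex 0"
    if hom
    using exact_free_module_iff[of "frank F (Suc 0)" "frank F 0" "bdry F 0" n "Suc 0" "abdry F 0"] that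
    by (simp add: ex_def hom_def aug_vm[of _ 0] bd_vm[abs_def])
  have exS: "{v \<in> free_module n (frank F (Suc i)). bdry_map F i v = (\<lambda>_. 0)}
      = bdry_map F (Suc i) ` free_module n (frank F (Suc (Suc i))) \<longleftrightarrow> ex (Suc i)" if hom for i
  proof -
    have "bdry_map F i v = (\<lambda>_. 0) \<longleftrightarrow> (\<forall>l<frank F i. vm (frank F (Suc i)) v (bdry F i) l = 0)" for v
      by (auto simp: bd_vm fun_eq_iff)
    then show ?thesis
      using exact_free_module_iff[of "frank F (Suc (Suc i))" "frank F (Suc i)" "bdry F (Suc i)" n "frank F i" "bdry F i"] that
      by (simp add: ex_def hom_def bd_vm[of "Suc i", abs_def])
  qed
  have all: "(\<forall>i. ex i) \<longleftrightarrow> ex 0 \<and> (\<forall>i. ex (Suc i))"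
    by (metis not0_implies_Suc)
  have G: "graded_free_resolution n I F \<longleftrightarrow> hom \<and> hom0 \<and> aug_map F ` free_module n (frank F 0) = I \<and>
     {v \<in> free_module n (frank F 0). aug_map F v = 0} = bdry_map F 0 ` free_module n (frank F 1) \<and>
     (\<forall>i. {v \<in> free_module n (frank F (Suc i)). bdry_map F i v = (\<lambda>_. 0)}
       = bdry_map F (Suc i) ` free_module n (frank F (Suc (Suc i))))"
    unfolding graded_free_resolution_def hom_def hom0_def by blast
  have E: "exact_aug n I F \<longleftrightarrow> (hom0 \<and> hom) \<and> aug_map F ` free_module n (frank F 0) = I \<and> (\<forall>i. ex i)"
    unfolding exact_aug_def H aug ex_def ..
  show ?thesis
    unfolding G E all by (cases hom) (simp_all only: ex0 exS simp_thms)
qed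

section \<open>Comparison of resolutions\<close>

lemma exact_augD:
  assumes "exact_aug n I F"
  shows exact_aug_S: "k < arank F (Suc i) \<Longrightarrow> l < arank F i \<Longrightarrow> abdry F i k l \<in> S n"
    and exact_aug_homogeneous: "k < arank F (Suc i) \<Longrightarrow> l < arank F i \<Longrightarrow>
          homogeneous (ashift F (Suc i) k - ashift F i l) (abdry F i k l)"
    and exact_aug_ideal: "p \<in> I \<longleftrightarrow> (\<exists>w. (\<forall>k<arank F 1. w k \<in> S n) \<and> p = vm (arank F 1) w (abdry F 0) 0)"
    and exact_aug_exact: "(\<And>k. k < arank F (Suc i) \<Longrightarrow> v k \<in> S n) \<Longrightarrow>
          (\<forall>l<arank F i. vm (arank F (Suc i)) v (abdry F i) l = 0) \<longleftrightarrow>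
          (\<exists>w. (\<forall>k<arank F (Suc (Suc i)). w k \<in> S n) \<and>
            (\<forall>l<arank F (Suc i). v l = vm (arank F (Suc (Suc i))) w (abdry F (Suc i)) l))"
  using assms unfolding exact_aug_def by blast+

text \<open>Row \<open>k\<close> is the boundary of a unit vector, so exactness read from image to
  kernel annihilates it.\<close>

lemma exact_aug_complex:
  fixes F :: "'k::field free_complex"
  assumes F: "exact_aug n I F" and k: "k < arank F (Suc (Suc i))" and l: "l < arank F i"
  shows "vm (arank F (Suc i)) (abdry F (Suc i) k) (abdry F i) l = 0"
proof -
  let ?w = "\<lambda>p. if k = p then 1 else 0 :: 'k mpoly"
  have "\<forall>l<arank F (Suc i). abdry F (Suc i) k l = vm (arank F (Suc (Suc i))) ?w (abdry F (Suc i)) l"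
    using k by (simp add: vm_unit)
  moreover have "\<forall>k<arank F (Suc (Suc i)). ?w k \<in> S n" by simp
  ultimately have "\<exists>w. (\<forall>k<arank F (Suc (Suc i)). w k \<in> S n) \<and>
      (\<forall>l<arank F (Suc i). abdry F (Suc i) k l = vm (arank F (Suc (Suc i))) w (abdry F (Suc i)) l)"
    by (intro exI[of _ ?w] conjI)
  moreover have "abdry F (Suc i) k p \<in> S n" if "p < arank F (Suc i)" for p
    using exact_aug_S[OF F k that] .
  ultimately show ?thesis using exact_aug_exact[OF F] l by blast
qed

text \<open>Homogeneous maps of degree \<open>a\<close> between graded free modules with basis
  degrees \<open>s\<close> and \<open>s'\<close>. Differentials have \<open>a = 0\<close>; lifts of
  multiplication by a monomial \<open>u\<close> have \<open>a = deg u\<close>.\<close>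

definition graded_mat ::
    "nat \<Rightarrow> int \<Rightarrow> nat \<Rightarrow> (nat \<Rightarrow> int) \<Rightarrow> nat \<Rightarrow> (nat \<Rightarrow> int) \<Rightarrow> (nat \<Rightarrow> nat \<Rightarrow> 'k::field mpoly) \<Rightarrow> bool" where
  "graded_mat n a r s r' s' A \<longleftrightarrow>
     (\<forall>k<r. \<forall>l<r'. A k l \<in> S n \<and> homogeneous (a + s k - s' l) (A k l))"

lemma graded_mat_mult:
  assumes A: "graded_mat n a r s q t A" and B: "graded_mat n b q t r' s' B"
  shows "graded_mat n (a + b) r s r' s' (\<lambda>k. vm q (A k) B)"
  unfolding graded_mat_def
proof (intro allI impI conjI)
  fix k l assume "k < r" "l < r'"
  then show "vm q (A k) B l \<in> S n" using A B by (intro vm_S) (auto simp: graded_mat_def)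
  have "homogeneous ((a + b + s k) - s' l) (vm q (A k) B l)"
  proof (rule vm_homogeneous)
    show "homogeneous (a + b + s k - (b + t p)) (A k p)" if "p < q" for p
      using A that \<open>k < r\<close> by (simp add: graded_mat_def add_diff_eq)
    show "homogeneous (b + t p - s' l) (B p l)" if "p < q" for p
      using B that \<open>l < r'\<close> by (simp add: graded_mat_def)
  qed
  then show "homogeneous (a + b + s k - s' l) (vm q (A k) B l)" .
qed

lemma graded_mat_diff:
  "graded_mat n a r s r' s' A \<Longrightarrow> graded_mat n a r s r' s' B \<Longrightarrow> graded_mat n a r s r' s' (\<lambda>k l. A k l - B k l)"
  unfolding graded_mat_def by blast

lemma graded_mat_abdry:
  "exact_aug n I F \<Longrightarrow> graded_mat n 0 (arank F (Suc i)) (ashift F (Suc i)) (arank F i) (ashift F i) (abdry F i)"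
  using exact_aug_S exact_aug_homogeneous by (fastforce simp: graded_mat_def)

text \<open>Taking homogeneous components of arbitrary preimages makes them homogeneous.\<close>

lemma graded_lift:
  assumes B: "graded_mat n 0 q t r' s' B" and A: "graded_mat n a r s r' s' A"
    and ex: "\<And>k. k < r \<Longrightarrow> \<exists>w. (\<forall>p<q. w p \<in> S n) \<and> (\<forall>l<r'. A k l = vm q w B l)"
  shows "\<exists>W. graded_mat n a r s q t W \<and> (\<forall>k<r. \<forall>l<r'. A k l = vm q (W k) B l)"
proof -
  obtain w where w: "\<And>k p. k < r \<Longrightarrow> p < q \<Longrightarrow> w k p \<in> S n"
    "\<And>k l. k < r \<Longrightarrow> l < r' \<Longrightarrow> A k l = vm q (w k) B l"
    using ex by metis
  define W where "W k p = hcomp (a + s k - t p) (w k p)" for k p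
  have "graded_mat n a r s q t W"
    using w(1) by (simp add: graded_mat_def W_def hcomp_S homogeneous_hcomp)
  moreover have "A k l = vm q (W k) B l" if "k < r" "l < r'" for k l
  proof -
    have "A k l = hcomp (a + s k - s' l) (A k l)"
      using A that hcomp_homogeneous[of "a + s k - s' l" "A k l"] by (simp add: graded_mat_def)
    also have "\<dots> = (\<Sum>p<q. hcomp (a + s k - s' l) (w k p * B p l))"
      by (simp add: w(2)[OF that] vm_def hcomp_sum)
    also have "\<dots> = vm q (W k) B l"
      unfolding vm_def
    proof (rule sum.cong[OF refl])
      fix p assume "p \<in> {..<q}"
      then have "homogeneous (t p - s' l) (B p l)"
        using B that by (simp add: graded_mat_def)
      then show "hcomp (a + s k - s' l) (w k p * B p l) = W k p * B p l"
        by (simp add: hcomp_mult_homogeneous W_def diff_diff_eq2 add_diff_eq)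
    qed
    finally show ?thesis .
  qed
  ultimately show ?thesis by blast
qed

definition chain_map ::
    "nat \<Rightarrow> int \<Rightarrow> 'k::field free_complex \<Rightarrow> 'k free_complex \<Rightarrow> (nat \<Rightarrow> nat \<Rightarrow> nat \<Rightarrow> 'k mpoly) \<Rightarrow> bool" where
  "chain_map n a F G \<Phi> \<longleftrightarrow>
     (\<forall>i. graded_mat n a (arank F i) (ashift F i) (arank G i) (ashift G i) (\<Phi> i)) \<and>
     (\<forall>i. \<forall>k<arank F (Suc i). \<forall>l<arank G i.
        vm (arank F i) (abdry F i k) (\<Phi> i) l = vm (arank G (Suc i)) (\<Phi> (Suc i) k) (abdry G i) l)"

lemma chain_mapD:
  assumes "chain_map n a F G \<Phi>"
  shows chain_map_graded: "graded_mat n a (arank F i) (ashift F i) (arank G i) (ashift G i) (\<Phi> i)"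
    and chain_map_comm: "k < arank F (Suc i) \<Longrightarrow> l < arank G i \<Longrightarrow>
      vm (arank F i) (abdry F i k) (\<Phi> i) l = vm (arank G (Suc i)) (\<Phi> (Suc i) k) (abdry G i) l"
  using assms by (auto simp: chain_map_def)

lemma exact_aug_row:
  assumes "exact_aug n I F" "k < arank F (Suc 0)"
  shows "abdry F 0 k 0 \<in> I"
proof -
  have "\<exists>w. (\<forall>p<arank F 1. w p \<in> S n) \<and> abdry F 0 k 0 = vm (arank F 1) w (abdry F 0) 0"
    using assms(2) by (intro exI[of _ "\<lambda>p. if k = p then 1 else 0"]) (simp add: vm_unit)
  then show ?thesis using exact_aug_ideal[OF assms(1)] by blast
qed

text \<open>Lifts multiplication by \<open>u\<close>, viewed as the map in position 0. The case
  \<open>u = 1\<close> compares two resolutions of one ideal; a monomial \<open>u\<close> gives the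
  map whose cone adds a generator.\<close>

theorem comparison:
  fixes F G :: "'k::field free_complex"
  assumes F: "exact_aug n I F" and G: "exact_aug n J G"
    and u: "u \<in> S n" "homogeneous a u" and IJ: "\<And>p. p \<in> I \<Longrightarrow> p * u \<in> J"
  shows "\<exists>\<Phi>. chain_map n a F G \<Phi> \<and> \<Phi> 0 0 0 = u"
proof -
  define good where "good i A \<longleftrightarrow> graded_mat n a (arank F i) (ashift F i) (arank G i) (ashift G i) A" for i and A :: "nat \<Rightarrow> nat \<Rightarrow> 'k mpoly"
  \<comment> \<open>\<open>lft\<close> says that the next square can be filled. It has to be part of
    the invariant, because each matrix must be chosen so that the construction can continue.\<close>
  define lft where "lft i A \<longleftrightarrow> (\<forall>k<arank F (Suc i). \<exists>w. (\<forall>q<arank G (Suc i). w q \<in> S n) \<and>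
      (\<forall>l<arank G i. vm (arank F i) (abdry F i k) A l = vm (arank G (Suc i)) w (abdry G i) l))" for i and A :: "nat \<Rightarrow> nat \<Rightarrow> 'k mpoly"
  define comm where "comm i A B \<longleftrightarrow> (\<forall>k<arank F (Suc i). \<forall>l<arank G i.
      vm (arank F i) (abdry F i k) A l = vm (arank G (Suc i)) (B k) (abdry G i) l)" for i and A B :: "nat \<Rightarrow> nat \<Rightarrow> 'k mpoly"
  have "\<exists>\<Phi>. \<forall>i. (good i (\<Phi> i) \<and> lft i (\<Phi> i) \<and> (i = 0 \<longrightarrow> \<Phi> i 0 0 = u)) \<and> comm i (\<Phi> i) (\<Phi> (Suc i))"
  proof (rule dependent_nat_choice)
    let ?A = "\<lambda>k l. u"
    have "good 0 ?A" using u by (simp add: good_def graded_mat_def)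
    moreover have "lft 0 ?A"
      unfolding lft_def
    proof (intro allI impI)
      fix k assume "k < arank F (Suc 0)"
      then have "abdry F 0 k 0 * u \<in> J" using IJ exact_aug_row[OF F] by blast
      then obtain w where "\<forall>q<arank G 1. w q \<in> S n" "abdry F 0 k 0 * u = vm (arank G 1) w (abdry G 0) 0"
        using exact_aug_ideal[OF G] by blast
      then show "\<exists>w. (\<forall>q<arank G (Suc 0). w q \<in> S n) \<and>
          (\<forall>l<arank G 0. vm (arank F 0) (abdry F 0 k) ?A l = vm (arank G (Suc 0)) w (abdry G 0) l)"
        by (intro exI[of _ w]) (simp add: vm_Suc_0)
    qed
    ultimately show "\<exists>A. good 0 A \<and> lft 0 A \<and> (0 = (0::nat) \<longrightarrow> A 0 0 = u)" by blast
  next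
    fix A i assume "good i A \<and> lft i A \<and> (i = 0 \<longrightarrow> A 0 0 = u)"
    then have A: "good i A" and lftA: "lft i A" by auto
    have gr: "graded_mat n a (arank F (Suc i)) (ashift F (Suc i)) (arank G i) (ashift G i) (\<lambda>k. vm (arank F i) (abdry F i k) A)"
      using graded_mat_mult[OF graded_mat_abdry[OF F] A[unfolded good_def]] by simp
    obtain B where B: "good (Suc i) B" "comm i A B"
      using graded_lift[OF graded_mat_abdry[OF G] gr] lftA unfolding lft_def good_def comm_def by blast
    have "lft (Suc i) B"
      unfolding lft_def
    proof (intro allI impI)
      fix k assume k: "k < arank F (Suc (Suc i))"
      have "vm (arank F (Suc i)) (abdry F (Suc i) k) B l \<in> S n" if "l < arank G (Suc i)" for l
        using B(1) that exact_aug_S[OF F k] by (intro vm_S) (auto simp: good_def graded_mat_def)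
      moreover have "vm (arank G (Suc i)) (vm (arank F (Suc i)) (abdry F (Suc i) k) B) (abdry G i) l = 0"
        if l: "l < arank G i" for l
      proof -
        have "vm (arank G (Suc i)) (vm (arank F (Suc i)) (abdry F (Suc i) k) B) (abdry G i) l
            = vm (arank F (Suc i)) (abdry F (Suc i) k) (\<lambda>p. vm (arank F i) (abdry F i p) A) l"
          unfolding vm_assoc using B(2) l by (intro vm_cong) (auto simp: comm_def)
        also have "\<dots> = vm (arank F i) (vm (arank F (Suc i)) (abdry F (Suc i) k) (abdry F i)) A l"
          by (simp add: vm_assoc)
        also have "\<dots> = 0"
          using exact_aug_complex[OF F k] by (rule vm_zero_left)
        finally show ?thesis .
      qed
      ultimately show "\<exists>w. (\<forall>q<arank G (Suc (Suc i)). w q \<in> S n) \<and>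
          (\<forall>l<arank G (Suc i). vm (arank F (Suc i)) (abdry F (Suc i) k) B l
             = vm (arank G (Suc (Suc i))) w (abdry G (Suc i)) l)"
        using exact_aug_exact[OF G, where v = "vm (arank F (Suc i)) (abdry F (Suc i) k) B"] by blast
    qed
    then show "\<exists>B. (good (Suc i) B \<and> lft (Suc i) B \<and> (Suc i = 0 \<longrightarrow> B 0 0 = u)) \<and> comm i A B"
      using B by blast
  qed
  then obtain \<Phi> where \<Phi>: "\<And>i. good i (\<Phi> i)" "\<And>i. comm i (\<Phi> i) (\<Phi> (Suc i))" "\<Phi> 0 0 0 = u"
    by metis
  then have "chain_map n a F G \<Phi>" by (auto simp: chain_map_def good_def comm_def)
  then show ?thesis using \<Phi>(3) by blast
qed

text \<open>\<open>res i A\<close> is what remains of the chain map after subtracting the homotopy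
  built so far. Its boundary vanishes, so exactness supplies the next piece. The component on
  \<open>S\<close> is zero, which later removes the augmentation term in homological degree
  0.\<close>

lemma null_homotopy:
  fixes F :: "'k::field free_complex"
  assumes F: "exact_aug n I F" and \<phi>: "chain_map n 0 F F \<phi>" and \<phi>0: "\<phi> 0 0 0 = 0"
  shows "\<exists>H. (\<forall>i. graded_mat n 0 (arank F i) (ashift F i) (arank F (Suc i)) (ashift F (Suc i)) (H i)) \<and>
    (\<forall>l. H 0 0 l = 0) \<and> (\<forall>i. \<forall>k<arank F (Suc i). \<forall>l<arank F (Suc i).
       \<phi> (Suc i) k l = vm (arank F (Suc (Suc i))) (H (Suc i) k) (abdry F (Suc i)) l
         + vm (arank F i) (abdry F i k) (H i) l)"
proof -
  define good where "good i A \<longleftrightarrow> graded_mat n 0 (arank F i) (ashift F i) (arank F (Suc i)) (ashift F (Suc i)) A" for i and A :: "nat \<Rightarrow> nat \<Rightarrow> 'k mpoly"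
  define res where "res i A k l = \<phi> (Suc i) k l - vm (arank F i) (abdry F i k) A l" for i A k l
  define lft where "lft i A \<longleftrightarrow> (\<forall>k<arank F (Suc i). \<exists>w. (\<forall>q<arank F (Suc (Suc i)). w q \<in> S n) \<and>
      (\<forall>l<arank F (Suc i). res i A k l = vm (arank F (Suc (Suc i))) w (abdry F (Suc i)) l))" for i and A :: "nat \<Rightarrow> nat \<Rightarrow> 'k mpoly"
  define comm where "comm i A B \<longleftrightarrow> (\<forall>k<arank F (Suc i). \<forall>l<arank F (Suc i).
      res i A k l = vm (arank F (Suc (Suc i))) (B k) (abdry F (Suc i)) l)" for i and A B :: "nat \<Rightarrow> nat \<Rightarrow> 'k mpoly"
  have res_graded: "graded_mat n 0 (arank F (Suc i)) (ashift F (Suc i)) (arank F (Suc i)) (ashift F (Suc i)) (res i A)"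
    if "good i A" for i A
  proof -
    have "graded_mat n 0 (arank F (Suc i)) (ashift F (Suc i)) (arank F (Suc i)) (ashift F (Suc i))
        (\<lambda>k. vm (arank F i) (abdry F i k) A)"
      using graded_mat_mult[OF graded_mat_abdry[OF F] that[unfolded good_def]] by simp
    from graded_mat_diff[OF chain_map_graded[OF \<phi>] this] show ?thesis
      by (simp add: res_def[abs_def])
  qed
  have lftI: "lft i A" if A: "good i A"
    and z: "\<And>k l. k < arank F (Suc i) \<Longrightarrow> l < arank F i \<Longrightarrow> vm (arank F (Suc i)) (res i A k) (abdry F i) l = 0" for i A
    unfolding lft_def
  proof (intro allI impI)
    fix k assume k: "k < arank F (Suc i)"
    have "res i A k l \<in> S n" if "l < arank F (Suc i)" for l
      using res_graded[OF A] k that by (simp add: graded_mat_def)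
    then show "\<exists>w. (\<forall>q<arank F (Suc (Suc i)). w q \<in> S n) \<and>
      (\<forall>l<arank F (Suc i). res i A k l = vm (arank F (Suc (Suc i))) w (abdry F (Suc i)) l)"
      using exact_aug_exact[OF F, where v = "res i A k"] z[OF k] by blast
  qed
  have res_bdry: "vm (arank F (Suc i)) (res i A k) (abdry F i) l
      = vm (arank F i) (abdry F i k) (\<phi> i) l - vm (arank F i) (abdry F i k) (\<lambda>p. vm (arank F (Suc i)) (A p) (abdry F i)) l"
    if "k < arank F (Suc i)" "l < arank F i" for i A k l
    unfolding res_def vm_diff_left vm_assoc using chain_map_comm[OF \<phi> that] by simp
  have "\<exists>H. \<forall>i. (good i (H i) \<and> lft i (H i) \<and> (i = 0 \<longrightarrow> H i = (\<lambda>k l. 0))) \<and> comm i (H i) (H (Suc i))"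
  proof (rule dependent_nat_choice)
    let ?A = "\<lambda>k l. 0"
    have g: "good 0 ?A" by (simp add: good_def graded_mat_def)
    moreover have "lft 0 ?A"
    proof (rule lftI[OF g])
      fix k l assume "k < arank F (Suc 0)" "l < arank F 0"
      then show "vm (arank F (Suc 0)) (res 0 ?A k) (abdry F 0) l = 0"
        using \<phi>0 by (simp only: res_bdry) (simp add: vm_Suc_0 vm_zero_left)
    qed
    ultimately show "\<exists>A. good 0 A \<and> lft 0 A \<and> (0 = (0::nat) \<longrightarrow> A = (\<lambda>k l. 0))" by blast
  next
    fix A i assume "good i A \<and> lft i A \<and> (i = 0 \<longrightarrow> A = (\<lambda>k l. 0))"
    then have A: "good i A" and lftA: "lft i A" by auto
    obtain B where B: "good (Suc i) B" "comm i A B"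
      using graded_lift[OF graded_mat_abdry[OF F] res_graded[OF A]] lftA
      unfolding lft_def good_def comm_def by blast
    have "lft (Suc i) B"
    proof (rule lftI[OF B(1)])
      fix k l assume k: "k < arank F (Suc (Suc i))" and l: "l < arank F (Suc i)"
      have "vm (arank F (Suc i)) (abdry F (Suc i) k) (\<lambda>p. vm (arank F (Suc (Suc i))) (B p) (abdry F (Suc i))) l
          = vm (arank F (Suc i)) (abdry F (Suc i) k) (res i A) l"
        using B(2) l by (intro vm_cong) (auto simp: comm_def)
      also have "\<dots> = vm (arank F (Suc i)) (abdry F (Suc i) k) (\<phi> (Suc i)) l
          - vm (arank F i) (vm (arank F (Suc i)) (abdry F (Suc i) k) (abdry F i)) A l"
        by (simp add: res_def[abs_def] vm_diff_right vm_assoc)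
      also have "vm (arank F i) (vm (arank F (Suc i)) (abdry F (Suc i) k) (abdry F i)) A l = 0"
        using exact_aug_complex[OF F k] by (rule vm_zero_left)
      finally show "vm (arank F (Suc (Suc i))) (res (Suc i) B k) (abdry F (Suc i)) l = 0"
        unfolding res_bdry[OF k l] by simp
    qed
    then show "\<exists>B. (good (Suc i) B \<and> lft (Suc i) B \<and> (Suc i = 0 \<longrightarrow> B = (\<lambda>k l. 0))) \<and> comm i A B"
      using B by blast
  qed
  then obtain H where H: "\<And>i. good i (H i)" "\<And>i. comm i (H i) (H (Suc i))" "H 0 = (\<lambda>k l. 0)" by metis
  show ?thesis
    using H by (intro exI[of _ H]) (auto simp: good_def comm_def res_def algebra_simps)
qed

section \<open>Dimensions of subquotients\<close>

text \<open>\<open>fB\<close> says that \<open>f\<close> is injective on classes. A basis of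
  \<open>B\<close> is extended to one of \<open>V\<close>; the images of the added vectors, together
  with a basis of \<open>B'\<close>, are independent in \<open>V'\<close>.\<close>

lemma (in vector_space) dim_quotient_le:
  assumes V: "subspace V" "V \<subseteq> span T" "finite T" and B: "subspace B" "B \<subseteq> V"
    and V': "V' \<subseteq> span T'" "finite T'" and B': "subspace B'" "B' \<subseteq> V'"
    and f: "Vector_Spaces.linear scale scale f" and fV: "\<And>v. v \<in> V \<Longrightarrow> f v \<in> V'"
    and fB: "\<And>v. v \<in> V \<Longrightarrow> f v \<in> B' \<Longrightarrow> v \<in> B"
  shows "dim V - dim B \<le> dim V' - dim B'"
proof -
  interpret f: Vector_Spaces.linear scale scale f by (rule f)
  obtain BB where BB: "BB \<subseteq> B" "independent BB" "B \<subseteq> span BB" "card BB = dim B"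
    using basis_exists by blast
  obtain BZ where BZ: "BB \<subseteq> BZ" "BZ \<subseteq> V" "independent BZ" "V \<subseteq> span BZ"
    using maximal_independent_subset_extend[of BB V] BB B by blast
  obtain BB' where BB': "BB' \<subseteq> B'" "independent BB'" "B' \<subseteq> span BB'" "card BB' = dim B'"
    using basis_exists by blast
  obtain BZ' where BZ': "BZ' \<subseteq> V'" "independent BZ'" "V' \<subseteq> span BZ'" "card BZ' = dim V'"
    using basis_exists by blast
  have finBZ: "finite BZ" using independent_span_bound[OF V(3) BZ(3)] BZ(2) V(2) by blast
  have finBZ': "finite BZ'" using independent_span_bound[OF V'(2) BZ'(2)] BZ'(1) V'(1) by blast
  have finBB': "finite BB'" using independent_span_bound[OF V'(2) BB'(2)] BB'(1) B'(2) V'(1) by blast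
  have spanB': "span BB' \<subseteq> B'" using BB'(1) B'(1) span_minimal by blast
  have spanB: "B = span BB" using BB(1,3) B(1) span_minimal by blast
  have ind: "D \<subseteq> BZ - BB \<Longrightarrow> independent (f ` D \<union> BB') \<and> card (f ` D \<union> BB') = card D + card BB'"
    if "finite D" for D
    using that
  proof (induction D rule: finite_induct)
    case empty
    then show ?case using BB' by simp
  next
    case (insert c D)
    \<comment> \<open>Otherwise \<open>c\<close> minus some element of \<open>span D\<close> is
      mapped into \<open>B'\<close>, hence lies in \<open>B\<close>, contradicting the independence
      of the extended basis.\<close>
    have "f c \<notin> span (f ` D \<union> BB')"
    proof
      assume "f c \<in> span (f ` D \<union> BB')"
      then obtain x b where xb: "x \<in> span D" "b \<in> span BB'" "f c = f x + b"
        unfolding span_Un f.span_image by blast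
      have "span D \<subseteq> V" using insert.prems BZ(2) V(1) by (intro span_minimal) auto
      then have "c - x \<in> V" using insert.prems BZ(2) V(1) xb(1) by (intro subspace_diff) auto
      moreover have "f (c - x) \<in> B'" using xb spanB' by (auto simp: f.diff)
      ultimately have "c - x \<in> span BB" using fB spanB by blast
      then have "x + (c - x) \<in> span (D \<union> BB)"
        using xb(1) by (intro span_add) (meson span_mono subsetD sup_ge1 sup_ge2)+
      then have "c \<in> span (BZ - {c})"
        using span_mono[of "D \<union> BB" "BZ - {c}"] insert BZ(1) by auto
      then show False using BZ(3) insert.prems by (auto simp: dependent_def)
    qed
    moreover from this have "f c \<notin> f ` D \<union> BB'" by (metis span_base)
    ultimately show ?case using insert finBB'
      by (simp add: independent_insertI)
  qed
  have "finite (BZ - BB)" using finBZ by simp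
  from ind[OF this] have i: "independent (f ` (BZ - BB) \<union> BB')" "card (f ` (BZ - BB) \<union> BB') = card (BZ - BB) + card BB'"
    by auto
  have "f ` (BZ - BB) \<union> BB' \<subseteq> V'" using fV BZ(2) BB'(1) B'(2) by blast
  then have "f ` (BZ - BB) \<union> BB' \<subseteq> span BZ'" using BZ'(3) by blast
  from independent_span_bound[OF finBZ' i(1) this] have "card (BZ - BB) + card BB' \<le> card BZ'"
    using i(2) by simp
  moreover have "card (BZ - BB) = card BZ - card BB"
    using BZ(1) finBZ by (intro card_Diff_subset) (auto intro: finite_subset)
  moreover have "card BZ = dim V" using BZ by (intro basis_card_eq_dim)
  ultimately show ?thesis using BB(4) BB'(4) BZ'(4) by simp
qed

interpretation kvec: vector_space "\<lambda>(c :: 'k::field) (v :: nat \<Rightarrow> 'k) k. c * v k"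
  by unfold_locales (auto simp: fun_eq_iff algebra_simps)

lemma sum_fun_apply: "(\<Sum>x\<in>A. f x) k = (\<Sum>x\<in>A. f x k)"
  by (induction A rule: infinite_finite_induct) auto

definition unit_vec :: "nat \<Rightarrow> nat \<Rightarrow> 'k::field" where
  "unit_vec k l = (if k = l then 1 else 0)"

lemma supported_in_span_unit_vecs:
  assumes "finite K" "\<And>k. v k \<noteq> 0 \<Longrightarrow> k \<in> K"
  shows "v \<in> kvec.span (unit_vec ` K)"
proof -
  have "v = (\<Sum>k\<in>K. (\<lambda>l. v k * unit_vec k l))"
  proof
    fix l
    show "v l = (\<Sum>k\<in>K. (\<lambda>l. v k * unit_vec k l)) l"
      using assms by (cases "l \<in> K") (auto simp: sum_fun_apply unit_vec_def if_distrib[of "\<lambda>x. _ * x"] cong: if_cong)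
  qed
  also have "\<dots> \<in> kvec.span (unit_vec ` K)"
    by (intro kvec.span_sum kvec.span_scale kvec.span_base) auto
  finally show ?thesis .
qed

lemma inj_unit_vec: "inj unit_vec"
  by (rule injI) (metis unit_vec_def zero_neq_one)

lemma independent_unit_vecs:
  assumes "finite K"
  shows "kvec.independent (unit_vec ` K :: (nat \<Rightarrow> 'k::field) set)"
proof (rule kvec.independent_if_scalars_zero)
  fix f :: "(nat \<Rightarrow> 'k) \<Rightarrow> 'k" and x :: "nat \<Rightarrow> 'k"
  assume z: "(\<Sum>x\<in>unit_vec ` K. (\<lambda>k. f x * x k)) = 0" and x: "x \<in> unit_vec ` K"
  then obtain k where k: "k \<in> K" "x = unit_vec k" by blast
  have "0 = (\<Sum>x\<in>unit_vec ` K. (\<lambda>k. f x * x k)) k" by (simp only: z zero_fun_apply)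
  also have "\<dots> = (\<Sum>l\<in>K. f (unit_vec l) * unit_vec l k)"
    unfolding sum_fun_apply by (subst sum.reindex) (auto intro: inj_on_subset[OF inj_unit_vec])
  also have "\<dots> = f x"
    using assms k by (simp add: unit_vec_def[of _ k] if_distrib[of "\<lambda>x. _ * x"] cong: if_cong)
  finally show "f x = 0" by simp
qed (use assms in simp)

lemma tensor_part_in_span:
  "tensor_part F i j \<subseteq> kvec.span (unit_vec ` {k. k < frank F i \<and> shift F i k = j})"
  by (auto intro!: supported_in_span_unit_vecs simp: tensor_part_def)

lemma dim_tensor_part:
  fixes F :: "'k::field free_complex"
  shows "kdim (tensor_part F i j) = card {k. k < frank F i \<and> shift F i k = j}"
proof (rule kvec.dim_unique)
  let ?K = "{k. k < frank F i \<and> shift F i k = j}"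
  show "unit_vec ` ?K \<subseteq> tensor_part F i j" by (auto simp: tensor_part_def unit_vec_def split: if_splits)
  show "tensor_part F i j \<subseteq> kvec.span (unit_vec ` ?K)" by (rule tensor_part_in_span)
  show "kvec.independent (unit_vec ` ?K :: (nat \<Rightarrow> 'k) set)" by (rule independent_unit_vecs) simp
  show "card (unit_vec ` ?K :: (nat \<Rightarrow> 'k) set) = card ?K" by (intro card_image inj_on_subset[OF inj_unit_vec]) simp
qed

section \<open>Graded Betti numbers are independent of the resolution\<close>

abbreviation cmat :: "(nat \<Rightarrow> nat \<Rightarrow> 'k::field mpoly) \<Rightarrow> nat \<Rightarrow> nat \<Rightarrow> 'k" where
  "cmat A k l \<equiv> lookup (A k l) 0"

text \<open>The map induced by \<open>A\<close> after tensoring with \<open>K\<close>. Setting it to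
  zero from \<open>s\<close> onwards makes equality of functions equality of vectors.\<close>

definition tmap :: "nat \<Rightarrow> nat \<Rightarrow> (nat \<Rightarrow> nat \<Rightarrow> 'k::field mpoly) \<Rightarrow> (nat \<Rightarrow> 'k) \<Rightarrow> nat \<Rightarrow> 'k" where
  "tmap r s A v l = (if l < s then vm r v (cmat A) l else 0)"

lemma tensor_bdry_tmap: "tensor_bdry F i = tmap (frank F (Suc i)) (frank F i) (bdry F i)"
  by (simp add: tensor_bdry_def tmap_def vm_def fun_eq_iff)

lemma linear_tmap: "Vector_Spaces.linear (\<lambda>c v k. c * v k) (\<lambda>c v k. c * v k) (tmap r s A)"
  by unfold_locales
    (auto simp: tmap_def vm_def fun_eq_iff algebra_simps sum.distrib sum_distrib_left)

text \<open>A homogeneous entry with a constant term has degree 0, so it only connects basis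
  elements of equal degree.\<close>

lemma tmap_tensor_part:
  assumes A: "graded_mat n 0 (frank F i) (shift F i) (frank G i') (shift G i') A" and v: "v \<in> tensor_part F i j"
  shows "tmap (frank F i) (frank G i') A v \<in> tensor_part G i' j"
  unfolding tensor_part_def
proof (intro CollectI allI impI)
  fix l assume nz: "tmap (frank F i) (frank G i') A v l \<noteq> 0"
  then have l: "l < frank G i'" by (auto simp: tmap_def split: if_splits)
  then have "vm (frank F i) v (cmat A) l \<noteq> 0" using nz by (simp add: tmap_def)
  then have "\<exists>k\<in>{..<frank F i}. v k * cmat A k l \<noteq> 0"
    unfolding vm_def by (meson sum.neutral)
  then obtain k where k: "k < frank F i" "v k \<noteq> 0" "cmat A k l \<noteq> 0" by auto
  then have "homogeneous (shift F i k - shift G i' l) (A k l)" using A l by (simp add: graded_mat_def)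
  from homogeneous_const_term[OF this k(3)] have "shift G i' l = shift F i k" by simp
  then show "l < frank G i' \<and> shift G i' l = j" using l v k by (auto simp: tensor_part_def)
qed

lemma tmap_comp:
  assumes "l < s"
  shows "tmap q s B (tmap r q A v) l = vm r v (cmat (\<lambda>k. vm q (A k) B)) l"
proof -
  have "tmap q s B (tmap r q A v) l = vm q (vm r v (cmat A)) (cmat B) l"
    unfolding tmap_def using assms by (auto intro: vm_cong)
  then show ?thesis by (simp add: vm_assoc lookup_0_vm)
qed

lemma tmap_eqI: "(\<And>k l. k < r \<Longrightarrow> l < s \<Longrightarrow> A k l = B k l) \<Longrightarrow> tmap r s A v = tmap r s B v"
  by (auto simp: tmap_def fun_eq_iff intro!: vm_cong)

lemma tmap_tmap: "tmap q s B (tmap r q A v) = tmap r s (\<lambda>k. vm q (A k) B) v"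
proof
  fix l show "tmap q s B (tmap r q A v) l = tmap r s (\<lambda>k. vm q (A k) B) v l"
    by (cases "l < s") (simp add: tmap_comp tmap_def[of r s], simp add: tmap_def)
qed

text \<open>Since \<open>S\<close> occupies position 0, the matrix acting on
  \<open>F\<^sub>i\<close> is \<open>\<Phi> (Suc i)\<close>.\<close>

lemma tmap_chain:
  assumes "chain_map n a F G \<Phi>"
  shows "tensor_bdry G i (tmap (frank F (Suc i)) (frank G (Suc i)) (\<Phi> (Suc (Suc i))) v)
    = tmap (frank F i) (frank G i) (\<Phi> (Suc i)) (tensor_bdry F i v)"
  unfolding tensor_bdry_tmap tmap_tmap
  using chain_map_comm[OF assms, of _ "Suc i"] by (intro tmap_eqI) (simp add: aug_Suc)

lemma chain_map_part:
  assumes "chain_map n 0 F G \<Phi>" "v \<in> tensor_part F i j"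
  shows "tmap (frank F i) (frank G i) (\<Phi> (Suc i)) v \<in> tensor_part G i j"
  using chain_map_graded[OF assms(1), of "Suc i"] assms(2)
  by (intro tmap_tensor_part) (auto simp: graded_mat_def aug_Suc)

lemma tensor_cycles_iff:
  "v \<in> tensor_cycles F i j \<longleftrightarrow> v \<in> tensor_part F i j \<and> (\<forall>i'. i = Suc i' \<longrightarrow> tensor_bdry F i' v = (\<lambda>_. 0))"
  by (cases i) (auto simp: tensor_cycles_def)

lemma tmap_0: "tmap r s A (\<lambda>_. 0) = (\<lambda>_. 0)"
  by (simp add: tmap_def vm_def fun_eq_iff)

lemma chain_map_cycles:
  assumes "chain_map n 0 F G \<Phi>" "v \<in> tensor_cycles F i j"
  shows "tmap (frank F i) (frank G i) (\<Phi> (Suc i)) v \<in> tensor_cycles G i j"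
  using assms(2) unfolding tensor_cycles_iff
  by (auto simp: chain_map_part[OF assms(1)] tmap_chain[OF assms(1)] tmap_0)

lemma chain_map_boundaries:
  assumes "chain_map n 0 F G \<Phi>" "v \<in> tensor_boundaries F i j"
  shows "tmap (frank F i) (frank G i) (\<Phi> (Suc i)) v \<in> tensor_boundaries G i j"
  using assms(2) unfolding tensor_boundaries_def
  by (auto simp: tmap_chain[OF assms(1), symmetric] intro!: imageI chain_map_part[OF assms(1)])

lemma chain_map_comp:
  assumes \<Phi>: "chain_map n a F G \<Phi>" and \<Psi>: "chain_map n b G H \<Psi>"
  shows "chain_map n (a + b) F H (\<lambda>i k. vm (arank G i) (\<Phi> i k) (\<Psi> i))"
  unfolding chain_map_def
proof (intro conjI allI impI)
  show "graded_mat n (a + b) (arank F i) (ashift F i) (arank H i) (ashift H i) (\<lambda>k. vm (arank G i) (\<Phi> i k) (\<Psi> i))" for i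
    using chain_map_graded[OF \<Phi>] chain_map_graded[OF \<Psi>] by (rule graded_mat_mult)
  fix i k l assume k: "k < arank F (Suc i)" and l: "l < arank H i"
  have "vm (arank F i) (abdry F i k) (\<lambda>k. vm (arank G i) (\<Phi> i k) (\<Psi> i)) l
      = vm (arank G i) (vm (arank F i) (abdry F i k) (\<Phi> i)) (\<Psi> i) l"
    by (simp add: vm_assoc)
  also have "\<dots> = vm (arank G i) (vm (arank G (Suc i)) (\<Phi> (Suc i) k) (abdry G i)) (\<Psi> i) l"
    using chain_map_comm[OF \<Phi> k] by (intro vm_cong) auto
  also have "\<dots> = vm (arank G (Suc i)) (\<Phi> (Suc i) k) (\<lambda>q. vm (arank H (Suc i)) (\<Psi> (Suc i) q) (abdry H i)) l"
    unfolding vm_assoc using chain_map_comm[OF \<Psi> _ l] by (intro vm_cong) auto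
  finally show "vm (arank F i) (abdry F i k) (\<lambda>k. vm (arank G i) (\<Phi> i k) (\<Psi> i)) l
      = vm (arank H (Suc i)) (vm (arank G (Suc i)) (\<Phi> (Suc i) k) (\<Psi> (Suc i))) (abdry H i) l"
    by (simp add: vm_assoc)
qed

lemma chain_map_diff_id:
  assumes \<Phi>: "chain_map n 0 F F \<Phi>"
  shows "chain_map n 0 F F (\<lambda>i k l. \<Phi> i k l - (if k = l then 1 else 0))"
  unfolding chain_map_def
proof (intro conjI allI impI)
  show "graded_mat n 0 (arank F i) (ashift F i) (arank F i) (ashift F i) (\<lambda>k l. \<Phi> i k l - (if k = l then 1 else 0))" for i
    by (rule graded_mat_diff[OF chain_map_graded[OF \<Phi>]]) (simp add: graded_mat_def)
  fix i k l assume k: "k < arank F (Suc i)" and l: "l < arank F i"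
  show "vm (arank F i) (abdry F i k) (\<lambda>k l. \<Phi> i k l - (if k = l then 1 else 0)) l
      = vm (arank F (Suc i)) (\<lambda>l. \<Phi> (Suc i) k l - (if k = l then 1 else 0)) (abdry F i) l"
    using chain_map_comm[OF \<Phi> k l] k l by (simp add: vm_diff_right vm_diff_left vm_id vm_unit)
qed

text \<open>The difference to the identity has the form boundary after homotopy plus homotopy after
  boundary. On a cycle the second term dies after tensoring, and the first one is a
  boundary.\<close>

lemma homotopic_id_boundaries:
  assumes F: "exact_aug n I F" and \<Phi>: "chain_map n 0 F F \<Phi>" and \<Phi>0: "\<Phi> 0 0 0 = 1"
    and v: "v \<in> tensor_cycles F i j"
  shows "tmap (frank F i) (frank F i) (\<Phi> (Suc i)) v - v \<in> tensor_boundaries F i j"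
proof -
  let ?\<phi> = "\<lambda>i k l. \<Phi> i k l - (if k = l then 1 else 0)"
  have vp: "v \<in> tensor_part F i j" using v by (simp add: tensor_cycles_iff)
  obtain H where Hg: "\<And>i. graded_mat n 0 (arank F i) (ashift F i) (arank F (Suc i)) (ashift F (Suc i)) (H i)"
    and H0: "\<And>l. H 0 0 l = 0"
    and H: "\<And>i k l. k < arank F (Suc i) \<Longrightarrow> l < arank F (Suc i) \<Longrightarrow>
       ?\<phi> (Suc i) k l = vm (arank F (Suc (Suc i))) (H (Suc i) k) (abdry F (Suc i)) l
         + vm (arank F i) (abdry F i k) (H i) l"
  proof -
    have "?\<phi> 0 0 0 = 0" using \<Phi>0 by simp
    from null_homotopy[OF F chain_map_diff_id[OF \<Phi>] this] show thesis using that by blast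
  qed
  let ?w = "tmap (frank F i) (frank F (Suc i)) (H (Suc i)) v"
  have "?w \<in> tensor_part F (Suc i) j"
    using Hg[of "Suc i"] vp by (intro tmap_tensor_part) (auto simp: graded_mat_def aug_Suc)
  moreover have "tmap (frank F i) (frank F i) (\<Phi> (Suc i)) v - v = tensor_bdry F i ?w"
  proof
    fix l
    show "(tmap (frank F i) (frank F i) (\<Phi> (Suc i)) v - v) l = tensor_bdry F i ?w l"
    proof (cases "l < frank F i")
      case False
      then show ?thesis using vp by (auto simp: tmap_def tensor_bdry_tmap tensor_part_def)
    next
      case l: True
      \<comment> \<open>For \<open>i = 0\<close> no cycle condition is available; there the term
        vanishes because the homotopy is zero on \<open>S\<close>.\<close>
      have z: "vm (frank F i) v (cmat (\<lambda>k. vm (arank F i) (abdry F i k) (H i))) l = 0"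
      proof (cases i)
        case 0
        then show ?thesis using H0 by (simp add: vm_Suc_0 vm_zero_right)
      next
        case (Suc i')
        have "tmap (frank F i') (frank F i) (H i) (tensor_bdry F i' v) l = 0"
          using v Suc by (simp add: tensor_cycles_iff tmap_0)
        then show ?thesis using l Suc by (simp add: tensor_bdry_tmap tmap_comp aug_Suc)
      qed
      have "(tmap (frank F i) (frank F i) (\<Phi> (Suc i)) v - v) l = vm (frank F i) v (cmat (?\<phi> (Suc i))) l"
      proof -
        have "cmat (?\<phi> (Suc i)) = (\<lambda>k l. cmat (\<Phi> (Suc i)) k l - (if k = l then 1 else 0))"
          by (auto simp: fun_eq_iff lookup_minus)
        then show ?thesis using l by (simp add: tmap_def vm_diff_right vm_id)
      qed
      also have "\<dots> = vm (frank F i) v (cmat (\<lambda>k l. vm (arank F (Suc (Suc i))) (H (Suc i) k) (abdry F (Suc i)) l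
         + vm (arank F i) (abdry F i k) (H i) l)) l"
        using H[of _ i l] l by (intro vm_cong) (auto simp: aug_Suc)
      also have "\<dots> = vm (frank F i) v (cmat (\<lambda>k. vm (arank F (Suc (Suc i))) (H (Suc i) k) (abdry F (Suc i)))) l
          + vm (frank F i) v (cmat (\<lambda>k. vm (arank F i) (abdry F i k) (H i))) l"
        by (simp add: vm_def[of "frank F i"] lookup_add distrib_left sum.distrib)
      also have "\<dots> = tensor_bdry F i ?w l"
        using l z by (simp add: tensor_bdry_tmap tmap_comp aug_Suc)
      finally show ?thesis .
    qed
  qed
  ultimately show ?thesis by (auto simp: tensor_boundaries_def)
qed

lemma subspace_tensor_part: "kvec.subspace (tensor_part F i j)"
  unfolding kvec.subspace_def tensor_part_def by (auto, (metis add.right_neutral)+)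

lemma subspace_tensor_cycles: "kvec.subspace (tensor_cycles F i j)"
proof -
  interpret T: Vector_Spaces.linear "\<lambda>c v k. c * v k" "\<lambda>c v k. c * v k" "tensor_bdry F i'" for i'
    unfolding tensor_bdry_tmap by (rule linear_tmap)
  have "kvec.subspace {v. tensor_bdry F i' v = 0}" for i' by (rule T.subspace_kernel)
  then have "kvec.subspace (tensor_part F (Suc i') j \<inter> {v. tensor_bdry F i' v = 0})" for i'
    using subspace_tensor_part kvec.subspace_inter by blast
  then show ?thesis
    using subspace_tensor_part
    by (cases i) (auto simp: tensor_cycles_def zero_fun_def Collect_conj_eq[symmetric] Int_def)
qed

lemma subspace_tensor_boundaries: "kvec.subspace (tensor_boundaries F i j)"
proof -
  interpret T: Vector_Spaces.linear "\<lambda>c v k. c * v k" "\<lambda>c v k. c * v k" "tensor_bdry F i"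
    unfolding tensor_bdry_tmap by (rule linear_tmap)
  show ?thesis unfolding tensor_boundaries_def
    using subspace_tensor_part by (rule T.subspace_image)
qed

lemma tensor_boundaries_subset:
  assumes F: "exact_aug n I F"
  shows "tensor_boundaries F i j \<subseteq> tensor_cycles F i j"
proof
  fix v assume "v \<in> tensor_boundaries F i j"
  then obtain w where w: "w \<in> tensor_part F (Suc i) j" "v = tensor_bdry F i w"
    by (auto simp: tensor_boundaries_def)
  have "v \<in> tensor_part F i j"
    unfolding w(2) tensor_bdry_tmap using graded_mat_abdry[OF F, of "Suc i"] w(1)
    by (intro tmap_tensor_part) (auto simp: graded_mat_def aug_Suc)
  moreover have "tensor_bdry F i' v = (\<lambda>_. 0)" if "i = Suc i'" for i'
  proof -
    have "tensor_bdry F i' v = tmap (frank F (Suc i)) (frank F i') (\<lambda>k. vm (frank F i) (bdry F i k) (bdry F i')) w"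
      by (simp add: w(2) tensor_bdry_tmap tmap_tmap that)
    also have "\<dots> = tmap (frank F (Suc i)) (frank F i') (\<lambda>k l. 0) w"
      using exact_aug_complex[OF F, of _ "Suc i'"] that by (intro tmap_eqI) (simp add: aug_Suc)
    finally show ?thesis by (simp add: tmap_def vm_def fun_eq_iff)
  qed
  ultimately show "v \<in> tensor_cycles F i j" by (simp add: tensor_cycles_iff)
qed

text \<open>The composite of the lifts in both directions is homotopic to the identity, so the first
  lift is injective on homology. An inequality suffices, since the roles of \<open>F\<close> and
  \<open>G\<close> can be exchanged.\<close>

theorem tensor_homology_dim_le:
  assumes F: "exact_aug n I F" and G: "exact_aug n I G"
  shows "tensor_homology_dim F i j \<le> tensor_homology_dim G i j"
proof -
  obtain \<Phi> where \<Phi>: "chain_map n 0 F G \<Phi>" "\<Phi> 0 0 0 = 1"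
    using comparison[OF F G, of 1 0] by auto
  obtain \<Psi> where \<Psi>: "chain_map n 0 G F \<Psi>" "\<Psi> 0 0 0 = 1"
    using comparison[OF G F, of 1 0] by auto
  let ?f = "tmap (frank F i) (frank G i) (\<Phi> (Suc i))"
  let ?g = "tmap (frank G i) (frank F i) (\<Psi> (Suc i))"
  let ?\<Theta> = "\<lambda>i k. vm (arank G i) (\<Phi> i k) (\<Psi> i)"
  have \<Theta>: "chain_map n 0 F F ?\<Theta>" using chain_map_comp[OF \<Phi>(1) \<Psi>(1)] by simp
  have \<Theta>0: "?\<Theta> 0 0 0 = 1" using \<Phi>(2) \<Psi>(2) by (simp add: vm_Suc_0)
  show ?thesis
    unfolding tensor_homology_dim_def
  proof (rule kvec.dim_quotient_le[where f = ?f])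
    show "Vector_Spaces.linear (\<lambda>c v k. c * v k) (\<lambda>c v k. c * v k) ?f" by (rule linear_tmap)
    show "tensor_cycles F i j \<subseteq> kvec.span (unit_vec ` {k. k < frank F i \<and> shift F i k = j})"
      by (rule subset_trans[OF _ tensor_part_in_span]) (auto simp: tensor_cycles_iff)
    show "tensor_cycles G i j \<subseteq> kvec.span (unit_vec ` {k. k < frank G i \<and> shift G i k = j})"
      by (rule subset_trans[OF _ tensor_part_in_span]) (auto simp: tensor_cycles_iff)
    show "?f v \<in> tensor_cycles G i j" if "v \<in> tensor_cycles F i j" for v
      using chain_map_cycles[OF \<Phi>(1) that] .
    show "v \<in> tensor_boundaries F i j" if v: "v \<in> tensor_cycles F i j" "?f v \<in> tensor_boundaries G i j" for v
    proof -
      have "?g (?f v) \<in> tensor_boundaries F i j" using chain_map_boundaries[OF \<Psi>(1) v(2)] .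
      moreover have "?g (?f v) - v \<in> tensor_boundaries F i j"
        using homotopic_id_boundaries[OF F \<Theta> \<Theta>0 v(1)] by (simp add: tmap_tmap aug_Suc)
      ultimately have "?g (?f v) - (?g (?f v) - v) \<in> tensor_boundaries F i j"
        by (rule kvec.subspace_diff[OF subspace_tensor_boundaries])
      then show ?thesis by simp
    qed
  qed (use F G in \<open>auto intro: subspace_tensor_cycles subspace_tensor_boundaries
      tensor_boundaries_subset[THEN subsetD]\<close>)
qed

text \<open>The augmentation is exempt: it is not a differential of \<open>K \<otimes> F\<close>,
  and for the unit ideal it has a constant entry.\<close>

definition minimal :: "'k::field free_complex \<Rightarrow> bool" where
  "minimal F \<longleftrightarrow> (\<forall>i. \<forall>k<frank F (Suc i). \<forall>l<frank F i. lookup (bdry F i k l) 0 = 0)"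

lemma tensor_homology_dim_minimal:
  fixes F :: "'k::field free_complex"
  assumes "minimal F"
  shows "tensor_homology_dim F i j = card {k. k < frank F i \<and> shift F i k = j}"
proof -
  have z: "tensor_bdry F i v = (\<lambda>_. 0)" for i v
    using assms by (simp add: tensor_bdry_def minimal_def fun_eq_iff)
  have "tensor_cycles F i j = tensor_part F i j" by (auto simp: tensor_cycles_iff z)
  moreover have "(\<lambda>_. 0) \<in> tensor_part F (Suc i) j" by (simp add: tensor_part_def)
  then have "tensor_boundaries F i j = {0}" by (auto simp: tensor_boundaries_def z zero_fun_def)
  moreover have "kdim {0 :: nat \<Rightarrow> 'k} = 0" by (rule kvec.dim_unique[of "{}"]) (auto dest: kvec.independent_empty[THEN notE])
  ultimately show ?thesis by (simp add: tensor_homology_dim_def dim_tensor_part)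
qed

text \<open>Nothing is known about the resolution that \<open>SOME\<close> selects except that it is
  one, so it is compared with \<open>F\<close> in both directions.\<close>

theorem betti_eq:
  assumes F: "exact_aug n I F" and min: "minimal F"
  shows "betti n I i j = card {k. k < frank F i \<and> shift F i k = j}"
proof -
  have "graded_free_resolution n I F" using F by (simp only: graded_free_resolution_iff)
  then have "graded_free_resolution n I (SOME F. graded_free_resolution n I F)" by (rule someI)
  then have "exact_aug n I (SOME F. graded_free_resolution n I F)"
    by (simp add: graded_free_resolution_iff)
  then show ?thesis
    unfolding betti_def tensor_homology_dim_minimal[OF min, symmetric]
    using F by (intro antisym tensor_homology_dim_le)
qed

section \<open>Mapping cones\<close>

text \<open>\<open>G\<close> resolves \<open>I\<close>, and \<open>C\<close> resolves the colon
  ideal \<open>I : u\<close>. The complex \<open>C\<close> enters together with its position 0,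
  whose single basis element becomes the new generator \<open>u\<close> of degree \<open>a\<close>.
  The sign on the boundary of \<open>C\<close> makes consecutive maps compose to zero.\<close>

definition cone ::
    "'k::field free_complex \<Rightarrow> 'k free_complex \<Rightarrow> int \<Rightarrow> (nat \<Rightarrow> nat \<Rightarrow> nat \<Rightarrow> 'k mpoly) \<Rightarrow> 'k free_complex" where
  "cone G C a \<Phi> = \<lparr>
     frank = \<lambda>i. frank G i + arank C i,
     shift = \<lambda>i k. if k < frank G i then shift G i k else a + ashift C i (k - frank G i),
     bdry = \<lambda>i k l. if k < frank G (Suc i) then (if l < frank G i then bdry G i k l else 0)
       else if l < frank G i then \<Phi> (Suc i) (k - frank G (Suc i)) l
       else - abdry C i (k - frank G (Suc i)) (l - frank G i),
     aug = \<lambda>k. if k < frank G 0 then aug G k else \<Phi> 0 (k - frank G 0) 0 \<rparr>"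

lemma arank_cone: "arank (cone G C a \<Phi>) (Suc i) = arank G (Suc i) + arank C i"
  by (simp add: cone_def aug_Suc)

lemma abdry_cone_G: "k < arank G (Suc i) \<Longrightarrow> l < arank G i \<Longrightarrow> abdry (cone G C a \<Phi>) i k l = abdry G i k l"
  by (cases i) (simp_all add: cone_def aug_Suc)

lemma abdry_cone_CG: "l < arank G i \<Longrightarrow> abdry (cone G C a \<Phi>) i (arank G (Suc i) + k) l = \<Phi> i k l"
  by (cases i) (simp_all add: cone_def aug_Suc)

lemma abdry_cone_GC: "k < arank G (Suc (Suc i)) \<Longrightarrow> abdry (cone G C a \<Phi>) (Suc i) k (arank G (Suc i) + l) = 0"
  by (simp add: cone_def aug_Suc)

lemma abdry_cone_C:
  "abdry (cone G C a \<Phi>) (Suc i) (arank G (Suc (Suc i)) + k) (arank G (Suc i) + l) = - abdry C i k l"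
  by (simp add: cone_def aug_Suc)

lemma ashift_cone_G: "k < arank G i \<Longrightarrow> ashift (cone G C a \<Phi>) i k = ashift G i k"
  by (cases i) (simp_all add: cone_def aug_Suc)

lemma ashift_cone_C: "ashift (cone G C a \<Phi>) (Suc i) (arank G (Suc i) + k) = a + ashift C i k"
  by (simp add: cone_def aug_Suc)

lemma vm_cone_G:
  assumes "l < arank G i"
  shows "vm (arank (cone G C a \<Phi>) (Suc i)) v (abdry (cone G C a \<Phi>) i) l
    = vm (arank G (Suc i)) v (abdry G i) l + vm (arank C i) (\<lambda>k. v (arank G (Suc i) + k)) (\<Phi> i) l"
  unfolding arank_cone vm_append using assms
  by (intro arg_cong2[of _ _ _ _ "(+)"] vm_cong) (auto simp: abdry_cone_G abdry_cone_CG)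

lemma vm_cone_C:
  "vm (arank (cone G C a \<Phi>) (Suc (Suc i))) v (abdry (cone G C a \<Phi>) (Suc i)) (arank G (Suc i) + l)
    = - vm (arank C (Suc i)) (\<lambda>k. v (arank G (Suc (Suc i)) + k)) (abdry C i) l"
  unfolding arank_cone[of _ _ _ _ "Suc i"] vm_append
  by (simp add: vm_zero_right abdry_cone_GC) (simp add: vm_def abdry_cone_C sum_negf)

lemma less_add_cases:
  fixes l :: nat
  assumes "l < r + s"
  obtains "l < r" | l' where "l = r + l'" "l' < s"
  using assms by (metis add_diff_inverse_nat nat_add_left_cancel_less)

lemma cone_entries:
  assumes G: "exact_aug n I G" and C: "exact_aug n Q C" and \<Phi>: "chain_map n a C G \<Phi>"
    and k: "k < arank (cone G C a \<Phi>) (Suc i)" and l: "l < arank (cone G C a \<Phi>) i"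
  shows "abdry (cone G C a \<Phi>) i k l \<in> S n \<and>
    homogeneous (ashift (cone G C a \<Phi>) (Suc i) k - ashift (cone G C a \<Phi>) i l) (abdry (cone G C a \<Phi>) i k l)"
proof -
  have \<Phi>e: "\<Phi> i k l \<in> S n \<and> homogeneous (a + ashift C i k - ashift G i l) (\<Phi> i k l)"
    if "k < arank C i" "l < arank G i" for i k l
    using chain_map_graded[OF \<Phi>] that by (simp add: graded_mat_def)
  have l': "l < arank G i \<or> (\<exists>i' l'. i = Suc i' \<and> l = arank G (Suc i') + l' \<and> l' < arank C i')"
  proof (cases i)
    case 0
    then show ?thesis using l by simp
  next
    case (Suc i')
    then show ?thesis using l unfolding Suc arank_cone by (elim less_add_cases) auto
  qed
  from k show ?thesis unfolding arank_cone
  proof (cases rule: less_add_cases)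
    case 1
    show ?thesis using l'
    proof (elim disjE exE conjE)
      assume l: "l < arank G i"
      show ?thesis using exact_aug_S[OF G 1 l] exact_aug_homogeneous[OF G 1 l]
        by (simp add: abdry_cone_G[OF 1 l] ashift_cone_G[OF 1] ashift_cone_G[OF l])
    next
      fix i' l' assume "i = Suc i'" "l = arank G (Suc i') + l'"
      then show ?thesis using 1 by (simp add: abdry_cone_GC)
    qed
  next
    case (2 k')
    show ?thesis using l'
    proof (elim disjE exE conjE)
      assume l: "l < arank G i"
      show ?thesis using \<Phi>e[OF 2(2) l]
        by (simp add: 2(1) abdry_cone_CG[OF l] ashift_cone_G[OF l] ashift_cone_C)
    next
      fix i' l' assume i': "i = Suc i'" "l = arank G (Suc i') + l'" "l' < arank C i'"
      then have "abdry C i' k' l' \<in> S n" "homogeneous (ashift C i k' - ashift C i' l') (abdry C i' k' l')"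
        using exact_aug_S[OF C, of k' i' l'] exact_aug_homogeneous[OF C, of k' i' l'] 2 by auto
      then show ?thesis
        using 2(1) i' by (auto simp: abdry_cone_C ashift_cone_C)
    qed
  qed
qed

text \<open>A direct diagram chase: given a cycle of the cone, lift its component in
  \<open>C\<close>, correct the component in \<open>G\<close> by the image of this lift, and lift
  the corrected vector in \<open>G\<close>.\<close>

theorem exact_aug_cone:
  fixes G C :: "'k::field free_complex"
  assumes G: "exact_aug n I G" and C: "exact_aug n Q C" and u: "u \<in> S n"
    and Q: "\<And>p. p \<in> Q \<longleftrightarrow> p \<in> S n \<and> p * u \<in> I" and \<Phi>: "chain_map n a C G \<Phi>" and \<Phi>0: "\<Phi> 0 0 0 = u"
  shows "exact_aug n {p + q * u | p q. p \<in> I \<and> q \<in> S n} (cone G C a \<Phi>)"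
proof -
  let ?E = "cone G C a \<Phi>"
  have \<Phi>S: "\<Phi> i k l \<in> S n" if "k < arank C i" "l < arank G i" for i k l
    using chain_map_graded[OF \<Phi>] that by (simp add: graded_mat_def)
  have comm: "vm (arank G i) (vm (arank C i) c (\<Phi> i)) B l = vm (arank C i) c (\<lambda>q. vm (arank G i) (\<Phi> i q) B) l" for i c B l
    by (rule vm_assoc)
  have ideal: "p \<in> {p + q * u | p q. p \<in> I \<and> q \<in> S n} \<longleftrightarrow>
      (\<exists>w. (\<forall>k<arank ?E 1. w k \<in> S n) \<and> p = vm (arank ?E 1) w (abdry ?E 0) 0)" (is "_ \<longleftrightarrow> ?R") for p
  proof -
    have E: "vm (arank ?E 1) w (abdry ?E 0) 0 = vm (arank G 1) w (abdry G 0) 0 + w (arank G 1) * u" for w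
      using vm_cone_G[of 0 G 0 C a \<Phi> w] \<Phi>0 by (simp add: vm_Suc_0)
    show ?thesis
    proof
      assume "p \<in> {p + q * u | p q. p \<in> I \<and> q \<in> S n}"
      then obtain p' q where pq: "p = p' + q * u" "p' \<in> I" "q \<in> S n" by blast
      obtain w where w: "\<forall>k<arank G 1. w k \<in> S n" "p' = vm (arank G 1) w (abdry G 0) 0"
        using pq(2) exact_aug_ideal[OF G] by blast
      let ?w = "\<lambda>k. if k < arank G 1 then w k else q"
      have "vm (arank G 1) ?w (abdry G 0) 0 = p'" unfolding w(2) by (rule vm_cong) auto
      then have "p = vm (arank ?E 1) ?w (abdry ?E 0) 0" unfolding E pq by simp
      moreover have "\<forall>k<arank ?E 1. ?w k \<in> S n" using w pq by simp
      ultimately show ?R by (intro exI[of _ ?w] conjI)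
    next
      assume ?R
      then obtain w where w: "\<And>k. k < arank ?E 1 \<Longrightarrow> w k \<in> S n" "p = vm (arank ?E 1) w (abdry ?E 0) 0" by blast
      have r: "arank ?E 1 = arank G 1 + 1" using arank_cone[of G C a \<Phi> 0] by simp
      have "\<forall>k<arank G 1. w k \<in> S n" using w(1) r by simp
      then have "vm (arank G 1) w (abdry G 0) 0 \<in> I" using exact_aug_ideal[OF G] by blast
      moreover have "w (arank G 1) \<in> S n" using w(1) r by simp
      ultimately show "p \<in> {p + q * u | p q. p \<in> I \<and> q \<in> S n}" unfolding w(2) E by blast
    qed
  qed
  have exact: "(\<forall>l<arank ?E i. vm (arank ?E (Suc i)) v (abdry ?E i) l = 0) \<longleftrightarrow>
         (\<exists>w. (\<forall>k<arank ?E (Suc (Suc i)). w k \<in> S n) \<and>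
            (\<forall>l<arank ?E (Suc i). v l = vm (arank ?E (Suc (Suc i))) w (abdry ?E (Suc i)) l))" (is "?K \<longleftrightarrow> ?M")
    if v: "\<forall>k<arank ?E (Suc i). v k \<in> S n" for i v
  proof
    assume K: ?K
    define c where "c k = v (arank G (Suc i) + k)" for k
    have cS: "c k \<in> S n" if "k < arank C i" for k using v that by (simp add: c_def arank_cone)
    have gS: "v k \<in> S n" if "k < arank G (Suc i)" for k using v that by (simp add: arank_cone)
    have K1: "vm (arank G (Suc i)) v (abdry G i) l + vm (arank C i) c (\<Phi> i) l = 0" if "l < arank G i" for l
    proof -
      have "l < arank ?E i" using that by (cases i) (auto simp: arank_cone)
      then show ?thesis using K vm_cone_G[OF that, of C a \<Phi> v] by (simp add: c_def[abs_def])
    qed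
    \<comment> \<open>For \<open>i = 0\<close> this is the colon condition: the cycle equation puts
      \<open>c 0 * u\<close> into \<open>I\<close>, so \<open>c 0\<close> lies in
      \<open>Q\<close>.\<close>
    have "\<exists>c'. (\<forall>k<arank C (Suc i). c' k \<in> S n) \<and> (\<forall>k<arank C i. c k = vm (arank C (Suc i)) c' (abdry C i) k)"
    proof (cases i)
      case 0
      have "c 0 * u = vm (arank G 1) (\<lambda>k. - v k) (abdry G 0) 0"
        using K1[of 0] 0 \<Phi>0 by (simp add: vm_uminus_left vm_Suc_0 eq_neg_iff_add_eq_0 add.commute)
      moreover have "\<forall>k<arank G 1. - v k \<in> S n" using gS 0 by auto
      ultimately have "\<exists>w. (\<forall>k<arank G 1. w k \<in> S n) \<and> c 0 * u = vm (arank G 1) w (abdry G 0) 0"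
        by (intro exI[of _ "\<lambda>k. - v k"] conjI)
      then have "c 0 * u \<in> I" by (rule exact_aug_ideal[OF G, THEN iffD2])
      then have "c 0 \<in> Q" using Q cS 0 by simp
      then obtain w where "\<forall>k<arank C 1. w k \<in> S n" "c 0 = vm (arank C 1) w (abdry C 0) 0"
        using exact_aug_ideal[OF C] by blast
      then show ?thesis using 0 by (intro exI[of _ w]) simp
    next
      case (Suc i')
      have "vm (arank C (Suc i')) c (abdry C i') l = 0" if "l < arank C i'" for l
      proof -
        have "arank G (Suc i') + l < arank ?E i" using Suc that by (simp add: arank_cone)
        then have "vm (arank ?E (Suc i)) v (abdry ?E i) (arank G (Suc i') + l) = 0" using K by blast
        then show ?thesis unfolding Suc vm_cone_C by (simp add: c_def[abs_def] Suc)
      qed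
      then show ?thesis using exact_aug_exact[OF C, of i' c] cS Suc by blast
    qed
    then obtain c' where c': "\<And>k. k < arank C (Suc i) \<Longrightarrow> c' k \<in> S n"
      "\<And>k. k < arank C i \<Longrightarrow> c k = vm (arank C (Suc i)) c' (abdry C i) k" by blast
    \<comment> \<open>By \<open>K1\<close> the boundary of \<open>v\<close> in \<open>G\<close> is
      minus the image of \<open>c\<close>. The image of \<open>c'\<close> has the image of
      \<open>c\<close> as its boundary, so the sum is a cycle.\<close>
    define g where "g l = v l + vm (arank C (Suc i)) c' (\<Phi> (Suc i)) l" for l
    have "g l \<in> S n" if "l < arank G (Suc i)" for l
      unfolding g_def using that gS c'(1) \<Phi>S by (intro S_add vm_S) auto
    moreover have "vm (arank G (Suc i)) g (abdry G i) l = 0" if l: "l < arank G i" for l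
    proof -
      have "vm (arank G (Suc i)) (vm (arank C (Suc i)) c' (\<Phi> (Suc i))) (abdry G i) l
          = vm (arank C (Suc i)) c' (\<lambda>k. vm (arank C i) (abdry C i k) (\<Phi> i)) l"
        unfolding vm_assoc using chain_map_comm[OF \<Phi> _ l] by (intro vm_cong) auto
      also have "\<dots> = vm (arank C i) c (\<Phi> i) l"
        unfolding vm_assoc[symmetric] using c'(2) by (intro vm_cong) auto
      finally show ?thesis using K1[OF l] by (simp add: g_def[abs_def] vm_add_left)
    qed
    ultimately obtain g' where g': "\<forall>k<arank G (Suc (Suc i)). g' k \<in> S n"
      "\<And>l. l < arank G (Suc i) \<Longrightarrow> g l = vm (arank G (Suc (Suc i))) g' (abdry G (Suc i)) l"
      using exact_aug_exact[OF G, of i g] by blast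
    \<comment> \<open>The sign of \<open>c'\<close> undoes the sign of the boundary of
      \<open>C\<close> in the cone, and in \<open>G\<close> it subtracts the correction
      again.\<close>
    define w where "w k = (if k < arank G (Suc (Suc i)) then g' k else - c' (k - arank G (Suc (Suc i))))" for k
    have w1: "vm (arank G (Suc (Suc i))) w A l = vm (arank G (Suc (Suc i))) g' A l" for A l
      by (rule vm_cong) (simp_all add: w_def)
    have w2: "(\<lambda>k. w (arank G (Suc (Suc i)) + k)) = (\<lambda>k. - c' k)" by (simp add: w_def)
    have "w k \<in> S n" if "k < arank ?E (Suc (Suc i))" for k
      using that g'(1) c'(1) by (auto simp: w_def arank_cone[of _ _ _ _ "Suc i"])
    moreover have "v l = vm (arank ?E (Suc (Suc i))) w (abdry ?E (Suc i)) l" if "l < arank ?E (Suc i)" for l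
      using that unfolding arank_cone[of _ _ _ _ i]
    proof (cases rule: less_add_cases)
      case 1
      then show ?thesis
        unfolding vm_cone_G[OF 1] w1 w2 vm_uminus_left using g'(2)[OF 1] by (simp add: g_def algebra_simps)
    next
      case (2 l')
      then show ?thesis
        unfolding 2(1) vm_cone_C w2 vm_uminus_left using c'(2)[OF 2(2)] by (simp add: c_def)
    qed
    ultimately show ?M by blast
  next
    assume ?M
    then obtain w where w: "\<And>k. k < arank ?E (Suc (Suc i)) \<Longrightarrow> w k \<in> S n"
      "\<And>l. l < arank ?E (Suc i) \<Longrightarrow> v l = vm (arank ?E (Suc (Suc i))) w (abdry ?E (Suc i)) l" by blast
    define c where "c k = w (arank G (Suc (Suc i)) + k)" for k
    have v1: "v l = vm (arank G (Suc (Suc i))) w (abdry G (Suc i)) l + vm (arank C (Suc i)) c (\<Phi> (Suc i)) l"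
      if "l < arank G (Suc i)" for l
      using w(2)[of l] that vm_cone_G[OF that, of C a \<Phi> w] by (simp add: arank_cone[of _ _ _ _ i] c_def[abs_def])
    have v2: "v (arank G (Suc i) + l) = - vm (arank C (Suc i)) c (abdry C i) l" if "l < arank C i" for l
      using w(2)[of "arank G (Suc i) + l"] that vm_cone_C[of G C a \<Phi> i w l]
      by (simp add: arank_cone[of _ _ _ _ i] c_def[abs_def])
    show ?K
    proof (intro allI impI)
      fix l assume "l < arank ?E i"
      then have "l < arank G i \<or> (\<exists>i' l'. i = Suc i' \<and> l = arank G (Suc i') + l' \<and> l' < arank C i')"
        by (cases i) (auto simp: arank_cone elim: less_add_cases)
      then show "vm (arank ?E (Suc i)) v (abdry ?E i) l = 0"
      proof (elim disjE exE conjE)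
        assume l: "l < arank G i"
        have "vm (arank G (Suc i)) v (abdry G i) l
            = vm (arank G (Suc i)) (\<lambda>l. vm (arank G (Suc (Suc i))) w (abdry G (Suc i)) l + vm (arank C (Suc i)) c (\<Phi> (Suc i)) l) (abdry G i) l"
          using v1 by (intro vm_cong) auto
        also have "\<dots> = vm (arank C (Suc i)) c (\<lambda>k. vm (arank G (Suc i)) (\<Phi> (Suc i) k) (abdry G i)) l"
          unfolding vm_add_left vm_assoc using exact_aug_complex[OF G _ l] by (simp add: vm_zero_right)
        also have "\<dots> = vm (arank C (Suc i)) c (\<lambda>k. vm (arank C i) (abdry C i k) (\<Phi> i)) l"
          using chain_map_comm[OF \<Phi> _ l] by (intro vm_cong) auto
        finally have *: "vm (arank G (Suc i)) v (abdry G i) l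
            = vm (arank C i) (vm (arank C (Suc i)) c (abdry C i)) (\<Phi> i) l" by (simp add: vm_assoc)
        have "vm (arank C i) (\<lambda>k. v (arank G (Suc i) + k)) (\<Phi> i) l
            = vm (arank C i) (\<lambda>k. - vm (arank C (Suc i)) c (abdry C i) k) (\<Phi> i) l"
          using v2 by (intro vm_cong) auto
        then show ?thesis unfolding vm_cone_G[OF l] * by (simp add: vm_uminus_left)
      next
        fix i' l' assume i': "i = Suc i'" "l = arank G (Suc i') + l'" "l' < arank C i'"
        have "vm (arank C i) (\<lambda>k. v (arank G (Suc i) + k)) (abdry C i') l'
            = vm (arank C i) (\<lambda>k. - vm (arank C (Suc i)) c (abdry C i) k) (abdry C i') l'"
          using v2 by (intro vm_cong) auto
        also have "\<dots> = 0"
          unfolding vm_uminus_left vm_assoc using exact_aug_complex[OF C _ i'(3)] i'(1) by (simp add: vm_zero_right)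
        finally show ?thesis unfolding i'(1,2) vm_cone_C using i'(1) by simp
      qed
    qed
  qed
  show ?thesis
    unfolding exact_aug_def
  proof (intro conjI allI impI)
    fix i k l assume kl: "k < arank ?E (Suc i)" "l < arank ?E i"
    show "abdry ?E i k l \<in> S n" using cone_entries[OF G C \<Phi> kl] by blast
    show "homogeneous (ashift ?E (Suc i) k - ashift ?E i l) (abdry ?E i k l)"
      using cone_entries[OF G C \<Phi> kl] by blast
  qed (fact ideal exact)+
qed

lemma card_shift_cone:
  "card {k. k < frank (cone G C a \<Phi>) i \<and> shift (cone G C a \<Phi>) i k = j}
   = card {k. k < frank G i \<and> shift G i k = j} + card {k. k < arank C i \<and> ashift C i k = j - a}"
proof -
  let ?A = "{k. k < frank G i \<and> shift G i k = j}" and ?B = "{k. k < arank C i \<and> ashift C i k = j - a}"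
  have "{k. k < frank (cone G C a \<Phi>) i \<and> shift (cone G C a \<Phi>) i k = j} = ?A \<union> (+) (frank G i) ` ?B"
  proof (intro subset_antisym subsetI)
    fix k assume k: "k \<in> {k. k < frank (cone G C a \<Phi>) i \<and> shift (cone G C a \<Phi>) i k = j}"
    then have "k < frank G i + arank C i" by (simp add: cone_def)
    then show "k \<in> ?A \<union> (+) (frank G i) ` ?B"
      using k by (cases rule: less_add_cases) (auto simp: cone_def)
  qed (auto simp: cone_def)
  moreover have "?A \<inter> (+) (frank G i) ` ?B = {}" by auto
  moreover have "card ((+) (frank G i) ` ?B) = card ?B" by (intro card_image) simp
  ultimately show ?thesis by (simp add: card_Un_disjoint)
qed

text \<open>Position 0 is included: \<open>F\<^sub>i\<close> of such a complex sits in degree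
  \<open>i + 1\<close>.\<close>

definition linear_complex :: "'k::field free_complex \<Rightarrow> bool" where
  "linear_complex C \<longleftrightarrow> (\<forall>i. \<forall>k<arank C i. ashift C i k = int i)"

text \<open>A constant entry joins equal degrees. From \<open>C\<close> to \<open>G\<close> the
  source has degree \<open>a + i + 1\<close> and the target at most \<open>a + i\<close>; inside
  \<open>C\<close> the degrees differ by 1.\<close>

lemma minimal_cone:
  assumes C: "exact_aug n Q C" and \<Phi>: "chain_map n a C G \<Phi>" and lin: "linear_complex C"
    and min: "minimal G" and G: "\<And>i k. k < frank G i \<Longrightarrow> shift G i k \<le> a + int i"
  shows "minimal (cone G C a \<Phi>)"
  unfolding minimal_def
proof (intro allI impI)
  fix i k l assume k: "k < frank (cone G C a \<Phi>) (Suc i)" and l: "l < frank (cone G C a \<Phi>) i"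
  show "lookup (bdry (cone G C a \<Phi>) i k l) 0 = 0"
  proof (rule ccontr)
    assume nz: "lookup (bdry (cone G C a \<Phi>) i k l) 0 \<noteq> 0"
    have kG: "\<not> k < frank G (Suc i)"
      using nz min by (auto simp: cone_def minimal_def split: if_splits)
    define k' where "k' = k - frank G (Suc i)"
    have k': "k' < arank C (Suc i)" using k kG by (simp add: k'_def cone_def less_diff_conv2)
    show False
    proof (cases "l < frank G i")
      case True
      then have "homogeneous (a + ashift C (Suc i) k' - shift G i l) (\<Phi> (Suc i) k' l)"
        using chain_map_graded[OF \<Phi>, of "Suc i"] k' by (simp add: graded_mat_def aug_Suc)
      moreover have "lookup (\<Phi> (Suc i) k' l) 0 \<noteq> 0"
        using nz kG True by (simp add: cone_def k'_def)
      ultimately have "a + ashift C (Suc i) k' - shift G i l = 0" by (rule homogeneous_const_term)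
      then show False using lin k' G[OF True] by (simp add: linear_complex_def)
    next
      case False
      define l' where "l' = l - frank G i"
      have l': "l' < arank C i" using l False by (simp add: l'_def cone_def less_diff_conv2)
      have "lookup (abdry C i k' l') 0 \<noteq> 0"
        using nz kG False by (simp add: cone_def k'_def l'_def)
      with exact_aug_homogeneous[OF C k' l'] have "ashift C (Suc i) k' - ashift C i l' = 0"
        by (rule homogeneous_const_term)
      then show False using lin k' l' by (simp add: linear_complex_def)
    qed
  qed
qed

section \<open>Monomial ideals\<close>

text \<open>Membership is a condition on each exponent vector, so sums and colons of ideals reduce
  to divisibility. A cofactor \<open>w\<close> uses only variables of \<open>m\<close> and hence
  stays in the ring. \<open>genideal_mono_polys\<close> identifies this with the generated
  ideal.\<close>

definition mideal :: "nat \<Rightarrow> monomial set \<Rightarrow> 'k::field mpoly set" where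
  "mideal n A = {p \<in> S n. \<forall>m\<in>keys p. \<exists>u\<in>A. \<exists>w. m = u + w}"

lemma mideal_empty: "mideal n {} = {0}"
  by (auto simp: mideal_def)

lemma mono_poly_in_mideal:
  "mono_poly m \<in> (mideal n A :: 'k::field mpoly set) \<longleftrightarrow> keys m \<subseteq> {1..n} \<and> (\<exists>u\<in>A. \<exists>w. m = u + w)"
  by (auto simp: mideal_def in_S_iff)

lemma mideal_add: "p \<in> mideal n A \<Longrightarrow> q \<in> mideal n A \<Longrightarrow> p + q \<in> mideal n A"
  using Poly_Mapping.keys_add[of p q] by (auto simp: mideal_def)

lemma mideal_sum: "(\<And>x. x \<in> X \<Longrightarrow> f x \<in> mideal n A) \<Longrightarrow> sum f X \<in> mideal n A"
proof (induction X rule: infinite_finite_induct)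
  case (insert x X)
  then show ?case by (simp add: mideal_add)
qed (simp_all add: mideal_def)

lemma mideal_mono: "A \<subseteq> B \<Longrightarrow> mideal n A \<subseteq> mideal n B"
  unfolding mideal_def by blast

lemma mideal_mult:
  assumes p: "p \<in> mideal n A" and q: "q \<in> S n"
  shows "q * p \<in> mideal n A"
  unfolding mideal_def
proof (intro CollectI conjI ballI)
  show "q * p \<in> S n" using p q by (auto simp: mideal_def)
  fix m assume "m \<in> keys (q * p)"
  then obtain a b where ab: "m = a + b" "b \<in> keys p"
    using keys_mult[of q p] by blast
  then obtain u w where "u \<in> A" "b = u + w" using p by (auto simp: mideal_def)
  then show "\<exists>u\<in>A. \<exists>w. m = u + w" using ab by (metis add.left_commute)
qed

lemma mono_poly_S: "mono_poly u \<in> S n \<longleftrightarrow> keys u \<subseteq> {1..n}"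
  by (auto simp: in_S_iff)

lemma times_mono_poly: "p * mono_poly u = (\<Sum>m\<in>keys p. single (m + u) (lookup p m))"
proof -
  have "(\<Sum>m\<in>keys p. single m (lookup p m)) * mono_poly u
      = (\<Sum>m\<in>keys p. single (m + u) (lookup p m))"
    by (simp add: sum_distrib_right mult_single)
  then show ?thesis using sum_monomials[of p] by simp
qed

lemma lookup_times_mono_poly:
  fixes p :: "'k::field mpoly"
  shows "lookup (p * mono_poly u) (m + u) = lookup p m"
  by (auto simp: times_mono_poly lookup_sum lookup_single when_def in_keys_iff)

lemma keys_times_mono_poly:
  fixes p :: "'k::field mpoly"
  shows "keys (p * mono_poly u) = (\<lambda>m. m + u) ` keys p"
proof (intro subset_antisym subsetI)
  fix m assume "m \<in> keys (p * mono_poly u)"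
  then show "m \<in> (\<lambda>m. m + u) ` keys p"
    using keys_mult[of p "mono_poly u"] by auto
qed (auto simp: in_keys_iff lookup_times_mono_poly)

text \<open>The terms divisible by an element of \<open>A\<close> are split off; the remaining ones
  must be divisible by \<open>u\<close>.\<close>

lemma mideal_insert:
  fixes u :: monomial
  assumes u: "keys u \<subseteq> {1..n}"
  shows "(mideal n (insert u A) :: 'k::field mpoly set) = {p + q * mono_poly u | p q. p \<in> mideal n A \<and> q \<in> S n}"
proof (intro subset_antisym subsetI)
  fix p :: "'k mpoly" assume p: "p \<in> mideal n (insert u A)"
  let ?K = "{m \<in> keys p. \<exists>v\<in>A. \<exists>w. m = v + w}"
  let ?L = "keys p - ?K"
  let ?c = "lookup p"
  let ?p1 = "\<Sum>m\<in>?K. single m (?c m)"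
  let ?q = "\<Sum>m\<in>?L. single (m - u) (?c m)"
  have keysS: "keys m \<subseteq> {1..n}" if "m \<in> keys p" for m
    using p that by (auto simp: mideal_def in_S_iff)
  have div: "\<exists>w. m = u + w" if "m \<in> ?L" for m
    using p that by (auto simp: mideal_def)
  have "?q * mono_poly u = (\<Sum>m\<in>?L. single m (?c m))"
    unfolding sum_distrib_right
  proof (rule sum.cong[OF refl])
    fix m assume "m \<in> ?L"
    then obtain w where "m = u + w" using div by blast
    then show "single (m - u) (?c m) * mono_poly u = single m (?c m)"
      by (simp add: mult_single add.commute)
  qed
  then have "p = ?p1 + ?q * mono_poly u"
    using sum.subset_diff[of ?K "keys p" "\<lambda>m. single m (?c m)"] sum_monomials[of p]
    by (simp add: add.commute)
  moreover have "?p1 \<in> mideal n A"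
  proof -
    have "single m (?c m) \<in> mideal n A" if "m \<in> ?K" for m
      using that keysS by (auto simp: mideal_def in_S_iff split: if_splits)
    then show ?thesis by (rule mideal_sum)
  qed
  moreover have "?q \<in> S n"
  proof (rule S_sum)
    fix m assume m: "m \<in> ?L"
    then obtain w where "m = u + w" using div by blast
    then have "keys (m - u) \<subseteq> {1..n}" using keysS[of m] m by (auto simp: keys_add_monomial)
    then show "single (m - u) (?c m) \<in> S n" by (simp add: in_S_iff)
  qed
  ultimately show "p \<in> {p + q * mono_poly u | p q. p \<in> mideal n A \<and> q \<in> S n}" by blast
next
  fix x :: "'k mpoly" assume "x \<in> {p + q * mono_poly u | p q. p \<in> mideal n A \<and> q \<in> S n}"
  then obtain p q where x: "x = p + q * mono_poly u" "p \<in> mideal n A" "q \<in> S n" by blast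
  have "mono_poly u \<in> (mideal n (insert u A) :: 'k mpoly set)"
    unfolding mono_poly_in_mideal using u by (metis add.right_neutral insertI1)
  then have "q * mono_poly u \<in> mideal n (insert u A)" using x(3) by (rule mideal_mult)
  moreover have "p \<in> mideal n (insert u A)" using x(2) mideal_mono[of A "insert u A"] by blast
  ultimately show "x \<in> mideal n (insert u A)" unfolding x(1) by (intro mideal_add)
qed

text \<open>Multiplication by a monomial translates the support without cancellation, so the colon
  ideal can be tested on monomials.\<close>

lemma mideal_colon:
  fixes p :: "'k::field mpoly"
  assumes u: "keys u \<subseteq> {1..n}"
    and AB: "\<And>m. keys m \<subseteq> {1..n} \<Longrightarrow> (\<exists>a\<in>A. \<exists>w. m + u = a + w) \<longleftrightarrow> (\<exists>b\<in>B. \<exists>w. m = b + w)"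
  shows "p \<in> mideal n B \<longleftrightarrow> p \<in> S n \<and> p * mono_poly u \<in> mideal n A"
proof -
  have "p * mono_poly u \<in> S n" if "p \<in> S n" using that u by (auto simp: mono_poly_S)
  then show ?thesis using AB by (auto simp: mideal_def keys_times_mono_poly in_S_iff)
qed

text \<open>One step of the linear quotient construction, with \<open>B\<close> generating the colon
  ideal of \<open>A\<close> by \<open>u\<close>. As \<open>C\<close> is linear, position
  \<open>i\<close> of it contributes in the single degree \<open>mdeg u + i\<close>.\<close>

theorem mideal_insert_resolution:
  fixes G C :: "'k::field free_complex"
  assumes G: "exact_aug n (mideal n A) G" and C: "exact_aug n (mideal n B) C" and lin: "linear_complex C"
    and min: "minimal G" and Gs: "\<And>i k. k < frank G i \<Longrightarrow> shift G i k \<le> int (mdeg u) + int i"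
    and u: "keys u \<subseteq> {1..n}"
    and AB: "\<And>m. keys m \<subseteq> {1..n} \<Longrightarrow> (\<exists>a\<in>A. \<exists>w. m + u = a + w) \<longleftrightarrow> (\<exists>b\<in>B. \<exists>w. m = b + w)"
  shows "\<exists>E :: 'k free_complex. exact_aug n (mideal n (insert u A)) E \<and> minimal E \<and>
    (\<forall>i. frank E i = frank G i + arank C i) \<and>
    (\<forall>i j. card {k. k < frank E i \<and> shift E i k = j} = card {k. k < frank G i \<and> shift G i k = j}
       + (if int (mdeg u + i) = j then arank C i else 0))"
proof -
  let ?u = "mono_poly u :: 'k mpoly"
  have uS: "?u \<in> S n" using u by (simp add: mono_poly_S)
  have Q: "p \<in> mideal n B \<longleftrightarrow> p \<in> S n \<and> p * ?u \<in> mideal n A" for p :: "'k mpoly"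
    using mideal_colon[OF u AB] .
  obtain \<Phi> where \<Phi>: "chain_map n (int (mdeg u)) C G \<Phi>" "\<Phi> 0 0 0 = ?u"
    using comparison[OF C G uS homogeneous_single] Q by blast
  let ?E = "cone G C (int (mdeg u)) \<Phi>"
  have "exact_aug n (mideal n (insert u A)) ?E"
    unfolding mideal_insert[OF u] using exact_aug_cone[OF G C uS Q \<Phi>] .
  moreover have "minimal ?E" using minimal_cone[OF C \<Phi>(1) lin min Gs] by simp
  moreover have "{k. k < arank C i \<and> ashift C i k = j - int (mdeg u)} = (if int (mdeg u + i) = j then {..<arank C i} else {})" for i j
    using lin by (auto simp: linear_complex_def)
  then have "card {k. k < arank C i \<and> ashift C i k = j - int (mdeg u)} = (if int (mdeg u + i) = j then arank C i else 0)" for i j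
    by simp
  ultimately show ?thesis
    by (intro exI[of _ ?E]) (simp add: card_shift_cone, simp add: cone_def)
qed

definition zero_complex :: "'k::field free_complex" where
  "zero_complex = \<lparr> frank = \<lambda>_. 0, shift = \<lambda>_ _. 0, bdry = \<lambda>_ _ _. 0, aug = \<lambda>_. 0 \<rparr>"

lemma exact_aug_zero_complex: "exact_aug n (mideal n {}) zero_complex"
proof -
  have r: "arank zero_complex (Suc i) = 0" for i by (simp add: zero_complex_def aug_Suc)
  show ?thesis unfolding exact_aug_def by (auto simp: r mideal_empty vm_def)
qed

lemma single_divides_iff:
  fixes m :: monomial
  shows "(\<exists>w. m = single s 1 + w) \<longleftrightarrow> s \<in> keys m"
proof
  assume "s \<in> keys m"
  then have "m = single s 1 + (m - single s 1)"
    by (intro poly_mapping_eqI) (auto simp: lookup_add lookup_minus lookup_single when_def in_keys_iff)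
  then show "\<exists>w. m = single s 1 + w" by blast
qed (auto simp: keys_add_monomial)

text \<open>The Koszul complex, obtained as an iterated mapping cone.\<close>

lemma variables_resolution:
  assumes "finite P" "P \<subseteq> {1..n}"
  shows "\<exists>C :: 'k::field free_complex. exact_aug n (mideal n ((\<lambda>s. single s 1) ` P)) C \<and>
    minimal C \<and> linear_complex C \<and> (\<forall>i. arank C i = card P choose i)"
  using assms
proof (induction P rule: finite_induct)
  case empty
  have "arank zero_complex i = (0 choose i)" for i
    by (cases i) (simp_all add: zero_complex_def aug_Suc)
  moreover have "linear_complex zero_complex"
    unfolding linear_complex_def by (intro allI, case_tac i) (simp_all add: zero_complex_def aug_Suc)
  moreover have "minimal zero_complex" by (simp add: minimal_def zero_complex_def)
  ultimately show ?case using exact_aug_zero_complex by auto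
next
  case (insert s P)
  let ?x = "\<lambda>s. single s 1 :: monomial"
  obtain C :: "'k free_complex" where C: "exact_aug n (mideal n (?x ` P)) C" "minimal C" "linear_complex C"
    "\<And>i. arank C i = card P choose i" using insert by blast
  have shift: "shift C i k = int (Suc i)" if "k < frank C i" for i k
    using C(3) that unfolding linear_complex_def by (metis aug_Suc(1,2))
  have "\<exists>E :: 'k free_complex. exact_aug n (mideal n (insert (?x s) (?x ` P))) E \<and> minimal E \<and>
    (\<forall>i. frank E i = frank C i + arank C i) \<and>
    (\<forall>i j. card {k. k < frank E i \<and> shift E i k = j} = card {k. k < frank C i \<and> shift C i k = j}
       + (if int (mdeg (?x s) + i) = j then arank C i else 0))"
  \<comment> \<open>A new variable is a nonzerodivisor modulo the others, so the colon ideal is the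
    old ideal and \<open>C\<close> plays both roles.\<close>
  proof (rule mideal_insert_resolution[OF C(1) C(1) C(3) C(2)])
    show "shift C i k \<le> int (mdeg (?x s)) + int i" if "k < frank C i" for i k
      using shift[OF that] by simp
    show "keys (?x s) \<subseteq> {1..n}" using insert.prems by simp
    show "(\<exists>a\<in>?x ` P. \<exists>w. m + ?x s = a + w) \<longleftrightarrow> (\<exists>b\<in>?x ` P. \<exists>w. m = b + w)" for m
      unfolding bex_simps single_divides_iff keys_add_monomial using insert.hyps(2) by auto
  qed
  then obtain E :: "'k free_complex" where E: "exact_aug n (mideal n (insert (?x s) (?x ` P))) E" "minimal E"
    "\<And>i. frank E i = frank C i + arank C i"
    "\<And>i j. card {k. k < frank E i \<and> shift E i k = j} = card {k. k < frank C i \<and> shift C i k = j}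
       + (if int (mdeg (?x s) + i) = j then arank C i else 0)" by blast
  \<comment> \<open>Pascal's rule: \<open>arank\<close> runs one position ahead of
    \<open>frank\<close>, so the two summands are consecutive binomial coefficients.\<close>
  have arE: "arank E i = card (insert s P) choose i" for i
  proof (cases i)
    case (Suc i')
    then show ?thesis using E(3)[of i'] C(4)[of i'] C(4)[of i] insert.hyps by (simp add: aug_Suc)
  qed simp
  \<comment> \<open>The degrees of \<open>E\<close> are known only through their counts; the count
    in degree \<open>i + 1\<close> already exhausts the rank.\<close>
  have "shift E i k = int (Suc i)" if k: "k < frank E i" for i k
  proof -
    have "{k. k < frank C i \<and> shift C i k = int (Suc i)} = {..<frank C i}" using shift by auto
    then have "card {k. k < frank E i \<and> shift E i k = int (Suc i)} = card {..<frank E i}"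
      using E(3,4)[of i] by simp
    then have "{k. k < frank E i \<and> shift E i k = int (Suc i)} = {..<frank E i}"
      by (intro card_subset_eq) auto
    then show ?thesis using k by blast
  qed
  then have "ashift E i k = int i" if "k < arank E i" for i k
    using that by (cases i) (auto simp: aug_Suc)
  then have "linear_complex E" by (simp add: linear_complex_def)
  then show ?case using E(1,2) arE by (intro exI[of _ E]) simp
qed

section \<open>Spread monomials in shifted coordinates\<close>

text \<open>Subtracting \<open>t\<^sub>1 + \<dots> + t\<^sub>r\<close> from the index in position \<open>r\<close> (counted from 0) identifies the
  spread monomials of degree \<open>l\<close> with the sorted words of length \<open>l\<close> over \<open>{1..width n t l}\<close>.\<close>

definition offs :: "nat list \<Rightarrow> nat \<Rightarrow> nat" where
  "offs t r = (\<Sum>s<r. t ! s)"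

text \<open>Only the last position, with offset \<open>offs t (l - 1)\<close>, limits the alphabet.
  For \<open>l = 0\<close> the truncated subtraction yields \<open>n\<close>, which keeps the widths
  weakly decreasing.\<close>

definition width :: "nat \<Rightarrow> nat list \<Rightarrow> nat \<Rightarrow> nat" where
  "width n t l = n - offs t (l - 1)"

definition spread :: "nat list \<Rightarrow> nat list \<Rightarrow> monomial" where
  "spread t a = (\<Sum>r<length a. single (a ! r + offs t r) 1)"

lemma offs_simps [simp]: "offs t 0 = 0" "offs t (Suc r) = offs t r + t ! r"
  by (simp_all add: offs_def)

lemma offs_mono: "r \<le> s \<Longrightarrow> offs t r \<le> offs t s"
  unfolding offs_def by (intro sum_mono2) auto

lemma width_antimono: "m \<le> l \<Longrightarrow> width n t l \<le> width n t m"
  unfolding width_def by (intro diff_le_mono2 offs_mono diff_le_mono)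

lemma lookup_spread: "lookup (spread t a) x = card {r. r < length a \<and> a ! r + offs t r = x}"
proof -
  have "lookup (spread t a) x = (\<Sum>r<length a. if a ! r + offs t r = x then 1 else 0)"
    by (auto simp: spread_def lookup_sum lookup_single when_def intro!: sum.cong)
  also have "\<dots> = card ({..<length a} \<inter> {r. a ! r + offs t r = x})"
    by (simp add: sum.If_cases)
  also have "{..<length a} \<inter> {r. a ! r + offs t r = x} = {r. r < length a \<and> a ! r + offs t r = x}" by auto
  finally show ?thesis .
qed

lemma keys_spread: "x \<in> keys (spread t a) \<longleftrightarrow> (\<exists>r<length a. a ! r + offs t r = x)"
  by (auto simp: in_keys_iff lookup_spread card_eq_0_iff)

lemma mdeg_sum: "mdeg (sum f A) = (\<Sum>x\<in>A. mdeg (f x))"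
  by (induction A rule: infinite_finite_induct) (auto simp: mdeg_add)

lemma mdeg_spread [simp]: "mdeg (spread t a) = length a"
  by (simp add: spread_def mdeg_sum)

lemma words_nth: "a \<in> words N l \<Longrightarrow> r < l \<Longrightarrow> 1 \<le> a ! r \<and> a ! r \<le> N"
  by (force simp: words_def)

lemma pos_le:
  assumes "a \<in> words (width n t l) l" "r < l"
  shows "a ! r + offs t r \<le> n"
proof -
  have "r \<le> l - 1" using assms(2) by simp
  then have "offs t r \<le> offs t (l - 1)" by (rule offs_mono)
  moreover have "1 \<le> a ! r \<and> a ! r \<le> n - offs t (l - 1)"
    using words_nth[OF assms] by (simp add: width_def)
  ultimately show ?thesis by linarith
qed

lemma pos_mono:
  assumes "sorted a" "r \<le> s" "s < length a"
  shows "a ! r + offs t r \<le> a ! s + offs t s"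
  using assms sorted_nth_mono offs_mono add_mono by metis

lemma keys_spread_subset: "a \<in> words (width n t l) l \<Longrightarrow> keys (spread t a) \<subseteq> {1..n}"
proof
  fix x assume a: "a \<in> words (width n t l) l" and "x \<in> keys (spread t a)"
  then obtain r where r: "r < l" "x = a ! r + offs t r" by (auto simp: keys_spread words_def)
  then show "x \<in> {1..n}" using pos_le[OF a r(1)] words_nth[OF a r(1)] by simp
qed

lemma sum_list_singles: "(\<Sum>j\<leftarrow>js. single j 1) = (\<Sum>r<length js. single (js ! r) 1 :: monomial)"
  by (simp add: sum_list_sum_nth atLeast0LessThan)

lemma tspread_iff:
  "tspread n d t u \<longleftrightarrow> (\<exists>a. length a \<le> d \<and> a \<in> words (width n t (length a)) (length a) \<and> u = spread t a)"
proof
  assume "tspread n d t u"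
  then obtain js where js: "sorted js" "set js \<subseteq> {1..n}" "length js \<le> d" "u = (\<Sum>j\<leftarrow>js. single j 1)"
    "\<And>i. Suc i < length js \<Longrightarrow> js ! i + t ! i \<le> js ! Suc i" unfolding tspread_def by blast
  \<comment> \<open>This bound ensures that subtracting the offsets does not truncate and leaves
    letters of at least 1.\<close>
  have ge: "1 + offs t r \<le> js ! r" if "r < length js" for r
    using that
  proof (induction r)
    case 0
    then show ?case using js(2) nth_mem[of 0 js] by fastforce
  next
    case (Suc r)
    then show ?case using js(5)[of r] by simp
  qed
  define a where "a = map (\<lambda>r. js ! r - offs t r) [0..<length js]"
  have len: "length a = length js" by (simp add: a_def)
  have nth: "a ! r = js ! r - offs t r" if "r < length js" for r using that by (simp add: a_def)
  have sorted: "sorted a"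
    unfolding sorted_iff_nth_Suc len using js(5) nth by fastforce
  have "x \<in> {1..width n t (length js)}" if "x \<in> set a" for x
  proof -
    obtain r where r: "r < length js" "x = a ! r" using \<open>x \<in> set a\<close> len by (metis in_set_conv_nth)
    have "a ! r \<le> a ! (length js - 1)" using sorted r(1) len by (intro sorted_nth_mono) auto
    also have "\<dots> = js ! (length js - 1) - offs t (length js - 1)" using r(1) by (intro nth) auto
    also have "\<dots> \<le> n - offs t (length js - 1)"
      using js(2) nth_mem[of "length js - 1" js] r(1) by (intro diff_le_mono) fastforce
    finally show ?thesis using ge[OF r(1)] nth[OF r(1)] r(2) by (simp add: width_def)
  qed
  then have "a \<in> words (width n t (length a)) (length a)" using sorted len by (auto simp: words_def)
  moreover have "u = spread t a"
    unfolding js(4) sum_list_singles spread_def len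
  proof (rule sum.cong[OF refl])
    fix r assume "r \<in> {..<length js}"
    then show "single (js ! r) 1 = single (a ! r + offs t r) (1 :: nat)"
      using ge[of r] nth[of r] by simp
  qed
  ultimately show "\<exists>a. length a \<le> d \<and> a \<in> words (width n t (length a)) (length a) \<and> u = spread t a"
    using js(3) len by (intro exI[of _ a]) simp
next
  assume "\<exists>a. length a \<le> d \<and> a \<in> words (width n t (length a)) (length a) \<and> u = spread t a"
  then obtain a where a: "length a \<le> d" "a \<in> words (width n t (length a)) (length a)" "u = spread t a" by blast
  have sa: "sorted a" using a(2) by (simp add: words_def)
  define js where "js = map (\<lambda>r. a ! r + offs t r) [0..<length a]"
  have len: "length js = length a" by (simp add: js_def)
  have nth: "js ! r = a ! r + offs t r" if "r < length a" for r using that by (simp add: js_def)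
  have "sorted js"
    unfolding sorted_iff_nth_mono using pos_mono[OF sa] by (auto simp: len nth)
  moreover have "set js \<subseteq> {1..n}"
  proof
    fix x assume "x \<in> set js"
    then obtain r where r: "r < length a" "x = a ! r + offs t r" by (auto simp: js_def)
    then show "x \<in> {1..n}" using pos_le[OF a(2) r(1)] words_nth[OF a(2) r(1)] by simp
  qed
  moreover have "u = (\<Sum>j\<leftarrow>js. single j 1)"
    unfolding a(3) sum_list_singles spread_def len using nth by (intro sum.cong) auto
  moreover have "js ! i + t ! i \<le> js ! Suc i" if "Suc i < length js" for i
    using that sa len nth sorted_nth_mono[of a i "Suc i"] by simp
  ultimately show "tspread n d t u" unfolding tspread_def using a(1) len by (intro exI[of _ js]) simp
qed

text \<open>Let \<open>p\<close> be the first difference. Since positions increase weakly, all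
  variables before \<open>a ! p + offs t p\<close> occur equally often in both monomials, while that
  variable itself occurs more often for \<open>a\<close>.\<close>

lemma spread_less:
  assumes "sorted a" "sorted b" "length a = length b" "a < b"
  shows "spread t b < spread t a"
proof -
  obtain p where p: "p < length a" "\<And>q. q < p \<Longrightarrow> a ! q = b ! q" "a ! p < b ! p"
    using assms list_less_nth by blast
  let ?x = "a ! p + offs t p"
  have b_ge: "?x < b ! r + offs t r" if "p \<le> r" "r < length b" for r
    using pos_mono[OF assms(2) that, of t] p(3) by simp
  have a_ge: "?x \<le> a ! r + offs t r" if "p \<le> r" "r < length a" for r
    using pos_mono[OF assms(1) that] .
  have eq: "lookup (spread t b) y = lookup (spread t a) y" if "y < ?x" for y
  proof -
    have "{r. r < length b \<and> b ! r + offs t r = y} = {r. r < length a \<and> a ! r + offs t r = y}"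
    proof (rule Collect_cong)
      fix r show "(r < length b \<and> b ! r + offs t r = y) = (r < length a \<and> a ! r + offs t r = y)"
      proof (cases "r < p")
        case True
        then show ?thesis using p(2)[OF True] assms(3) by simp
      next
        case False
        then show ?thesis using a_ge[of r] b_ge[of r] that assms(3) by auto
      qed
    qed
    then show ?thesis by (simp add: lookup_spread)
  qed
  have "{r. r < length b \<and> b ! r + offs t r = ?x} \<subset> {r. r < length a \<and> a ! r + offs t r = ?x}"
  proof
    show "{r. r < length b \<and> b ! r + offs t r = ?x} \<subseteq> {r. r < length a \<and> a ! r + offs t r = ?x}"
    proof
      fix r assume r: "r \<in> {r. r < length b \<and> b ! r + offs t r = ?x}"
      then have "r < p" using b_ge[of r] by (metis (mono_tags, lifting) leI less_irrefl mem_Collect_eq)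
      then show "r \<in> {r. r < length a \<and> a ! r + offs t r = ?x}" using r p(2)[of r] assms(3) by simp
    qed
    have "p \<notin> {r. r < length b \<and> b ! r + offs t r = ?x}" using p(3) by simp
    moreover have "p \<in> {r. r < length a \<and> a ! r + offs t r = ?x}" using p(1) by simp
    ultimately show "{r. r < length b \<and> b ! r + offs t r = ?x} \<noteq> {r. r < length a \<and> a ! r + offs t r = ?x}" by blast
  qed
  then have "lookup (spread t b) ?x < lookup (spread t a) ?x"
    unfolding lookup_spread by (intro psubset_card_mono) auto
  then show ?thesis
    unfolding less_poly_mapping.rep_eq less_fun_def using eq by blast
qed

lemma spread_le_iff:
  assumes "a \<in> words N l" "b \<in> words N l"
  shows "spread t a \<le> spread t b \<longleftrightarrow> b \<le> a"
proof -
  have s: "sorted a" "sorted b" "length a = length b" using assms by (auto simp: words_def)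
  show ?thesis
    using spread_less[OF s, of t] spread_less[of b a t] s by (cases a b rule: linorder_cases) auto
qed

lemma spread_inj:
  assumes "a \<in> words (width n t (length a)) (length a)" "b \<in> words (width n t (length b)) (length b)"
    and "spread t a = spread t b"
  shows "a = b"
proof -
  have "length a = length b" using assms(3) mdeg_spread by metis
  then have w: "a \<in> words (width n t (length a)) (length a)" "b \<in> words (width n t (length a)) (length a)"
    using assms(1,2) by auto
  show ?thesis using spread_le_iff[OF w, of t] spread_le_iff[OF w(2,1), of t] assms(3) by simp
qed

lemma spread_snoc: "spread t (a @ [b]) = spread t a + single (b + offs t (length a)) 1"
  unfolding spread_def by (auto simp: nth_append intro!: arg_cong2[of _ _ _ _ "(+)"] sum.cong)

lemma spread_append_divides: "\<exists>w. spread t (a @ b) = spread t a + w"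
proof (induction b rule: rev_induct)
  case Nil
  then show ?case by (intro exI[of _ 0]) simp
next
  case (snoc x b)
  then obtain w where "spread t (a @ b) = spread t a + w" by blast
  then have "spread t (a @ b @ [x]) = spread t a + (w + single (x + offs t (length (a @ b))) 1)"
    using spread_snoc[of t "a @ b" x] by (simp add: add.assoc)
  then show ?case by blast
qed

lemma spread_take_divides: "\<exists>w. spread t a = spread t (take m a) + w"
  using spread_append_divides[of t "take m a" "drop m a"] by simp

text \<open>The exchange of one variable, in additive form because subtraction of exponents
  truncates.\<close>

lemma spread_update:
  assumes "r < length a"
  shows "spread t (a[r := y]) + single (a ! r + offs t r) 1 = spread t a + single (y + offs t r) 1"
proof -
  have s: "spread t c = single (c ! r + offs t r) 1
      + (\<Sum>s\<in>{..<length c} - {r}. single (c ! s + offs t s) 1)" if "length c = length a" for c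
    unfolding spread_def using that assms by (intro sum.remove) auto
  have "(\<Sum>s\<in>{..<length (a[r := y])} - {r}. single (a[r := y] ! s + offs t s) 1)
      = (\<Sum>s\<in>{..<length a} - {r}. single (a ! s + offs t s) (1 :: nat))"
    by (intro sum.cong) auto
  then show ?thesis using s[of a] s[of "a[r := y]"] assms by (simp add: add_ac)
qed

section \<open>Linear quotients\<close>

text \<open>The variables that multiply \<open>spread t a\<close> into the ideal generated by the earlier generators:
  they can replace the next variable of \<open>spread t a\<close> without violating the spread condition.\<close>

definition free_vars :: "nat list \<Rightarrow> nat list \<Rightarrow> nat set" where
  "free_vars t a = {x. \<exists>r<length a. (if r = 0 then 1 else a ! (r - 1)) + offs t r \<le> x \<and> x < a ! r + offs t r}"

lemma free_vars_snoc: "free_vars t (a @ [b]) = free_vars t a \<union> {mx a + offs t (length a)..<b + offs t (length a)}"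
proof -
  define P where "P r x \<longleftrightarrow> (if r = 0 then 1 else (a @ [b]) ! (r - 1)) + offs t r \<le> x \<and> x < (a @ [b]) ! r + offs t r" for r x
  define Q where "Q r x \<longleftrightarrow> (if r = 0 then 1 else a ! (r - 1)) + offs t r \<le> x \<and> x < a ! r + offs t r" for r x
  have P: "free_vars t (a @ [b]) = {x. \<exists>r<Suc (length a). P r x}"
    unfolding free_vars_def P_def by simp
  have Q: "free_vars t a = {x. \<exists>r<length a. Q r x}"
    unfolding free_vars_def Q_def by simp
  have PQ: "P r x \<longleftrightarrow> Q r x" if "r < length a" for r x
    using that by (simp add: P_def Q_def nth_append less_imp_diff_less)
  have last: "(if length a = 0 then 1 else (a @ [b]) ! (length a - 1)) = mx a"
    by (cases a rule: rev_cases) (auto simp: mx_def nth_append)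
  have Pl: "P (length a) x \<longleftrightarrow> x \<in> {mx a + offs t (length a)..<b + offs t (length a)}" for x
    unfolding P_def last by simp
  show ?thesis unfolding P Q using PQ Pl by (auto simp: less_Suc_eq)
qed

lemma free_vars_less: "a \<in> words N l \<Longrightarrow> x \<in> free_vars t a \<Longrightarrow> x < mx a + offs t l"
proof -
  assume a: "a \<in> words N l" and "x \<in> free_vars t a"
  then obtain r where r: "r < l" "x < a ! r + offs t r" by (auto simp: free_vars_def words_def)
  have "a ! r \<le> a ! (l - 1)" using a r(1) by (intro sorted_nth_mono) (auto simp: words_def)
  also have "a ! (l - 1) = mx a" using a r(1) by (auto simp: words_def mx_def last_conv_nth)
  finally show ?thesis using r offs_mono[of r l t] by simp
qed

text \<open>The block for position \<open>r\<close> has length \<open>a ! r - a ! (r - 1)\<close>,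
  with 1 as predecessor of the first letter. Blocks are disjoint since offsets never decrease, so
  the lengths telescope to the last letter minus 1.\<close>

lemma card_free_vars:
  "a \<in> words N l \<Longrightarrow> finite (free_vars t a) \<and> card (free_vars t a) = mx a - 1"
proof (induction l arbitrary: a N)
  case 0
  then show ?case by (simp add: free_vars_def mx_def)
next
  case (Suc l)
  then obtain c b where c: "a = c @ [b]" "c \<in> words b l" "1 \<le> b" "b \<le> N" by (elim words_Suc_cases)
  have len: "length c = l" using c(2) by (simp add: words_def)
  have "free_vars t c \<inter> {mx c + offs t l..<b + offs t l} = {}"
    using free_vars_less[OF c(2)] by fastforce
  then have "card (free_vars t a) = card (free_vars t c) + (b - mx c)" "finite (free_vars t a)"
    using Suc.IH[OF c(2)] len by (simp_all add: c(1) free_vars_snoc card_Un_disjoint)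
  moreover have "1 \<le> mx c" "mx c \<le> b" using mx_ge[OF c(2)] mx_le[OF c(2,3)] by auto
  ultimately show ?case using Suc.IH[OF c(2)] c(1) by simp
qed

lemma free_vars_subset:
  assumes "a \<in> words (width n t l) l"
  shows "free_vars t a \<subseteq> {1..n}"
proof
  fix x assume "x \<in> free_vars t a"
  then obtain r where r: "r < l" "(if r = 0 then 1 else a ! (r - 1)) + offs t r \<le> x" "x < a ! r + offs t r"
    using assms by (auto simp: free_vars_def words_def)
  have "1 \<le> (if r = 0 then 1 else a ! (r - 1))" using words_nth[OF assms, of "r - 1"] r(1) by auto
  then show "x \<in> {1..n}" using r pos_le[OF assms r(1)] by simp
qed

text \<open>At the first position where \<open>a\<close> exceeds \<open>b\<close>, the variable of \<open>spread t b\<close> is either free for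
  \<open>a\<close> or occurs in \<open>spread t b\<close> more often than in \<open>spread t a\<close>.\<close>

lemma divides_imp_dominated:
  assumes a: "a \<in> words N l" and b: "b \<in> words N' l'"
    and div: "spread t a + m = spread t b + w" and m: "keys m \<inter> free_vars t a = {}"
    and r: "r < l" "r < l'"
  shows "a ! r \<le> b ! r"
  using r
proof (induction r rule: less_induct)
  case (less r)
  have la: "length a = l" "sorted a" and lb: "length b = l'" "sorted b"
    using a b by (auto simp: words_def)
  show ?case
  proof (rule ccontr)
    assume "\<not> a ! r \<le> b ! r"
    then have lt: "b ! r < a ! r" by simp
    let ?x = "b ! r + offs t r"
    have "(if r = 0 then 1 else a ! (r - 1)) \<le> b ! r"
    proof (cases "r = 0")
      case True
      then show ?thesis using words_nth[OF b, of r] less.prems by simp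
    next
      case False
      then have "a ! (r - 1) \<le> b ! (r - 1)" using less.IH[of "r - 1"] less.prems by simp
      also have "\<dots> \<le> b ! r" using lb less.prems by (intro sorted_nth_mono) auto
      finally show ?thesis using False by simp
    qed
    then have "(if r = 0 then 1 else a ! (r - 1)) + offs t r \<le> ?x" by (rule add_right_mono)
    moreover have "?x < a ! r + offs t r" using lt by simp
    ultimately have "?x \<in> free_vars t a"
      unfolding free_vars_def using less.prems(1) la(1) by blast
    then have "lookup m ?x = 0" using m by (auto simp: in_keys_iff)
    then have le: "lookup (spread t b) ?x \<le> lookup (spread t a) ?x"
      using arg_cong[OF div, of "\<lambda>u. lookup u ?x"] by (simp add: lookup_add)
    have "{s. s < length a \<and> a ! s + offs t s = ?x} \<subset> {s. s < length b \<and> b ! s + offs t s = ?x}"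
    proof
      show "{s. s < length a \<and> a ! s + offs t s = ?x} \<subseteq> {s. s < length b \<and> b ! s + offs t s = ?x}"
      proof
        fix s assume s: "s \<in> {s. s < length a \<and> a ! s + offs t s = ?x}"
        have sr: "s < r"
        proof (rule ccontr)
          assume "\<not> s < r"
          then have "a ! r + offs t r \<le> a ! s + offs t s" using s la by (intro pos_mono) auto
          then show False using s lt by simp
        qed
        then have "a ! s \<le> b ! s" using less by simp
        moreover have "b ! s + offs t s \<le> ?x" using sr lb less.prems by (intro pos_mono) auto
        ultimately show "s \<in> {s. s < length b \<and> b ! s + offs t s = ?x}"
          using s sr less.prems lb by auto
      qed
      have "r \<notin> {s. s < length a \<and> a ! s + offs t s = ?x}" using lt by simp
      moreover have "r \<in> {s. s < length b \<and> b ! s + offs t s = ?x}" using less.prems lb by simp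
      ultimately show "{s. s < length a \<and> a ! s + offs t s = ?x} \<noteq> {s. s < length b \<and> b ! s + offs t s = ?x}" by blast
    qed
    then have "lookup (spread t a) ?x < lookup (spread t b) ?x"
      unfolding lookup_spread by (intro psubset_card_mono) auto
    then show False using le by simp
  qed
qed

section \<open>Generators as shortest prefixes in a stable family\<close>

lemma stable_family_down:
  assumes "stable_family N d L" "l \<le> d" "a \<in> L l" "b \<in> words (N l) l" "\<And>r. r < l \<Longrightarrow> b ! r \<le> a ! r"
  shows "b \<in> L l"
proof -
  have "length a = l" "length b = l" using stable_family_words[OF assms(1,2)] assms(3,4) by (auto simp: words_def)
  then have "list_all2 (\<le>) b a" using assms(5) by (simp add: list_all2_conv_all_nth)
  then show ?thesis using assms unfolding stable_family_def stab_def by blast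
qed

lemma words_take: "a \<in> words N l \<Longrightarrow> m \<le> l \<Longrightarrow> N \<le> M \<Longrightarrow> take m a \<in> words M m"
  by (auto simp: words_def sorted_wrt_take dest!: in_set_takeD)

text \<open>Longer prefixes are iterated shadows of the given one; they fit into their alphabets
  because these are larger in lower degree.\<close>

lemma stable_family_take:
  assumes fam: "stable_family N d L" and N: "\<And>m l. m \<le> l \<Longrightarrow> N l \<le> N m"
    and a: "a \<in> words (N l) l" and m: "m \<le> m'" "m' \<le> l" "l \<le> d" and t: "take m a \<in> L m"
  shows "take m' a \<in> L m'"
  using m(1,2)
proof (induction m' rule: dec_induct)
  case base
  then show ?case using t by simp
next
  case (step k)
  have "take (Suc k) a \<in> words (N (Suc k)) (Suc k)"
    using words_take[OF a, of "Suc k"] N step.prems by simp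
  moreover have "butlast (take (Suc k) a) = take k a"
    using a step.prems by (simp add: butlast_take words_def)
  moreover have "take k a \<in> L k" using step by simp
  ultimately have "take (Suc k) a \<in> shad (N (Suc k)) k (L k)" by (simp add: shad_def)
  moreover have "k < d" using step.prems m(3) by simp
  ultimately show ?case using fam unfolding stable_family_def by blast
qed

text \<open>The shortest prefix that lies in the family is a generator.\<close>

lemma exists_gen_prefix:
  assumes fam: "stable_family N d L" and a: "a \<in> L l" "l \<le> d"
  shows "\<exists>m\<le>l. take m a \<in> family_gens d L \<and> length (take m a) = m"
proof -
  have len: "length a = l" using stable_family_words[OF fam a(2)] a(1) by (auto simp: words_def)
  define m where "m = (LEAST m. take m a \<in> L m)"
  have ex: "take l a \<in> L l" using a(1) len by simp
  have m1: "take m a \<in> L m" unfolding m_def using ex by (rule LeastI)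
  have ml: "m \<le> l" unfolding m_def using ex by (rule Least_le)
  have "take m a \<in> level_gens L m"
  proof (cases m)
    case 0
    then show ?thesis using m1 by (simp add: level_gens_def)
  next
    case (Suc k)
    have "take k a \<notin> L k" using not_less_Least[of k "\<lambda>m. take m a \<in> L m"] Suc unfolding m_def by simp
    moreover have "butlast (take m a) = take k a" using ml len Suc by (simp add: butlast_take)
    ultimately show ?thesis using m1 Suc by (simp add: level_gens_def)
  qed
  then show ?thesis using ml a(2) len unfolding family_gens_def by (intro exI[of _ m]) auto
qed

lemma family_gensD:
  assumes "stable_family N d L" "a \<in> family_gens d L"
  shows "length a \<le> d" "a \<in> L (length a)" "a \<in> words (N (length a)) (length a)" "a = [] \<or> butlast a \<notin> L (length a - 1)"
proof -
  obtain l where l: "l \<le> d" "a \<in> level_gens L l" using assms(2) by (auto simp: family_gens_def)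
  then have "a \<in> L l" by (simp add: level_gens_def)
  then have a: "a \<in> words (N l) l" using stable_family_words[OF assms(1) l(1)] by blast
  then have "length a = l" by (simp add: words_def)
  then show "length a \<le> d" "a \<in> L (length a)" "a \<in> words (N (length a)) (length a)" "a = [] \<or> butlast a \<notin> L (length a - 1)"
    using a l \<open>a \<in> L l\<close> by (auto simp: level_gens_def)
qed

lemma length_le_if_less: "a < b \<Longrightarrow> length a \<le> length b" for a b :: "nat list"
  by (cases a; cases b) (auto simp: Cons_less_Cons)

lemma less_if_length_less: "length a < length b \<Longrightarrow> a < b" for a b :: "nat list"
  by (cases a; cases b) (auto simp: Cons_less_Cons)

text \<open>If \<open>m\<close> avoids the free variables, domination gives \<open>b \<le> a\<close>
  letter by letter on the length of \<open>a\<close>. For equal lengths this contradicts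
  \<open>a < b\<close>; for a shorter \<open>a\<close>, stability puts a proper prefix of
  \<open>b\<close> into the family, contradicting that \<open>b\<close> is a generator. Conversely a
  free variable lowers one letter of \<open>b\<close>, and the resulting word begins with an earlier
  generator.\<close>

lemma colon_earlier_gens:
  assumes fam: "stable_family (width n t) d L" and b: "b \<in> family_gens d L"
  shows "(\<exists>a\<in>{a \<in> family_gens d L. a < b}. \<exists>w. m + spread t b = spread t a + w)
    \<longleftrightarrow> keys m \<inter> free_vars t b \<noteq> {}"
proof -
  let ?l = "length b" and ?N = "width n t"
  note bD = family_gensD[OF fam b]
  show ?thesis
  proof
    assume "\<exists>a\<in>{a \<in> family_gens d L. a < b}. \<exists>w. m + spread t b = spread t a + w"
    then obtain a w where a: "a \<in> family_gens d L" "a < b" and w: "m + spread t b = spread t a + w" by blast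
    note aD = family_gensD[OF fam a(1)]
    have len: "length a \<le> ?l" using a(2) by (rule length_le_if_less)
    show "keys m \<inter> free_vars t b \<noteq> {}"
    proof
      assume e: "keys m \<inter> free_vars t b = {}"
      have dom: "b ! r \<le> a ! r" if "r < length a" for r
        using divides_imp_dominated[OF bD(3) aD(3), of t m w] w e that len by (simp add: add.commute)
      show False
      proof (cases "length a = ?l")
        case True
        then have "list_all2 (\<le>) b a" using dom by (simp add: list_all2_conv_all_nth)
        then show False using list_all2_imp_le a(2) by fastforce
      next
        case False
        then have lt: "length a < ?l" using len by simp
        have "take (length a) b \<in> words (?N (length a)) (length a)"
          using words_take[OF bD(3) len] width_antimono[OF len] by blast
        then have "take (length a) b \<in> L (length a)"
          using stable_family_down[OF fam aD(1,2)] dom by simp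
        moreover have "length a \<le> ?l - 1" "?l - 1 \<le> ?l" using lt by auto
        ultimately have "take (?l - 1) b \<in> L (?l - 1)"
          using stable_family_take[OF fam width_antimono bD(3) _ _ bD(1)] by blast
        then show False using bD(4) lt by (auto simp: butlast_conv_take)
      qed
    qed
  next
    assume "keys m \<inter> free_vars t b \<noteq> {}"
    then obtain x where x: "x \<in> keys m" "x \<in> free_vars t b" by blast
    then obtain r where r: "r < ?l" "(if r = 0 then 1 else b ! (r - 1)) + offs t r \<le> x" "x < b ! r + offs t r"
      by (auto simp: free_vars_def)
    \<comment> \<open>The free variable as a letter in position \<open>r\<close>; it lies between
      the neighbouring letters, so replacing \<open>b ! r\<close> by it keeps the word
      sorted.\<close>
    define y where "y = x - offs t r"
    have y: "x = y + offs t r" "(if r = 0 then 1 else b ! (r - 1)) \<le> y" "y < b ! r"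
      using r by (auto simp: y_def)
    define b' where "b' = b[r := y]"
    have sb: "sorted b" using bD(3) by (simp add: words_def)
    have y1: "1 \<le> y"
    proof (cases "r = 0")
      case False
      then have "1 \<le> b ! (r - 1)" using words_nth[OF bD(3), of "r - 1"] r(1) by simp
      then show ?thesis using y(2) False by simp
    qed (use y(2) in simp)
    have "sorted b'"
      unfolding sorted_iff_nth_mono
    proof (intro allI impI)
      fix i j assume ij: "i \<le> j" "j < length b'"
      have "b ! i \<le> y" if "i < r"
      proof -
        have "b ! i \<le> b ! (r - 1)" using that sb r(1) by (intro sorted_nth_mono) auto
        then show ?thesis using y(2) that by simp
      qed
      moreover have "y \<le> b ! j" if "r < j"
        using sorted_nth_mono[OF sb, of r j] that ij y(3) by (simp add: b'_def)
      moreover have "b ! i \<le> b ! j" using sorted_nth_mono[OF sb] ij by (simp add: b'_def)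
      ultimately show "b' ! i \<le> b' ! j" using ij r(1) by (auto simp: b'_def nth_list_update)
    qed
    moreover have "set b' \<subseteq> {1..?N ?l}"
      using set_update_subset_insert[of b r y] bD(3) y1 y(3) words_nth[OF bD(3) r(1)]
      by (fastforce simp: b'_def words_def)
    ultimately have b'w: "b' \<in> words (?N ?l) ?l" by (simp add: words_def b'_def)
    have "b' ! s \<le> b ! s" if "s < ?l" for s
      using that y(3) by (cases "s = r") (auto simp: b'_def)
    then have b'L: "b' \<in> L ?l" by (rule stable_family_down[OF fam bD(1,2) b'w])
    have b'b: "b' < b" using r(1) y(3) by (auto simp: list_less_nth b'_def intro!: exI[of _ r])
    \<comment> \<open>The lowered word need not be a generator itself. A proper prefix precedes
      \<open>b\<close> by length, the whole word precedes it lexicographically.\<close>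
    obtain k where k: "k \<le> ?l" "take k b' \<in> family_gens d L" "length (take k b') = k"
      using exists_gen_prefix[OF fam b'L bD(1)] by blast
    have "take k b' < b"
      using k b'b less_if_length_less[of "take k b'" b] by (cases "k = ?l") (auto simp: b'_def)
    moreover have "\<exists>w. m + spread t b = spread t (take k b') + w"
    proof -
      obtain w where w: "spread t b' = spread t (take k b') + w" using spread_take_divides by blast
      obtain m' where m': "m = single x 1 + m'" using x(1) single_divides_iff by blast
      have "m + spread t b = (spread t b + single x 1) + m'"
        unfolding m' by (simp add: add_ac)
      also have "spread t b + single x 1 = spread t b' + single (b ! r + offs t r) 1"
        using spread_update[OF r(1), of t y, symmetric] y(1) by (simp only: b'_def)
      finally have "m + spread t b = spread t (take k b') + (w + single (b ! r + offs t r) 1 + m')"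
        unfolding w by (simp only: add.assoc)
      then show ?thesis by blast
    qed
    ultimately show "\<exists>a\<in>{a \<in> family_gens d L. a < b}. \<exists>w. m + spread t b = spread t a + w"
      using k(2) by blast
  qed
qed

text \<open>The generators are added in the order of degree and, within a degree, lexicographically.
  Since degrees do not decrease, the mapping cones stay minimal.\<close>

lemma gens_resolution:
  assumes fam: "stable_family (width n t) d L"
  shows "finite A \<Longrightarrow> A \<subseteq> family_gens d L \<Longrightarrow> (\<And>a b. a \<in> A \<Longrightarrow> b \<in> family_gens d L \<Longrightarrow> b < a \<Longrightarrow> b \<in> A) \<Longrightarrow>
    \<exists>F :: 'k::field free_complex. exact_aug n (mideal n (spread t ` A)) F \<and> minimal F \<and>
      (\<forall>i j. card {k. k < frank F i \<and> shift F i k = j} = gens_betti A i j)"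
proof (induction A rule: finite_linorder_max_induct)
  case empty
  have "minimal zero_complex" by (simp add: minimal_def zero_complex_def)
  moreover have "card {k. k < frank zero_complex i \<and> shift zero_complex i k = j} = gens_betti {} i j" for i j
    by (simp add: zero_complex_def gens_betti_def)
  ultimately show ?case using exact_aug_zero_complex by (auto intro!: exI[of _ zero_complex])
next
  case (insert b A)
  have bG: "b \<in> family_gens d L" using insert.prems by simp
  note bD = family_gensD[OF fam bG]
  \<comment> \<open>Since \<open>insert b A\<close> contains every generator below its elements and
    \<open>b\<close> is its maximum, \<open>A\<close> consists of all earlier generators.\<close>
  have A: "A = {a \<in> family_gens d L. a < b}" using insert.prems insert.hyps(2) by fastforce
  have "\<exists>F :: 'k free_complex. exact_aug n (mideal n (spread t ` A)) F \<and> minimal F \<and>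
      (\<forall>i j. card {k. k < frank F i \<and> shift F i k = j} = gens_betti A i j)"
    using A by (intro insert.IH) auto
  then obtain F :: "'k free_complex" where F: "exact_aug n (mideal n (spread t ` A)) F" "minimal F"
    "\<And>i j. card {k. k < frank F i \<and> shift F i k = j} = gens_betti A i j" by blast
  obtain C :: "'k free_complex" where C: "exact_aug n (mideal n ((\<lambda>s. single s 1) ` free_vars t b)) C"
    "linear_complex C" "\<And>i. arank C i = card (free_vars t b) choose i"
    using variables_resolution[of "free_vars t b" n] card_free_vars[OF bD(3)] free_vars_subset[OF bD(3)] by blast
  \<comment> \<open>The degree bound is read off from the count: a basis element of this degree
    forces a generator \<open>a\<close> in \<open>A\<close> with \<open>length a + i\<close> equal
    to it, and earlier generators are not longer than \<open>b\<close>.\<close>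
  have Fs: "shift F i k \<le> int (mdeg (spread t b)) + int i" if "k < frank F i" for i k
  proof -
    have "k \<in> {k'. k' < frank F i \<and> shift F i k' = shift F i k}" using that by simp
    then have "card {k'. k' < frank F i \<and> shift F i k' = shift F i k} \<noteq> 0" by (auto simp: card_eq_0_iff)
    then have "gens_betti A i (shift F i k) \<noteq> 0" using F(3) by simp
    then obtain a where "a \<in> A" "int (length a + i) = shift F i k"
      unfolding gens_betti_def by (elim sum.not_neutral_contains_not_neutral) (auto split: if_splits)
    then show ?thesis using A length_le_if_less[of a b] by simp
  qed
  have "\<exists>E :: 'k free_complex. exact_aug n (mideal n (insert (spread t b) (spread t ` A))) E \<and> minimal E \<and>
    (\<forall>i. frank E i = frank F i + arank C i) \<and>
    (\<forall>i j. card {k. k < frank E i \<and> shift E i k = j} = card {k. k < frank F i \<and> shift F i k = j}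
       + (if int (mdeg (spread t b) + i) = j then arank C i else 0))"
  proof (rule mideal_insert_resolution[OF F(1) C(1,2) F(2) Fs keys_spread_subset[OF bD(3)]])
    fix m :: monomial
    show "(\<exists>a\<in>spread t ` A. \<exists>w. m + spread t b = a + w)
        \<longleftrightarrow> (\<exists>x\<in>(\<lambda>s. single s 1) ` free_vars t b. \<exists>w. m = x + w)"
      unfolding bex_simps single_divides_iff using colon_earlier_gens[OF fam bG, of m] unfolding A by blast
  qed
  then obtain E :: "'k free_complex" where E: "exact_aug n (mideal n (spread t ` insert b A)) E" "minimal E"
    "\<And>i j. card {k. k < frank E i \<and> shift E i k = j} = gens_betti A i j
       + (if int (length b + i) = j then arank C i else 0)" using F(3) by auto
  have "b \<notin> A" using A by simp
  then have "gens_betti (insert b A) i j = gens_betti A i j + (if int (length b + i) = j then arank C i else 0)" for i j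
    using insert.hyps(1) C(3) card_free_vars[OF bD(3)] by (simp add: gens_betti_def)
  then show ?case using E by (intro exI[of _ E]) simp
qed

theorem betti_stable_family:
  assumes fam: "stable_family (width n t) d L"
  shows "betti n (mideal n (spread t ` family_gens d L) :: 'k::field mpoly set) i j = gens_betti (family_gens d L) i j"
proof -
  obtain F :: "'k free_complex" where F: "exact_aug n (mideal n (spread t ` family_gens d L)) F" "minimal F"
      "\<And>i j. card {k. k < frank F i \<and> shift F i k = j} = gens_betti (family_gens d L) i j"
    using gens_resolution[OF fam finite_family_gens[OF fam] subset_refl] by blast
  then show ?thesis by (simp add: betti_eq)
qed

section \<open>Spread ideals as monomial ideals\<close>

lemma poly_ring_simps [simp]:
  "x \<otimes>\<^bsub>poly_ring n\<^esub> y = x * y" "x \<oplus>\<^bsub>poly_ring n\<^esub> y = x + y" "\<zero>\<^bsub>poly_ring n\<^esub> = 0" "\<one>\<^bsub>poly_ring n\<^esub> = 1"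
  by (simp_all add: poly_ring_def)

lemma ring_poly_ring: "ring (poly_ring n :: 'k::field mpoly ring)"
proof (rule ringI)
  show "abelian_group (poly_ring n :: 'k mpoly ring)"
  proof (rule abelian_groupI)
    fix x :: "'k mpoly" assume "x \<in> S n"
    then show "\<exists>y\<in>S n. y \<oplus>\<^bsub>poly_ring n\<^esub> x = \<zero>\<^bsub>poly_ring n\<^esub>"
      by (intro bexI[of _ "- x"]) auto
  qed (auto simp: add.assoc add.commute)
  show "Group.monoid (poly_ring n :: 'k mpoly ring)"
    by (rule monoidI) (auto simp: mult.assoc)
qed (auto simp: distrib_left distrib_right)

lemma ideal_mideal: "ideal (mideal n A :: 'k::field mpoly set) (poly_ring n)"
proof (rule idealI)
  interpret R: ring "poly_ring n :: 'k mpoly ring" by (rule ring_poly_ring)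
  show "ring (poly_ring n :: 'k mpoly ring)" by (rule ring_poly_ring)
  have neg: "\<ominus>\<^bsub>poly_ring n\<^esub> x = - x" if "x \<in> S n" for x :: "'k mpoly"
    using that by (intro R.minus_equality) auto
  show "subgroup (mideal n A :: 'k mpoly set) (add_monoid (poly_ring n))"
  proof
    show "(mideal n A :: 'k mpoly set) \<subseteq> carrier (add_monoid (poly_ring n))" by (auto simp: mideal_def)
    show "x \<otimes>\<^bsub>add_monoid (poly_ring n)\<^esub> y \<in> mideal n A" if "x \<in> mideal n A" "y \<in> mideal n A" for x y :: "'k mpoly"
      using mideal_add[OF that] by simp
    show "\<one>\<^bsub>add_monoid (poly_ring n)\<^esub> \<in> (mideal n A :: 'k mpoly set)" by (simp add: mideal_def)
    fix x :: "'k mpoly" assume x: "x \<in> mideal n A"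
    then have "x \<in> S n" by (simp add: mideal_def)
    then have "inv\<^bsub>add_monoid (poly_ring n)\<^esub> x = (- 1) * x" using neg by (simp add: a_inv_def)
    moreover have "(- 1) * x \<in> mideal n A" by (rule mideal_mult[OF x]) auto
    ultimately show "inv\<^bsub>add_monoid (poly_ring n)\<^esub> x \<in> mideal n A" by simp
  qed
next
  fix a x :: "'k mpoly" assume "a \<in> mideal n A" "x \<in> S n"
  then show "x \<otimes>\<^bsub>poly_ring n\<^esub> a \<in> mideal n A" "a \<otimes>\<^bsub>poly_ring n\<^esub> x \<in> mideal n A"
    using mideal_mult[of a n A x] by (simp_all add: mult.commute)
qed

lemma genideal_mono_polys:
  assumes A: "\<And>u. u \<in> A \<Longrightarrow> keys u \<subseteq> {1..n}"
  shows "Idl\<^bsub>poly_ring n\<^esub> (mono_poly ` A) = (mideal n A :: 'k::field mpoly set)"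
proof
  interpret R: ring "poly_ring n :: 'k mpoly ring" by (rule ring_poly_ring)
  have AS: "mono_poly ` A \<subseteq> (S n :: 'k mpoly set)" using A by (auto simp: mono_poly_S)
  have "mono_poly u \<in> (mideal n A :: 'k mpoly set)" if "u \<in> A" for u
    unfolding mono_poly_in_mideal using A that by (metis add.right_neutral)
  then show "Idl\<^bsub>poly_ring n\<^esub> (mono_poly ` A) \<subseteq> (mideal n A :: 'k mpoly set)"
    by (intro R.genideal_minimal ideal_mideal) blast
  let ?J = "Idl\<^bsub>poly_ring n\<^esub> (mono_poly ` A) :: 'k mpoly set"
  interpret J: ideal ?J "poly_ring n" using AS by (rule R.genideal_ideal)
  show "(mideal n A :: 'k mpoly set) \<subseteq> ?J"
  proof
    fix p :: "'k mpoly" assume p: "p \<in> mideal n A"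
    have "single m c \<in> ?J" if m: "m \<in> keys p" for m c
    proof -
      obtain u w where u: "u \<in> A" "m = u + w" using p m by (auto simp: mideal_def)
      have "keys m \<subseteq> {1..n}" using p m unfolding mideal_def in_S_iff by blast
      then have "keys w \<subseteq> {1..n}" by (simp add: u(2) keys_add_monomial)
      then have "single w c \<in> S n" by (simp add: in_S_iff)
      moreover have "mono_poly u \<in> ?J" using R.genideal_self[OF AS] u(1) by blast
      ultimately have "single w c \<otimes>\<^bsub>poly_ring n\<^esub> mono_poly u \<in> ?J" by (intro J.I_l_closed)
      then show ?thesis by (simp add: mult_single u(2) add.commute)
    qed
    then have "(\<Sum>m\<in>X. single m (lookup p m)) \<in> ?J" if "X \<subseteq> keys p" for X
      using that
    proof (induction X rule: infinite_finite_induct)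
      case (insert m X)
      then show ?case using J.a_closed by simp
    qed (use J.zero_closed in simp_all)
    then show "p \<in> ?J" using sum_monomials[of p] by (metis subset_refl)
  qed
qed

lemma mideal_subset:
  assumes "\<And>u. u \<in> B \<Longrightarrow> \<exists>v\<in>A. \<exists>w. u = v + w"
  shows "mideal n B \<subseteq> mideal n A"
proof
  fix p :: "'k::field mpoly" assume p: "p \<in> mideal n B"
  have "\<exists>v\<in>A. \<exists>w. m = v + w" if "m \<in> keys p" for m
  proof -
    obtain u w where "u \<in> B" "m = u + w" using p \<open>m \<in> keys p\<close> by (auto simp: mideal_def)
    then show ?thesis using assms by (metis add.assoc)
  qed
  then show "p \<in> mideal n A" using p by (simp add: mideal_def)
qed

text \<open>The degree \<open>l\<close> part of \<open>I\<close> in shifted coordinates. The bound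
  \<open>l \<le> d\<close> is imposed where levels are combined, as in
  \<open>family_monos\<close>.\<close>

definition spread_words :: "nat \<Rightarrow> nat list \<Rightarrow> 'k::field mpoly set \<Rightarrow> nat \<Rightarrow> nat list set" where
  "spread_words n t I l = {a \<in> words (width n t l) l. mono_poly (spread t a) \<in> I}"

definition family_monos :: "nat list \<Rightarrow> nat \<Rightarrow> (nat \<Rightarrow> nat list set) \<Rightarrow> monomial set" where
  "family_monos t d L = spread t ` (\<Union>l\<le>d. L l)"

lemma inj_on_spread: "inj_on (spread t) (words (width n t l) l)"
  by (rule inj_onI) (rule spread_inj[of _ n], auto simp: words_def)

lemma tspread_monos_eq: "tspread_monos n d t l = (if l \<le> d then spread t ` words (width n t l) l else {})"
proof -
  have "u \<in> tspread_monos n d t l \<longleftrightarrow> l \<le> d \<and> u \<in> spread t ` words (width n t l) l" for u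
  proof
    assume "u \<in> tspread_monos n d t l"
    then show "l \<le> d \<and> u \<in> spread t ` words (width n t l) l"
      unfolding tspread_monos_def tspread_iff by auto
  next
    assume "l \<le> d \<and> u \<in> spread t ` words (width n t l) l"
    then obtain a where a: "l \<le> d" "a \<in> words (width n t l) l" "u = spread t a" by blast
    then have "length a = l" by (simp add: words_def)
    then show "u \<in> tspread_monos n d t l" using a unfolding tspread_monos_def tspread_iff by auto
  qed
  then show ?thesis by auto
qed

lemma tspread_part_eq: "tspread_part n d t I l = (if l \<le> d then spread t ` spread_words n t I l else {})"
  by (auto simp: tspread_part_def tspread_monos_eq spread_words_def)

lemma tspread_keys: "tspread n d t u \<Longrightarrow> keys u \<subseteq> {1..n}"
  unfolding tspread_iff using keys_spread_subset by blast

lemma family_monos_keys: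
  "(\<And>l. l \<le> d \<Longrightarrow> L l \<subseteq> words (width n t l) l) \<Longrightarrow> u \<in> family_monos t d L \<Longrightarrow> keys u \<subseteq> {1..n}"
  unfolding family_monos_def using keys_spread_subset by blast

text \<open>All spread monomials of \<open>I\<close> serve as a canonical generating set.
  Consequently a spread ideal is determined by its levels, which gives the uniqueness of the lex
  ideal.\<close>

lemma tspread_ideal_eq:
  assumes "tspread_ideal n d t I"
  shows "I = mideal n (family_monos t d (spread_words n t I))"
proof -
  obtain G where G: "\<And>u. u \<in> G \<Longrightarrow> tspread n d t u" "I = Idl\<^bsub>poly_ring n\<^esub> (mono_poly ` G)"
    using assms unfolding tspread_ideal_def by blast
  have I: "I = mideal n G" unfolding G(2) using G(1) tspread_keys by (intro genideal_mono_polys) blast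
  show ?thesis
  proof
    have "u \<in> family_monos t d (spread_words n t I)" if u: "u \<in> G" for u
    proof -
      obtain a where a: "length a \<le> d" "a \<in> words (width n t (length a)) (length a)" "u = spread t a"
        using G(1)[OF u] unfolding tspread_iff by blast
      have "mono_poly u \<in> I"
        unfolding I mono_poly_in_mideal using u tspread_keys[OF G(1)[OF u]] by (metis add.right_neutral)
      then show ?thesis using a unfolding family_monos_def spread_words_def by blast
    qed
    then show "I \<subseteq> mideal n (family_monos t d (spread_words n t I))"
      by (subst I) (intro mideal_mono subsetI)
    show "mideal n (family_monos t d (spread_words n t I)) \<subseteq> I"
    proof (subst (2) I, rule mideal_subset)
      fix u assume "u \<in> family_monos t d (spread_words n t I)"
      then have "mono_poly u \<in> I" by (auto simp: family_monos_def spread_words_def)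
      then show "\<exists>v\<in>G. \<exists>w. u = v + w" unfolding I mono_poly_in_mideal by blast
    qed
  qed
qed

lemma tspread_ideal_mideal:
  assumes "\<And>l. l \<le> d \<Longrightarrow> L l \<subseteq> words (width n t l) l"
  shows "tspread_ideal n d t (mideal n (family_monos t d L) :: 'k::field mpoly set)"
  unfolding tspread_ideal_def
proof (intro exI[of _ "family_monos t d L"] conjI ballI)
  fix u assume "u \<in> family_monos t d L"
  then obtain l a where a: "l \<le> d" "a \<in> L l" "u = spread t a" by (auto simp: family_monos_def)
  then have "a \<in> words (width n t l) l" using assms by blast
  then show "tspread n d t u" using a unfolding tspread_iff by (auto simp: words_def)
next
  show "(mideal n (family_monos t d L) :: 'k mpoly set) = Idl\<^bsub>poly_ring n\<^esub> (mono_poly ` family_monos t d L)"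
    using family_monos_keys[OF assms] genideal_mono_polys by metis
qed

lemma spread_words_shad:
  assumes I: "tspread_ideal n d t I"
  shows "shad (width n t (Suc l)) l (spread_words n t I l) \<subseteq> spread_words n t I (Suc l)"
proof
  fix c assume c: "c \<in> shad (width n t (Suc l)) l (spread_words n t I l)"
  then have cw: "c \<in> words (width n t (Suc l)) (Suc l)" by (simp add: shad_def)
  have "butlast c = take l c" using cw by (simp add: butlast_conv_take words_def)
  then obtain w where w: "spread t c = spread t (butlast c) + w" using spread_take_divides by metis
  have "mono_poly (spread t (butlast c)) \<in> I" using c by (simp add: shad_def spread_words_def)
  then have "mono_poly (spread t c) \<in> I"
    using keys_spread_subset[OF cw] unfolding w
    by (subst (asm) tspread_ideal_eq[OF I], subst tspread_ideal_eq[OF I], unfold mono_poly_in_mideal)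
      (metis add.assoc)
  then show "c \<in> spread_words n t I (Suc l)" using cw by (simp add: spread_words_def)
qed

text \<open>A word below \<open>a\<close> is reached from \<open>a\<close> by lowering the letters one at a time from the left.\<close>

lemma strongly_stable_imp_stab:
  assumes st: "tspread_strongly_stable_set n d t l (tspread_part n d t I l)" and l: "l \<le> d"
  shows "stab (width n t l) l (spread_words n t I l)"
  unfolding stab_def
proof (intro conjI ballI impI)
  let ?N = "width n t l" and ?L = "spread_words n t I l"
  show "?L \<subseteq> words ?N l" by (auto simp: spread_words_def)
  fix a b assume a: "a \<in> ?L" and b: "b \<in> words ?N l" and ba: "list_all2 (\<le>) b a"
  have aw: "a \<in> words ?N l" using a by (simp add: spread_words_def)
  have len: "length a = l" "length b = l" "sorted a" "sorted b" using aw b by (auto simp: words_def)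
  have le: "b ! r \<le> a ! r" if "r < l" for r using ba that len by (simp add: list_all2_conv_all_nth)
  define c where "c k = take k b @ drop k a" for k
  have nth: "c k ! i = (if i < k then b ! i else a ! i)" if "k \<le> l" "i < l" for k i
    using that len by (auto simp: c_def nth_append min_def)
  have clen: "length (c k) = l" if "k \<le> l" for k using that len by (simp add: c_def)
  have cw: "c k \<in> words ?N l" if k: "k \<le> l" for k
  proof -
    \<comment> \<open>Across the seam \<open>b ! i \<le> b ! j \<le> a ! j\<close>; this is why the
      letters are lowered starting from the left.\<close>
    have "sorted (c k)"
      unfolding sorted_iff_nth_mono
    proof (intro allI impI)
      fix i j assume ij: "i \<le> j" "j < length (c k)"
      then have "a ! i \<le> a ! j" "b ! i \<le> b ! j" "b ! j \<le> a ! j"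
        using sorted_nth_mono[OF len(3)] sorted_nth_mono[OF len(4)] le len clen[OF k] by auto
      then show "c k ! i \<le> c k ! j" using ij nth[OF k] clen[OF k] by auto
    qed
    moreover have "set (c k) \<subseteq> set b \<union> set a" by (auto simp: c_def dest: in_set_takeD in_set_dropD)
    ultimately show ?thesis using aw b clen[OF k] by (auto simp: words_def)
  qed
  have "c k \<in> ?L" if "k \<le> l" for k
    using that
  proof (induction k)
    case 0
    then show ?case using a by (simp add: c_def)
  next
    case (Suc k)
    then have k: "k < l" and IH: "c k \<in> ?L" by auto
    have upd: "c (Suc k) = (c k)[k := b ! k]"
      using k clen by (intro nth_equalityI) (auto simp: nth nth_list_update)
    show ?case
    proof (cases "b ! k = a ! k")
      case True
      then have "c (Suc k) = c k" unfolding upd using nth[of k k] k by (metis less_or_eq_imp_le list_update_id less_irrefl)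
      then show ?thesis using IH by simp
    next
      case False
      let ?i = "a ! k + offs t k" and ?j = "b ! k + offs t k"
      have ckk: "c k ! k = a ! k" using nth[of k k] k by simp
      have i: "?i \<in> keys (spread t (c k))"
        unfolding keys_spread using k clen[of k] ckk by (intro exI[of _ k]) simp
      have j: "1 \<le> ?j" "?j < ?i" using words_nth[OF b k] le[OF k] False by auto
      obtain w where w: "spread t (c k) = single ?i 1 + w" using i single_divides_iff by blast
      have "spread t (c (Suc k)) + single ?i 1 = spread t (c k) + single ?j 1"
        unfolding upd using spread_update[of k "c k" t "b ! k"] k clen[of k] ckk by simp
      then have eq: "spread t (c (Suc k)) = w + single ?j 1"
        unfolding w by (metis (no_types, opaque_lifting) add.assoc add.commute add_left_imp_eq)
      have v: "(spread t (c k) - single ?i 1) + single ?j 1 = spread t (c (Suc k))"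
        unfolding eq w by simp
      have "spread t (c k) \<in> tspread_part n d t I l" using IH l by (simp add: tspread_part_eq)
      moreover have "tspread n d t (spread t (c (Suc k)))"
        using cw[of "Suc k"] clen[of "Suc k"] k l unfolding tspread_iff by (intro exI[of _ "c (Suc k)"]) simp
      ultimately have "spread t (c (Suc k)) \<in> tspread_part n d t I l"
        using st i j v unfolding tspread_strongly_stable_set_def Let_def by metis
      then have "mono_poly (spread t (c (Suc k))) \<in> I" by (simp add: tspread_part_def)
      then show ?thesis using cw[of "Suc k"] k by (simp add: spread_words_def)
    qed
  qed
  from this[of l] show "b \<in> ?L" using len by (simp add: c_def)
qed

lemma strongly_stable_ideal_family:
  assumes "tspread_strongly_stable_ideal n d t I"
  shows "stable_family (width n t) d (spread_words n t I)"
  unfolding stable_family_def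
  using assms strongly_stable_imp_stab spread_words_shad unfolding tspread_strongly_stable_ideal_def by blast

lemma mideal_family_gens:
  assumes fam: "stable_family (width n t) d L"
  shows "mideal n (family_monos t d L) = mideal n (spread t ` family_gens d L)"
proof
  show "mideal n (family_monos t d L) \<subseteq> mideal n (spread t ` family_gens d L)"
  proof (rule mideal_subset)
    fix u assume "u \<in> family_monos t d L"
    then obtain l a where a: "l \<le> d" "a \<in> L l" "u = spread t a" by (auto simp: family_monos_def)
    then obtain m where "take m a \<in> family_gens d L" using exists_gen_prefix[OF fam] by blast
    then show "\<exists>v\<in>spread t ` family_gens d L. \<exists>w. u = v + w"
      using spread_take_divides[of t a m] a(3) by blast
  qed
  have "family_gens d L \<subseteq> (\<Union>l\<le>d. L l)" by (auto simp: family_gens_def level_gens_def)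
  then show "mideal n (spread t ` family_gens d L) \<subseteq> mideal n (family_monos t d L)"
    unfolding family_monos_def by (intro mideal_mono image_mono)
qed

text \<open>The generated ideal contains no unexpected spread monomials. If
  \<open>spread t b\<close> divides \<open>spread t a\<close>, then domination with
  \<open>m = 0\<close> shows that the prefix of \<open>a\<close> of length \<open>length b\<close>
  lies below \<open>b\<close>, hence in the family, and shadows extend this to all of
  \<open>a\<close>.\<close>

lemma spread_words_mideal:
  assumes fam: "stable_family (width n t) d L" and l: "l \<le> d"
  shows "spread_words n t (mideal n (family_monos t d L) :: 'k::field mpoly set) l = L l"
proof
  show "L l \<subseteq> spread_words n t (mideal n (family_monos t d L) :: 'k mpoly set) l"
  proof
    fix a assume a: "a \<in> L l"
    then have aw: "a \<in> words (width n t l) l" using stable_family_words[OF fam l] by blast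
    have "spread t a \<in> family_monos t d L" using a l by (auto simp: family_monos_def)
    then have "mono_poly (spread t a) \<in> (mideal n (family_monos t d L) :: 'k mpoly set)"
      unfolding mono_poly_in_mideal using keys_spread_subset[OF aw] by (metis add.right_neutral)
    then show "a \<in> spread_words n t (mideal n (family_monos t d L) :: 'k mpoly set) l"
      using aw by (simp add: spread_words_def)
  qed
  show "spread_words n t (mideal n (family_monos t d L) :: 'k mpoly set) l \<subseteq> L l"
  proof
    fix a assume "a \<in> spread_words n t (mideal n (family_monos t d L) :: 'k mpoly set) l"
    then have aw: "a \<in> words (width n t l) l" and "mono_poly (spread t a) \<in> (mideal n (family_monos t d L) :: 'k mpoly set)"
      by (auto simp: spread_words_def)
    then obtain m b w where b: "m \<le> d" "b \<in> L m" and w: "spread t a = spread t b + w"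
      unfolding mono_poly_in_mideal family_monos_def by blast
    have bw: "b \<in> words (width n t m) m" using stable_family_words[OF fam b(1)] b(2) by blast
    have len: "length a = l" "length b = m" using aw bw by (auto simp: words_def)
    have ml: "m \<le> l" using arg_cong[OF w, of mdeg] len by (simp add: mdeg_add)
    have "a ! r \<le> b ! r" if "r < m" for r
      using divides_imp_dominated[OF aw bw, of t 0 w r] w that ml by simp
    moreover have tw: "take m a \<in> words (width n t m) m" using words_take[OF aw ml] width_antimono[OF ml] by blast
    ultimately have "take m a \<in> L m" using stable_family_down[OF fam b tw] by simp
    then have "take l a \<in> L l" by (intro stable_family_take[OF fam width_antimono aw ml order_refl l])
    then show "a \<in> L l" using len by simp
  qed
qed

section \<open>The lex ideal\<close>

lemma tspread_lex_set_iff: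
  assumes "l \<le> d"
  shows "tspread_lex_set n d t l (tspread_part n d t I l) \<longleftrightarrow> lexs (width n t l) l (spread_words n t I l)"
proof -
  let ?W = "words (width n t l) l" and ?L = "spread_words n t I l"
  have LW: "?L \<subseteq> ?W" by (auto simp: spread_words_def)
  have mem: "spread t b \<in> spread t ` ?L \<longleftrightarrow> b \<in> ?L" if "b \<in> ?W" for b
    using inj_on_image_mem_iff[OF inj_on_spread that LW] .
  have "tspread_lex_set n d t l (tspread_part n d t I l) \<longleftrightarrow>
      (\<forall>a\<in>?L. \<forall>b\<in>?W. spread t a \<le> spread t b \<longrightarrow> spread t b \<in> spread t ` ?L)"
    using assms LW by (auto simp: tspread_lex_set_def tspread_part_eq tspread_monos_eq)
  also have "\<dots> \<longleftrightarrow> (\<forall>a\<in>?L. \<forall>b\<in>?W. b \<le> a \<longrightarrow> b \<in> ?L)"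
  proof (intro ball_cong refl)
    fix a b assume "a \<in> ?L" and b: "b \<in> ?W"
    then have "a \<in> ?W" using LW by blast
    then show "(spread t a \<le> spread t b \<longrightarrow> spread t b \<in> spread t ` ?L) \<longleftrightarrow> (b \<le> a \<longrightarrow> b \<in> ?L)"
      using spread_le_iff[of a "width n t l" l b t] mem[OF b] b by simp
  qed
  finally show ?thesis using LW by (simp add: lexs_def)
qed

text \<open>Each level is contained in the finite set of all words, so the truncated differences
  determine the subtracted cardinalities.\<close>

lemma f_vector_eq_iff:
  fixes I J :: "'k::field mpoly set"
  shows "f_vector n d t J = f_vector n d t I \<longleftrightarrow> (\<forall>l\<le>d. card (spread_words n t J l) = card (spread_words n t I l))"
proof -
  have c: "card (tspread_monos n d t l) = card (words (width n t l) l)"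
    "card (tspread_part n d t I l) = card (spread_words n t I l)"
    "card (spread_words n t I l) \<le> card (words (width n t l) l)" if "l \<le> d" for l and I :: "'k mpoly set"
  proof -
    have LW: "spread_words n t I l \<subseteq> words (width n t l) l" by (auto simp: spread_words_def)
    show "card (tspread_monos n d t l) = card (words (width n t l) l)"
      using that inj_on_spread by (simp add: tspread_monos_eq card_image)
    show "card (tspread_part n d t I l) = card (spread_words n t I l)"
      using that inj_on_subset[OF inj_on_spread LW] by (simp add: tspread_part_eq card_image)
    show "card (spread_words n t I l) \<le> card (words (width n t l) l)" using LW by (simp add: card_mono)
  qed
  have "f_vector n d t J = f_vector n d t I \<longleftrightarrow>
      (\<forall>l\<le>d. card (tspread_monos n d t l) - card (tspread_part n d t J l)
           = card (tspread_monos n d t l) - card (tspread_part n d t I l))"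
    unfolding f_vector_def map_eq_conv set_upt by (auto simp: less_Suc_eq_le)
  also have "\<dots> \<longleftrightarrow> (\<forall>l\<le>d. card (spread_words n t J l) = card (spread_words n t I l))"
  proof (intro all_cong)
    fix l assume l: "l \<le> d"
    show "(card (tspread_monos n d t l) - card (tspread_part n d t J l)
           = card (tspread_monos n d t l) - card (tspread_part n d t I l))
        \<longleftrightarrow> card (spread_words n t J l) = card (spread_words n t I l)"
      using c(3)[OF l, of I] c(3)[OF l, of J] unfolding c(1)[OF l] c(2)[OF l] by linarith
  qed
  finally show ?thesis .
qed

text \<open>For uniqueness, any competitor has lex levels of the same cardinalities; these coincide
  with \<open>M\<close>, and the levels determine the ideal.\<close>

lemma lex_ideal_of_eq:
  fixes I :: "'k::field mpoly set"
  assumes M: "stable_family (width n t) d M" and lex: "\<And>l. l \<le> d \<Longrightarrow> lexs (width n t l) l (M l)"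
    and card: "\<And>l. l \<le> d \<Longrightarrow> card (M l) = card (spread_words n t I l)"
  shows "lex_ideal_of n d t I = mideal n (family_monos t d M)"
  unfolding lex_ideal_of_def
proof (rule the_equality)
  let ?J = "mideal n (family_monos t d M) :: 'k mpoly set"
  have J: "spread_words n t ?J l = M l" if "l \<le> d" for l using spread_words_mideal[OF M that] .
  have "tspread_lex_set n d t l (tspread_part n d t ?J l)" for l
  proof (cases "l \<le> d")
    case True
    then show ?thesis using tspread_lex_set_iff[OF True] J lex by metis
  next
    case False
    then show ?thesis by (simp add: tspread_part_eq tspread_lex_set_def)
  qed
  moreover have "tspread_ideal n d t ?J" using stable_family_words[OF M] by (rule tspread_ideal_mideal)
  ultimately show "tspread_lex_ideal n d t ?J \<and> f_vector n d t ?J = f_vector n d t I"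
    using J card by (simp add: tspread_lex_ideal_def f_vector_eq_iff)
  fix J' :: "'k mpoly set" assume J': "tspread_lex_ideal n d t J' \<and> f_vector n d t J' = f_vector n d t I"
  have "spread_words n t J' l = M l" if "l \<le> d" for l
  proof -
    have "lexs (width n t l) l (spread_words n t J' l)"
      using J' tspread_lex_set_iff[OF that] unfolding tspread_lex_ideal_def by blast
    moreover have "card (spread_words n t J' l) = card (M l)"
      using J' card that by (simp add: f_vector_eq_iff)
    ultimately show ?thesis using lexs_card_le_imp_subset lex[OF that] by (metis order_refl subset_antisym)
  qed
  then have "family_monos t d (spread_words n t J') = family_monos t d M" by (simp add: family_monos_def)
  then show "J' = ?J" using J' tspread_ideal_eq[of n d t J'] by (simp add: tspread_lex_ideal_def)
qed

theorem theorem5p1: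
  fixes n d :: nat and t :: "nat list" and I :: "'k::field mpoly set"
  assumes "d \<ge> 2" and "length t = d - 1"
    and "tspread_strongly_stable_ideal n d t I"
  shows "\<forall>(i::nat) (j::int). betti n I i j \<le> betti n (lex_ideal_of n d t I) i j"
proof (intro allI)
  fix i :: nat and j :: int
  let ?L = "spread_words n t I"
  have fam: "stable_family (width n t) d ?L" using assms(3) by (rule strongly_stable_ideal_family)
  have width: "width n t (Suc l) \<le> width n t l" for l by (rule width_antimono) simp
  obtain M where M: "stable_family (width n t) d M" "\<And>l. l \<le> d \<Longrightarrow> lexs (width n t l) l (M l)"
    "\<And>l. l \<le> d \<Longrightarrow> card (M l) = card (?L l)"
    using lex_family_exists[OF fam width] by blast
  have "I = mideal n (family_monos t d ?L)"
    using assms(3) by (intro tspread_ideal_eq) (simp add: tspread_strongly_stable_ideal_def)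
  then have "betti n I i j = gens_betti (family_gens d ?L) i j"
    using mideal_family_gens[OF fam] betti_stable_family[OF fam] by metis
  also have "\<dots> \<le> gens_betti (family_gens d M) i j"
    using gens_betti_le[OF fam M(1) width M(2,3)] .
  finally have le: "betti n I i j \<le> gens_betti (family_gens d M) i j" .
  have "lex_ideal_of n d t I = mideal n (spread t ` family_gens d M)"
    using lex_ideal_of_eq[OF M] mideal_family_gens[OF M(1)] by simp
  then show "betti n I i j \<le> betti n (lex_ideal_of n d t I) i j"
    using le by (simp add: betti_stable_family[OF M(1)])
qed

end
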